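(* Let $X$ and $Y$ be simplicial complexes, and suppose the vertex set $V=X_0$ of $X$ is finite. Let $\mathrm{SCplx}_V$ be the poset of simplicial complexes over $V$, and consider the functor $$F\colon\mathrm{SCplx}_V^{\mathrm{op}}\to\mathsf{Spaces},\qquad Z\mapsto|\mathbf{Hom}(Z,Y)|,$$ where $\mathbf{Hom}(Z,Y)$ is the internal hom simplicial complex. Then for every $Z\in\mathrm{SCplx}_V$ there is a weak equivalence $$T^1F(Z)\simeq\mathbf{Hom}(|Z|,|Y|),$$ where on the right $\mathbf{Hom}$ denotes the internal hom (mapping space) in $\mathsf{Spaces}$.
   Context: $\mathsf{Spaces}$ is the category of compactly generated topological spaces with the Quillen model structure, and $|-|$ is geometric realization of simplicial complexes. Simplicial complexes contain the empty simplex. A simplicial complex over $V$ is a subset $Z\subseteq\mathcal{P}(V)$ with $\emptyset\in Z$ and closed under taking subsets; $\mathrm{SCplx}_V$ is the set of these, ordered by inclusion (a distributive lattice with join $\cup$ and meet $\cap$). A simplicial map $Z\to Y$ is a function $f\colon Z_0\to Y_0$ between vertex sets with $f(\sigma)\in Y$ for every $\sigma\in Z$. Internal hom of simplicial complexes: the vertices of $\mathbf{Hom}(Z,Y)$ are the simplicial maps $Z\to Y$, and $\{f_0,\dots,f_m\}$ is a simplex of $\mathbf{Hom}(Z,Y)$ if and only if $\bigcup_{i=0}^m f_i(\sigma)\in Y$ for every $\sigma\in Z$. Degree 1 approximation: for a functor $F\colon P^{\mathrm{op}}\to\mathsf{Spaces}$, with $P$ a finite distributive lattice, $T^1F(x)=\operatorname{holim}_{v\in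 P_{\le 1},\,v\le x}F(v)$, where $\le$ is the order of $P$ and $P_{\le 1}$ is the subposet of elements of join-dimension $\le 1$, i.e. of join-irreducible elements (those $v$ for which there are no $x,y<v$ with $v=x\vee y$; this includes the minimal element). This is the homotopy right Kan extension of $F|_{P_{\le 1}^{\mathrm{op}}}$, dual to the codegree 1 approximation. *)

theory Defs
  imports "HOL-Analysis.Analysis"
begin

section \<open>Abstract simplicial complexes\<close>

text \<open>As usual simplices are finite; the empty set is always a simplex.\<close>

definition scomplex :: "'a set set \<Rightarrow> bool" where
  "scomplex K \<longleftrightarrow> {} \<in> K \<and> (\<forall>\<sigma>\<in>K. finite \<sigma>) \<and> (\<forall>\<sigma>\<in>K. \<forall>\<tau>. \<tau> \<subseteq> \<sigma> \<longrightarrow> \<tau> \<in> K)"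

definition verts :: "'a set set \<Rightarrow> 'a set" where
  "verts K = {v. {v} \<in> K}"

text \<open>A complex over \<open>V\<close> need not contain every element of \<open>V\<close> as a vertex.
  The order is inclusion, join and meet are union and intersection, so this is a
  sublattice of the distributive lattice given by the type of sets of sets.\<close>

definition SCplx :: "'a set \<Rightarrow> 'a set set set" where
  "SCplx V = {Z. Z \<subseteq> Pow V \<and> {} \<in> Z \<and> (\<forall>\<sigma>\<in>Z. \<forall>\<tau>. \<tau> \<subseteq> \<sigma> \<longrightarrow> \<tau> \<in> Z)}"

text \<open>Maps defined on the vertex set only are represented by extensional functions.\<close>

definition simplicial_maps :: "'a set set \<Rightarrow> 'b set set \<Rightarrow> ('a \<Rightarrow> 'b) set" where
  "simplicial_maps Z Y = {f \<in> verts Z \<rightarrow>\<^sub>E verts Y. \<forall>\<sigma>\<in>Z. f ` \<sigma> \<in> Y}"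

definition hom_complex :: "'a set set \<Rightarrow> 'b set set \<Rightarrow> ('a \<Rightarrow> 'b) set set" where
  "hom_complex Z Y =
     {S. finite S \<and> S \<subseteq> simplicial_maps Z Y \<and> (\<forall>\<sigma>\<in>Z. (\<Union>f\<in>S. f ` \<sigma>) \<in> Y)}"


section \<open>Geometric realization\<close>

text \<open>Points are barycentric coordinates.\<close>

definition realization_points :: "'a set set \<Rightarrow> ('a \<Rightarrow> real) set" where
  "realization_points K =
     {t. (\<forall>v. 0 \<le> t v) \<and> finite {v. t v \<noteq> 0} \<and> {v. t v \<noteq> 0} \<in> K \<and> (\<Sum>v | t v \<noteq> 0. t v) = 1}"

definition closed_cell :: "'a set \<Rightarrow> ('a \<Rightarrow> real) set" where
  "closed_cell \<sigma> = {t. (\<forall>v. 0 \<le> t v) \<and> (\<forall>v. v \<notin> \<sigma> \<longrightarrow> t v = 0) \<and> (\<Sum>v\<in>\<sigma>. t v) = 1}"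

text \<open>The weak (coherent) topology.  A closed simplex carries the subspace topology from the
  product topology on functions, which is its Euclidean topology as the simplex is finite.\<close>

definition realization :: "'a set set \<Rightarrow> ('a \<Rightarrow> real) topology" where
  "realization K =
     topology (\<lambda>U. U \<subseteq> realization_points K \<and>
       (\<forall>\<sigma>\<in>K. openin (top_of_set (closed_cell \<sigma>)) (U \<inter> closed_cell \<sigma>)))"

definition realization_map :: "('a \<Rightarrow> 'b) \<Rightarrow> ('a \<Rightarrow> real) \<Rightarrow> 'b \<Rightarrow> real" where
  "realization_map g t = (\<lambda>w. \<Sum>v | t v \<noteq> 0 \<and> g v = w. t v)"

lemma openin_realization:
  "openin (realization K) U \<longleftrightarrow>
     U \<subseteq> realization_points K \<and>
     (\<forall>\<sigma>\<in>K. openin (top_of_set (closed_cell \<sigma>)) (U \<inter> closed_cell \<sigma>))"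
proof -
  let ?L = "\<lambda>U. U \<subseteq> realization_points K \<and>
     (\<forall>\<sigma>\<in>K. openin (top_of_set (closed_cell \<sigma>)) (U \<inter> closed_cell \<sigma>))"
  have "istopology ?L"
    unfolding istopology_def
  proof (intro conjI allI impI ballI)
    fix S T assume S: "?L S" and T: "?L T"
    show "S \<inter> T \<subseteq> realization_points K" using S by blast
    fix \<sigma> assume "\<sigma> \<in> K"
    then have "openin (top_of_set (closed_cell \<sigma>)) ((S \<inter> closed_cell \<sigma>) \<inter> (T \<inter> closed_cell \<sigma>))"
      by (intro openin_Int[OF S[THEN conjunct2, rule_format] T[THEN conjunct2, rule_format]])
    moreover have "(S \<inter> closed_cell \<sigma>) \<inter> (T \<inter> closed_cell \<sigma>) = S \<inter> T \<inter> closed_cell \<sigma>"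
      by blast
    ultimately show "openin (top_of_set (closed_cell \<sigma>)) (S \<inter> T \<inter> closed_cell \<sigma>)"
      by (simp only:)
  next
    fix \<K> assume K: "\<forall>S\<in>\<K>. ?L S"
    show "\<Union>\<K> \<subseteq> realization_points K" using K by blast
    fix \<sigma> assume "\<sigma> \<in> K"
    then have "openin (top_of_set (closed_cell \<sigma>)) (\<Union>S\<in>\<K>. S \<inter> closed_cell \<sigma>)"
      using K by (intro openin_Union) blast
    moreover have "(\<Union>S\<in>\<K>. S \<inter> closed_cell \<sigma>) = \<Union>\<K> \<inter> closed_cell \<sigma>"
      by blast
    ultimately show "openin (top_of_set (closed_cell \<sigma>)) (\<Union>\<K> \<inter> closed_cell \<sigma>)"
      by (simp only:)
  qed
  then show ?thesis
    unfolding realization_def by (simp only: topology_inverse')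
qed

lemma closed_cell_subset_realization:
  assumes "scomplex K" "\<sigma> \<in> K"
  shows "closed_cell \<sigma> \<subseteq> realization_points K"
proof
  fix t assume t: "t \<in> closed_cell \<sigma>"
  have fin: "finite \<sigma>" using assms by (auto simp: scomplex_def)
  have sub: "{v. t v \<noteq> 0} \<subseteq> \<sigma>" using t by (auto simp: closed_cell_def)
  have "(\<Sum>v | t v \<noteq> 0. t v) = (\<Sum>v\<in>\<sigma>. t v)"
    by (rule sum.mono_neutral_left) (use fin sub in auto)
  then show "t \<in> realization_points K"
    using t sub finite_subset[OF sub fin] assms
    by (simp add: realization_points_def closed_cell_def scomplex_def)
qed

lemma topspace_realization:
  assumes "scomplex K"
  shows "topspace (realization K) = realization_points K"
proof
  show "topspace (realization K) \<subseteq> realization_points K"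
    by (metis openin_realization openin_topspace)
  have "realization_points K \<inter> closed_cell \<sigma> = closed_cell \<sigma>" if "\<sigma> \<in> K" for \<sigma>
    using closed_cell_subset_realization[OF assms that] by blast
  then have "openin (realization K) (realization_points K)"
    unfolding openin_realization by simp
  then show "realization_points K \<subseteq> topspace (realization K)"
    by (rule openin_subset)
qed


section \<open>Compactly generated spaces and mapping spaces\<close>

text \<open>The operation \<open>kification\<close> tests on compact subsets.  All spaces it is applied to below are
  Hausdorff, where this agrees with testing on continuous maps from compact Hausdorff spaces.\<close>

definition mapping_points :: "'a topology \<Rightarrow> 'b topology \<Rightarrow> ('a \<Rightarrow> 'b) set" where
  "mapping_points X Y = {f \<in> extensional (topspace X). continuous_map X Y f}"

definition compact_open_topology :: "'a topology \<Rightarrow> 'b topology \<Rightarrow> ('a \<Rightarrow> 'b) topology" where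
  "compact_open_topology X Y =
     topology_generated_by {{f \<in> mapping_points X Y. f ` C \<subseteq> U} | C U. compactin X C \<and> openin Y U}"

definition mapping_space :: "'a topology \<Rightarrow> 'b topology \<Rightarrow> ('a \<Rightarrow> 'b) topology" where
  "mapping_space X Y = kification (compact_open_topology X Y)"

lemma topspace_mapping_space [simp]: "topspace (mapping_space X Y) = mapping_points X Y"
proof -
  let ?B = "{{f \<in> mapping_points X Y. f ` C \<subseteq> U} | C U. compactin X C \<and> openin Y U}"
  have "mapping_points X Y = {f \<in> mapping_points X Y. f ` {} \<subseteq> {}} \<and> compactin X {} \<and> openin Y {}"
    by simp
  then have "mapping_points X Y \<in> ?B"
    unfolding mem_Collect_eq by (intro exI)
  then have "mapping_points X Y \<subseteq> \<Union>?B"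
    by (rule Union_upper)
  moreover have "\<Union>?B \<subseteq> mapping_points X Y"
    by (rule Union_least) auto
  ultimately show ?thesis
    unfolding mapping_space_def compact_open_topology_def
      topspace_kification topology_generated_by_topspace by (simp only: set_eq_subset)
qed


section \<open>Weak equivalences\<close>

definition sphere_base :: "nat \<Rightarrow> real" where
  "sphere_base = (\<lambda>i. if i = 0 then 1 else 0)"

definition pointed_class ::
    "nat \<Rightarrow> 'a topology \<Rightarrow> 'a \<Rightarrow> ((nat \<Rightarrow> real) \<Rightarrow> 'a) \<Rightarrow> ((nat \<Rightarrow> real) \<Rightarrow> 'a) set" where
  "pointed_class n X x g = {h. homotopic_with (\<lambda>k. k sphere_base = x) (nsphere n) X g h}"

text \<open>The underlying set of the homotopy group: pointed homotopy classes of maps of the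
  \<open>n\<close>-sphere.\<close>

definition homotopy_group :: "nat \<Rightarrow> 'a topology \<Rightarrow> 'a \<Rightarrow> ((nat \<Rightarrow> real) \<Rightarrow> 'a) set set" where
  "homotopy_group n X x =
     pointed_class n X x ` {g. continuous_map (nsphere n) X g \<and> g sphere_base = x}"

definition homotopy_group_map ::
    "nat \<Rightarrow> 'b topology \<Rightarrow> ('a \<Rightarrow> 'b) \<Rightarrow> 'a \<Rightarrow>
     ((nat \<Rightarrow> real) \<Rightarrow> 'a) set \<Rightarrow> ((nat \<Rightarrow> real) \<Rightarrow> 'b) set" where
  "homotopy_group_map n Y f x c = (\<Union>g\<in>c. pointed_class n Y (f x) (f \<circ> g))"

definition path_components_map :: "'b topology \<Rightarrow> ('a \<Rightarrow> 'b) \<Rightarrow> 'a set \<Rightarrow> 'b set" where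
  "path_components_map Y f c = (\<Union>x\<in>c. path_component_of_set Y (f x))"

text \<open>The maps induced on homotopy groups are homomorphisms for every continuous map, so
  bijectivity amounts to their being isomorphisms.\<close>

definition weak_equivalence :: "'a topology \<Rightarrow> 'b topology \<Rightarrow> ('a \<Rightarrow> 'b) \<Rightarrow> bool" where
  "weak_equivalence X Y f \<longleftrightarrow>
     continuous_map X Y f \<and>
     bij_betw (path_components_map Y f) (path_components_of X) (path_components_of Y) \<and>
     (\<forall>n\<ge>1. \<forall>x\<in>topspace X.
        bij_betw (homotopy_group_map n Y f x) (homotopy_group n X x) (homotopy_group n Y (f x)))"

text \<open>Isomorphism in the homotopy category, i.e. being joined by a zigzag of weak equivalences.
  Every such zigzag can be replaced by a span out of a CW approximation \<open>W\<close> of \<open>X\<close>, such as the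
  realization of the singular set of \<open>X\<close>.  The type of the points of \<open>W\<close> is large enough for
  that space: its cardinality is at least that of the set of all functions from the reals
  (hence from any standard simplex) to \<open>X\<close>.\<close>

definition weakly_equivalent :: "'a topology \<Rightarrow> 'b topology \<Rightarrow> bool" where
  "weakly_equivalent X Y \<longleftrightarrow>
     (\<exists>(W :: (real \<Rightarrow> 'a + 'b) topology) p q.
        k_space W \<and> Hausdorff_space W \<and> weak_equivalence W X p \<and> weak_equivalence W Y q)"


section \<open>Homotopy limits over opposites of finite posets\<close>

definition order_complex :: "'p::order set \<Rightarrow> 'p set set" where
  "order_complex J = {C. finite C \<and> C \<subseteq> J \<and> (\<forall>a\<in>C. \<forall>b\<in>C. a \<le> b \<or> b \<le> a)}"

text \<open>A functor on the opposite of a poset is given by its values \<open>F i\<close> and by the maps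
  \<open>r i j\<close> from \<open>F j\<close> to \<open>F i\<close> for \<open>i \<le> j\<close>.  Its homotopy limit over the opposite of \<open>J\<close> is given
  by the formula of Bousfield and Kan (no fibrant replacement is needed for spaces): the space of
  natural transformations from the nerves of the slice categories to \<open>F\<close>.  In the opposite of
  \<open>J\<close> the slice over \<open>i\<close> is the opposite of the subposet of the elements above \<open>i\<close>, whose nerve
  is realized by the order complex.\<close>

definition up_nerve :: "'p::order set \<Rightarrow> 'p \<Rightarrow> ('p \<Rightarrow> real) topology" where
  "up_nerve J i = realization (order_complex {j \<in> J. i \<le> j})"

definition holim_op ::
    "'p::order set \<Rightarrow> ('p \<Rightarrow> 'a topology) \<Rightarrow> ('p \<Rightarrow> 'p \<Rightarrow> 'a \<Rightarrow> 'a) \<Rightarrow>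
     ('p \<Rightarrow> ('p \<Rightarrow> real) \<Rightarrow> 'a) topology" where
  "holim_op J F r =
     kification (subtopology
       (product_topology (\<lambda>i. mapping_space (up_nerve J i) (F i)) J)
       {\<phi>. \<forall>i\<in>J. \<forall>j\<in>J. i \<le> j \<longrightarrow> (\<forall>p\<in>topspace (up_nerve J j). \<phi> i p = r i j (\<phi> j p))})"


section \<open>Degree 1 approximation\<close>

text \<open>A finite distributive lattice is given as a finite sublattice \<open>P\<close> of a type of class
  \<open>distrib_lattice\<close>.  The least element counts as join-irreducible.\<close>

definition join_irreducibles :: "'p::distrib_lattice set \<Rightarrow> 'p set" where
  "join_irreducibles P = {v \<in> P. \<not> (\<exists>x\<in>P. \<exists>y\<in>P. x < v \<and> y < v \<and> v = sup x y)}"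

definition T1 ::
    "'p::distrib_lattice set \<Rightarrow> ('p \<Rightarrow> 'a topology) \<Rightarrow> ('p \<Rightarrow> 'p \<Rightarrow> 'a \<Rightarrow> 'a) \<Rightarrow> 'p \<Rightarrow>
     ('p \<Rightarrow> ('p \<Rightarrow> real) \<Rightarrow> 'a) topology" where
  "T1 P F r x = holim_op {v \<in> join_irreducibles P. v \<le> x} F r"


section \<open>The functor sending a complex to the realization of its internal hom into Y\<close>

definition hom_functor :: "'w set set \<Rightarrow> 'v set set \<Rightarrow> (('v \<Rightarrow> 'w) \<Rightarrow> real) topology" where
  "hom_functor Y Z = realization (hom_complex Z Y)"

definition hom_functor_map ::
    "'v set set \<Rightarrow> 'v set set \<Rightarrow> (('v \<Rightarrow> 'w) \<Rightarrow> real) \<Rightarrow> ('v \<Rightarrow> 'w) \<Rightarrow> real" where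
  "hom_functor_map Z Z' = realization_map (\<lambda>f. restrict f (verts Z))"

lemma sup_inf_SCplx:
  assumes "Z \<in> SCplx V" "Z' \<in> SCplx V"
  shows "sup Z Z' \<in> SCplx V" "inf Z Z' \<in> SCplx V"
  using assms by (auto simp: SCplx_def)

lemma finite_SCplx: "finite V \<Longrightarrow> finite (SCplx V)"
  by (rule finite_subset[of _ "Pow (Pow V)"]) (auto simp: SCplx_def)

lemma scomplex_SCplx: "finite V \<Longrightarrow> Z \<in> SCplx V \<Longrightarrow> scomplex Z"
  by (auto simp: scomplex_def SCplx_def dest: finite_subset[of _ V])

lemma scomplex_order_complex: "scomplex (order_complex J)"
  by (simp add: scomplex_def order_complex_def subset_iff) (meson finite_subset subsetI)

lemma scomplex_hom_complex:
  assumes "scomplex Y"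
  shows "scomplex (hom_complex Z Y)"
proof -
  have fin: "finite \<sigma>" if "\<sigma> \<in> hom_complex Z Y" for \<sigma>
    using that by (simp add: hom_complex_def)
  have down: "T \<in> hom_complex Z Y" if S: "S \<in> hom_complex Z Y" and T: "T \<subseteq> S" for S T
  proof -
    have "(\<Union>f\<in>T. f ` \<sigma>) \<in> Y" if "\<sigma> \<in> Z" for \<sigma>
    proof -
      have "(\<Union>f\<in>S. f ` \<sigma>) \<in> Y" using S that by (simp add: hom_complex_def)
      moreover have "(\<Union>f\<in>T. f ` \<sigma>) \<subseteq> (\<Union>f\<in>S. f ` \<sigma>)" using T by (rule UN_mono) simp
      ultimately show ?thesis using assms by (simp add: scomplex_def)
    qed
    moreover have "finite T" using fin[OF S] T by (rule rev_finite_subset)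
    moreover have "T \<subseteq> simplicial_maps Z Y" using S T by (auto simp: hom_complex_def)
    ultimately show ?thesis by (simp add: hom_complex_def)
  qed
  have "{} \<in> hom_complex Z Y" using assms by (simp add: hom_complex_def scomplex_def)
  with fin down show ?thesis unfolding scomplex_def by blast
qed

lemma verts_hom_complex:
  "verts (hom_complex Z Y) = simplicial_maps Z Y"
  by (auto simp: verts_def hom_complex_def simplicial_maps_def)

lemma restrict_simplicial:
  assumes "Z \<subseteq> Z'" "Z \<in> SCplx V" "S \<in> hom_complex Z' Y"
  shows "(\<lambda>f. restrict f (verts Z)) ` S \<in> hom_complex Z Y"
proof -
  have sub: "\<sigma> \<subseteq> verts Z" if "\<sigma> \<in> Z" for \<sigma>
    using assms(2) that by (auto simp: SCplx_def verts_def)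
  have v: "verts Z \<subseteq> verts Z'" using assms(1) by (auto simp: verts_def)
  have img: "restrict f (verts Z) ` \<sigma> = f ` \<sigma>" if "\<sigma> \<in> Z" for f :: "'a \<Rightarrow> 'b" and \<sigma>
    using sub[OF that] by (force simp: restrict_def)
  have "restrict f (verts Z) \<in> simplicial_maps Z Y" if "f \<in> simplicial_maps Z' Y" for f
  proof -
    have "restrict f (verts Z) \<in> verts Z \<rightarrow>\<^sub>E verts Y"
      using that v by (auto simp: simplicial_maps_def)
    moreover have "\<forall>\<sigma>\<in>Z. restrict f (verts Z) ` \<sigma> \<in> Y"
    proof
      fix \<sigma> assume "\<sigma> \<in> Z"
      then have "f ` \<sigma> \<in> Y" using that assms(1) by (auto simp: simplicial_maps_def)
      then show "restrict f (verts Z) ` \<sigma> \<in> Y" using img[OF \<open>\<sigma> \<in> Z\<close>] by metis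
    qed
    ultimately show ?thesis by (simp add: simplicial_maps_def)
  qed
  moreover have "(\<Union>f\<in>(\<lambda>f. restrict f (verts Z)) ` S. f ` \<sigma>) \<in> Y" if "\<sigma> \<in> Z" for \<sigma>
  proof -
    have "(\<Union>f\<in>(\<lambda>f. restrict f (verts Z)) ` S. f ` \<sigma>) = (\<Union>f\<in>S. f ` \<sigma>)"
      unfolding UN_simps(10) img[OF that] ..
    then show ?thesis using that assms(1,3) by (auto simp: hom_complex_def)
  qed
  ultimately show ?thesis
    using assms(3) unfolding hom_complex_def by blast
qed

lemma realization_map_in_closed_cell:
  assumes fin: "finite \<sigma>" and t: "t \<in> closed_cell \<sigma>"
  shows "realization_map g t = (\<lambda>w. \<Sum>v \<in> {v \<in> \<sigma>. g v = w}. t v)"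
    and "realization_map g t \<in> closed_cell (g ` \<sigma>)"
proof -
  show eq: "realization_map g t = (\<lambda>w. \<Sum>v \<in> {v \<in> \<sigma>. g v = w}. t v)"
    unfolding realization_map_def
    by (rule ext, rule sum.mono_neutral_left) (use fin t in \<open>auto simp: closed_cell_def\<close>)
  have "(\<Sum>w\<in>g ` \<sigma>. \<Sum>v \<in> {v \<in> \<sigma>. g v = w}. t v) = (\<Sum>v\<in>\<sigma>. t v)"
    using fin by (intro sum.group) auto
  moreover have "(\<Sum>v \<in> {v \<in> \<sigma>. g v = w}. t v) = 0" if "w \<notin> g ` \<sigma>" for w
    by (rule sum.neutral) (use that in auto)
  ultimately show "realization_map g t \<in> closed_cell (g ` \<sigma>)"
    unfolding eq using t by (simp add: closed_cell_def sum_nonneg)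
qed

lemma continuous_map_realization_map:
  assumes K: "scomplex K" and L: "scomplex L" and g: "\<And>\<sigma>. \<sigma> \<in> K \<Longrightarrow> g ` \<sigma> \<in> L"
  shows "continuous_map (realization K) (realization L) (realization_map g)"
proof -
  have fin: "finite \<sigma>" if "\<sigma> \<in> K" for \<sigma> using K that by (auto simp: scomplex_def)
  have cover: "\<exists>\<sigma>\<in>K. t \<in> closed_cell \<sigma>" if "t \<in> realization_points K" for t
    using that by (intro bexI[of _ "{v. t v \<noteq> 0}"]) (auto simp: realization_points_def closed_cell_def)
  have into: "realization_map g t \<in> realization_points L" if "t \<in> realization_points K" for t
    using cover[OF that] realization_map_in_closed_cell(2) fin g closed_cell_subset_realization[OF L]
    by blast
  have cont: "continuous_on (closed_cell \<sigma>) (realization_map g)" if "\<sigma> \<in> K" for \<sigma>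
  proof -
    have "continuous_on (closed_cell \<sigma>) (\<lambda>t. (\<lambda>w. \<Sum>v \<in> {v \<in> \<sigma>. g v = w}. t v))"
    proof (rule continuous_on_coordinatewise_then_product)
      fix w
      have "continuous_on (closed_cell \<sigma>) (\<lambda>t::'a \<Rightarrow> real. t v)" for v
        by (rule continuous_on_product_then_coordinatewise) (rule continuous_on_id)
      then show "continuous_on (closed_cell \<sigma>) (\<lambda>t. \<Sum>v \<in> {v \<in> \<sigma>. g v = w}. t v)"
        by (intro continuous_on_sum)
    qed
    then show ?thesis
      by (rule continuous_on_eq) (simp add: realization_map_in_closed_cell(1)[OF fin[OF that]])
  qed
  show ?thesis
    unfolding continuous_map_def topspace_realization[OF K] topspace_realization[OF L]
  proof (intro conjI allI impI)
    show "realization_map g \<in> realization_points K \<rightarrow> realization_points L"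
      using into by blast
    fix U assume U: "openin (realization L) U"
    show "openin (realization K) {t \<in> realization_points K. realization_map g t \<in> U}"
      unfolding openin_realization
    proof (intro conjI ballI)
      fix \<sigma> assume s: "\<sigma> \<in> K"
      have "openin (top_of_set (closed_cell (g ` \<sigma>))) (U \<inter> closed_cell (g ` \<sigma>))"
        using U g[OF s] by (simp add: openin_realization)
      then have "openin (top_of_set (closed_cell \<sigma>))
          (closed_cell \<sigma> \<inter> realization_map g -` (U \<inter> closed_cell (g ` \<sigma>)))"
        using continuous_openin_preimage[OF cont[OF s]]
          realization_map_in_closed_cell(2)[OF fin[OF s]] by blast
      moreover have "closed_cell \<sigma> \<inter> realization_map g -` (U \<inter> closed_cell (g ` \<sigma>)) =
          {t \<in> realization_points K. realization_map g t \<in> U} \<inter> closed_cell \<sigma>"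
        using closed_cell_subset_realization[OF K s]
          realization_map_in_closed_cell(2)[OF fin[OF s]] by blast
      ultimately show "openin (top_of_set (closed_cell \<sigma>))
          ({t \<in> realization_points K. realization_map g t \<in> U} \<inter> closed_cell \<sigma>)"
        by simp
    qed auto
  qed
qed

lemma continuous_map_hom_functor_map:
  assumes "scomplex Y" "Z \<subseteq> Z'" "Z \<in> SCplx V"
  shows "continuous_map (hom_functor Y Z') (hom_functor Y Z) (hom_functor_map Z Z')"
  unfolding hom_functor_def hom_functor_map_def
  using assms by (intro continuous_map_realization_map scomplex_hom_complex restrict_simplicial)

end

(*
  The join-irreducible complexes below Z are the full simplices on the simplices of Z, so T1 F(Z) is the
  space H of compatible families of maps phi_sigma from the nerve N_sigma of the simplices containing
  sigma to |Hom(sigma, Y)|.  A map g : |Z| -> |Y| gives such a family: send p in N_sigma to the image of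
  g(b(p)) under the inclusion |Y| -> |Hom(sigma, Y)| of the constant maps, where b(p) is the point of |Z|
  with barycentric coordinates p.  Conversely a family phi gives the map s |-> ev(phi_sigma(P(s)), h(s)),
  where ev is the evaluation |Hom(sigma, Y)| x |sigma| -> |Y| and P, h are continuous with h(s) in |sigma|
  and P(s) in N_sigma for some sigma.  Both composites are homotopic to the identity by straight line
  homotopies: constant maps and evaluation are contiguous to the identity of |Hom(sigma, Y)|, P(b(p)) is
  supported on the chain of p, and b(P(s)) on the simplex of s.

  The realizations need not be locally finite, but everything is tested on compact spaces, whose
  images lie in finite subcomplexes; there continuity is continuity of the coordinates.
*)
theory Submission
  imports Defs
begin

section \<open>Homotopy equivalences are weak equivalences\<close>

text \<open>Why P and h are both needed: evaluating a component on \<sigma> at s requires every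
  simplex of the chain carrying P(s) to contain \<sigma>, while \<sigma> must contain the point at
  which one evaluates. The inverse of barycentric subdivision with h the identity fails, since its
  chain begins with small faces of the support of s. Cutting at a level \<theta> reconciles the two
  demands: h keeps only the coordinates above \<theta>, and P uses only superlevel sets of level at
  most \<theta>. In the composite on the mapping space h disappears, because evaluating a constant
  map forgets the point. The least element of the lattice is among the join-irreducibles, but the
  empty simplex has no barycentre. The internal hom out of it is a point, so families are built on
  nonempty simplices and filled in there by the only possible value. Homotopy equivalences provide
  free homotopies, whereas weak equivalences concern pointed spheres. The base point is moved back
  along its track, and a collapsed cap of the sphere is the collar in which this happens.\<close>

abbreviation I01 :: "real topology" where
  "I01 \<equiv> top_of_set {0..1}"

abbreviation pointed_homotopic ::
    "nat \<Rightarrow> 'a topology \<Rightarrow> 'a \<Rightarrow> ((nat \<Rightarrow> real) \<Rightarrow> 'a) \<Rightarrow> ((nat \<Rightarrow> real) \<Rightarrow> 'a) \<Rightarrow> bool" where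
  "pointed_homotopic n X x \<equiv> homotopic_with (\<lambda>k. k sphere_base = x) (nsphere n) X"

section \<open>Collapsing a cap of the sphere and moving base points\<close>

lemma sphere_base_in_nsphere [simp]: "sphere_base \<in> topspace (nsphere n)"
  using in_topspace_nsphere by (simp add: sphere_base_def)

lemma sphere_base_0 [simp]: "sphere_base 0 = 1"
  by (simp add: sphere_base_def)

lemma nsphere_eq_sphere_base:
  assumes "x \<in> topspace (nsphere n)" "x 0 = 1"
  shows "x = sphere_base"
proof -
  have s: "(\<Sum>i\<le>n. (x i)\<^sup>2) = 1" and z: "\<forall>i>n. x i = 0"
    using assms(1) by (auto simp: nsphere)
  have "(\<Sum>i\<le>n. (x i)\<^sup>2) = (x 0)\<^sup>2 + (\<Sum>i\<in>{..n}-{0}. (x i)\<^sup>2)"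
    by (rule sum.remove) auto
  then have "(\<Sum>i\<in>{..n}-{0}. (x i)\<^sup>2) = 0" using s assms(2) by simp
  then have "x i = 0" if "i \<le> n" "i \<noteq> 0" for i
    using that by (subst (asm) sum_nonneg_eq_0_iff) auto
  then show ?thesis
    using z assms(2) unfolding sphere_base_def by (metis not_le)
qed

lemma nsphere_coord_0_bounds:
  assumes "x \<in> topspace (nsphere n)"
  shows "(x 0)\<^sup>2 \<le> 1" "x 0 \<le> 1" "-1 \<le> x 0"
proof -
  have s: "(\<Sum>i\<le>n. (x i)\<^sup>2) = 1"
    using assms by (auto simp: nsphere)
  have "(x 0)\<^sup>2 \<le> (\<Sum>i\<le>n. (x i)\<^sup>2)"
    by (rule member_le_sum) auto
  then show "(x 0)\<^sup>2 \<le> 1" using s by simp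
  then show "x 0 \<le> 1" "-1 \<le> x 0"
    by (simp_all add: abs_square_le_1 abs_le_iff)
qed

lemma continuous_map_fst_I01: "continuous_map (prod_topology I01 X) euclideanreal fst"
  using continuous_map_fst[of I01 X] by (simp only: continuous_map_in_subtopology)

text \<open>Scaling all coordinates but the zeroth by \<open>m\<close> and renormalising pushes the
  upper hemisphere towards the base point. At time 1 the factor \<open>m\<close> is 0 on the cap
  \<open>1/2 \<le> x 0\<close> and 1 where \<open>x 0 \<le> 0\<close>. The cap can then serve as a
  collar around the base point.\<close>

lemma sphere_cap_collapse:
  obtains r where "continuous_map (nsphere n) (nsphere n) r"
    and "pointed_homotopic n (nsphere n) sphere_base id r"
    and "\<And>x. x \<in> topspace (nsphere n) \<Longrightarrow> 1/2 \<le> x 0 \<Longrightarrow> r x = sphere_base"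
proof -
  define m :: "real \<times> (nat \<Rightarrow> real) \<Rightarrow> real" where
    "m = (\<lambda>(l,x). 1 - l + l * max 0 (min 1 (1 - 2 * x 0)))"
  define D where "D = (\<lambda>p::real \<times> (nat \<Rightarrow> real). (snd p 0)\<^sup>2 + (m p)\<^sup>2 * (1 - (snd p 0)\<^sup>2))"
  define R where
    "R = (\<lambda>p::real \<times> (nat \<Rightarrow> real). \<lambda>i. (if i = 0 then snd p i else m p * snd p i) / sqrt (D p))"
  let ?P = "prod_topology I01 (nsphere n)"
  have cc: "continuous_map ?P euclideanreal (\<lambda>p. snd p i)" for i
    using continuous_map_compose[OF continuous_map_snd continuous_map_nsphere_projection]
    by (auto simp: o_def)
  have cf: "continuous_map ?P euclideanreal fst"
    by (rule continuous_map_fst_I01)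
  have cm: "continuous_map ?P euclideanreal m"
    unfolding m_def case_prod_unfold by (intro continuous_intros cc cf)
  have cD: "continuous_map ?P euclideanreal D"
    unfolding D_def by (intro continuous_intros cc cm)
  \<comment> \<open>\<open>D\<close> is the squared norm before normalisation. It could vanish only
    where the zeroth coordinate is 0, and there \<open>m\<close> is 1.\<close>
  have Dpos: "0 < D p" if p: "p \<in> topspace ?P" for p
  proof (cases "snd p 0 = 0")
    case True
    then have "m p = 1" by (auto simp: m_def case_prod_unfold)
    then show ?thesis using True by (simp add: D_def)
  next
    case False
    moreover have "(snd p 0)\<^sup>2 \<le> 1" using p nsphere_coord_0_bounds(1)[of "snd p" n] by auto
    ultimately show ?thesis unfolding D_def
      by (intro add_pos_nonneg mult_nonneg_nonneg) auto
  qed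
  have cR: "continuous_map ?P (nsphere n) R"
    unfolding nsphere continuous_map_in_subtopology continuous_map_componentwise_UNIV
  proof (intro conjI allI)
    fix k
    show "continuous_map (prod_topology I01 (subtopology (powertop_real UNIV)
        {x. (\<Sum>i\<le>n. (x i)\<^sup>2) = 1 \<and> (\<forall>i>n. x i = 0)})) euclideanreal (\<lambda>x. R x k)"
      unfolding nsphere[symmetric]
    proof (cases "k = 0")
      case True
      then show "continuous_map ?P euclideanreal (\<lambda>x. R x k)"
        unfolding R_def if_P[OF True]
        by (intro continuous_intros cc cD) (use Dpos in force)
    next
      case False
      then show "continuous_map ?P euclideanreal (\<lambda>x. R x k)"
        unfolding R_def if_not_P[OF False]
        by (intro continuous_intros cc cD cm) (use Dpos in force)
    qed
  next
    have "R p \<in> {x. (\<Sum>i\<le>n. (x i)\<^sup>2) = 1 \<and> (\<forall>i>n. x i = 0)}" if p: "p \<in> topspace ?P" for p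
    proof -
      have x: "snd p \<in> topspace (nsphere n)" using p by auto
      then have s: "(\<Sum>i\<le>n. (snd p i)\<^sup>2) = 1" and z: "\<forall>i>n. snd p i = 0"
        by (auto simp: nsphere)
      have s1: "(\<Sum>i\<in>{..n}-{0}. (snd p i)\<^sup>2) = 1 - (snd p 0)\<^sup>2"
        using s sum.remove[of "{..n}" 0 "\<lambda>i. (snd p i)\<^sup>2"] by simp
      have "(\<Sum>i\<le>n. (if i = 0 then snd p i else m p * snd p i)\<^sup>2) =
          (snd p 0)\<^sup>2 + (\<Sum>i\<in>{..n}-{0}. (m p)\<^sup>2 * (snd p i)\<^sup>2)"
        by (subst sum.remove[of _ 0]) (auto intro!: sum.cong simp: power_mult_distrib)
      also have "\<dots> = D p"
        unfolding D_def sum_distrib_left[symmetric] s1 ..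
      finally have "(\<Sum>i\<le>n. (if i = 0 then snd p i else m p * snd p i)\<^sup>2) = D p" .
      moreover have "(\<Sum>i\<le>n. (R p i)\<^sup>2) = (\<Sum>i\<le>n. (if i = 0 then snd p i else m p * snd p i)\<^sup>2) / D p"
        unfolding R_def power_divide sum_divide_distrib using Dpos[OF p] by simp
      ultimately have "(\<Sum>i\<le>n. (R p i)\<^sup>2) = 1" using Dpos[OF p] by simp
      then show ?thesis using z by (auto simp: R_def)
    qed
    then show "R \<in> topspace (prod_topology I01 (subtopology (powertop_real UNIV)
        {x. (\<Sum>i\<le>n. (x i)\<^sup>2) = 1 \<and> (\<forall>i>n. x i = 0)})) \<rightarrow>
        {x. (\<Sum>i\<le>n. (x i)\<^sup>2) = 1 \<and> (\<forall>i>n. x i = 0)}"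
      unfolding nsphere[symmetric] by blast
  qed
  define r where "r = (\<lambda>x. R (1, x))"
  have "continuous_map (nsphere n) (nsphere n) (R \<circ> Pair 1)"
    by (rule continuous_map_o_Pair[OF cR]) simp
  then have 1: "continuous_map (nsphere n) (nsphere n) r"
    by (simp add: r_def o_def)
  have m0: "m (0, x) = 1" for x by (simp add: m_def)
  have 2: "pointed_homotopic n (nsphere n) sphere_base id r"
  proof (subst homotopic_with)
    show "\<exists>h. continuous_map ?P (nsphere n) h \<and> (\<forall>x\<in>topspace (nsphere n). h (0, x) = id x) \<and>
      (\<forall>x\<in>topspace (nsphere n). h (1, x) = r x) \<and> (\<forall>t\<in>{0..1}. h (t, sphere_base) = sphere_base)"
    proof (intro exI[of _ R] conjI ballI cR)
      show "R (0, x) = id x" for x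
        by (rule ext) (simp add: R_def m0 D_def)
      show "R (t, sphere_base) = sphere_base" for t
        by (rule ext) (simp add: R_def D_def sphere_base_def)
    qed (simp add: r_def)
  qed simp
  have 3: "r x = sphere_base" if x: "x \<in> topspace (nsphere n)" "1/2 \<le> x 0" for x
  proof (rule nsphere_eq_sphere_base)
    show "r x \<in> topspace (nsphere n)" using 1 x by (auto simp: continuous_map_def)
    have "m (1,x) = 0" using x by (auto simp: m_def)
    then show "r x 0 = 1" using x by (simp add: r_def R_def D_def)
  qed
  show ?thesis using that 1 2 3 by blast
qed

text \<open>On the cap the collar coordinate is \<open>2 * x 0 - 1\<close>, which runs from 0 on the
  rim to 1 at the base point, where \<open>N\<close> is followed up to the full parameter. On the
  rim \<open>r\<close> gives the base point, so the two formulas agree by \<open>NG\<close>.\<close>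

lemma continuous_map_sphere_extension:
  assumes G: "continuous_map (prod_topology T (nsphere n)) A G"
    and N: "continuous_map (prod_topology T I01) A N"
    and NG: "\<And>t. t \<in> topspace T \<Longrightarrow> N (t, 0) = G (t, sphere_base)"
    and r: "continuous_map (nsphere n) (nsphere n) r"
    and rb: "\<And>x. x \<in> topspace (nsphere n) \<Longrightarrow> 1/2 \<le> x 0 \<Longrightarrow> r x = sphere_base"
  shows "continuous_map (prod_topology (prod_topology T I01) (nsphere n)) A
    (\<lambda>p. if snd p 0 \<le> 1/2 then G (fst (fst p), r (snd p))
       else N (fst (fst p), snd (fst p) * max 0 (2 * snd p 0 - 1)))"
proof (rule continuous_map_cases_le)
  let ?Q = "prod_topology (prod_topology T I01) (nsphere n)"
  show c0: "continuous_map ?Q euclideanreal (\<lambda>p. snd p 0)"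
    using continuous_map_compose[OF continuous_map_snd continuous_map_nsphere_projection]
    by (auto simp: o_def)
  have ct: "continuous_map ?Q T (\<lambda>p. fst (fst p))"
    by (rule continuous_map_compose[OF continuous_map_fst continuous_map_fst, unfolded o_def])
  have "continuous_map ?Q I01 (\<lambda>p. snd (fst p))"
    by (rule continuous_map_compose[OF continuous_map_fst continuous_map_snd, unfolded o_def])
  then have cs: "continuous_map ?Q euclideanreal (\<lambda>p. snd (fst p))"
    by (simp add: continuous_map_in_subtopology)
  have "continuous_map ?Q A (G \<circ> (\<lambda>p. (fst (fst p), r (snd p))))"
    by (intro continuous_map_compose[OF _ G] continuous_map_pairedI ct
        continuous_map_compose[OF continuous_map_snd r, unfolded o_def])
  then show "continuous_map (subtopology ?Q {x \<in> topspace ?Q. snd x 0 \<le> 1/2}) A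
      (\<lambda>p. G (fst (fst p), r (snd p)))"
    by (simp add: o_def continuous_map_from_subtopology)
  have "continuous_map ?Q I01 (\<lambda>p. snd (fst p) * max 0 (2 * snd p 0 - 1))"
    unfolding continuous_map_in_subtopology
  proof
    show "continuous_map ?Q euclideanreal (\<lambda>p. snd (fst p) * max 0 (2 * snd p 0 - 1))"
      by (intro continuous_intros cs c0)
    show "(\<lambda>p. snd (fst p) * max 0 (2 * snd p 0 - 1)) \<in> topspace ?Q \<rightarrow> {0..1}"
    proof
      fix p assume p: "p \<in> topspace ?Q"
      then have "snd p 0 \<le> 1" "0 \<le> snd (fst p)" "snd (fst p) \<le> 1"
        using nsphere_coord_0_bounds(2)[of "snd p" n] by auto
      then show "snd (fst p) * max 0 (2 * snd p 0 - 1) \<in> {0..1}"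
        by (auto intro: mult_le_one)
    qed
  qed
  then have "continuous_map ?Q A (N \<circ> (\<lambda>p. (fst (fst p), snd (fst p) * max 0 (2 * snd p 0 - 1))))"
    by (intro continuous_map_compose[OF _ N] continuous_map_pairedI ct)
  then show "continuous_map (subtopology ?Q {x \<in> topspace ?Q. 1/2 \<le> snd x 0}) A
      (\<lambda>p. N (fst (fst p), snd (fst p) * max 0 (2 * snd p 0 - 1)))"
    by (simp add: o_def continuous_map_from_subtopology)
  show "G (fst (fst x), r (snd x)) = N (fst (fst x), snd (fst x) * max 0 (2 * snd x 0 - 1))"
    if "x \<in> topspace ?Q" "snd x 0 = 1/2" for x
    using that by (auto simp: rb NG)
qed simp

lemma pointed_homotopic_compose_cap_collapse:
  assumes k: "continuous_map (nsphere n) A k" "k sphere_base = x"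
    and r: "pointed_homotopic n (nsphere n) sphere_base id r"
  shows "pointed_homotopic n A x k (k \<circ> r)"
proof -
  have "pointed_homotopic n A x (k \<circ> id) (k \<circ> r)"
    by (rule homotopic_with_compose_continuous_map_left[OF r k(1)]) (use k in simp)
  then show ?thesis by simp
qed

lemma pointed_homotopic_if_homotopy:
  assumes "continuous_map (prod_topology I01 (nsphere n)) A h"
    and "\<And>x. x \<in> topspace (nsphere n) \<Longrightarrow> h (0, x) = f x"
    and "\<And>x. x \<in> topspace (nsphere n) \<Longrightarrow> h (1, x) = g x"
    and "\<And>t. t \<in> {0..1} \<Longrightarrow> h (t, sphere_base) = a"
  shows "pointed_homotopic n A a f g"
proof (subst homotopic_with)
  show "\<exists>h. continuous_map (prod_topology I01 (nsphere n)) A h \<and>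
      (\<forall>x\<in>topspace (nsphere n). h (0, x) = f x) \<and> (\<forall>x\<in>topspace (nsphere n). h (1, x) = g x) \<and>
      (\<forall>t\<in>{0..1}. h (t, sphere_base) = a)"
    using assms by blast
qed simp

text \<open>Two free homotopies with the same start and the same track of the base point: the track of
  their difference is a path followed by its reverse, and the contraction of this loop is extended
  over the sphere.\<close>

lemma pointed_homotopic_of_same_track:
  assumes L1: "continuous_map (prod_topology I01 (nsphere n)) A L1"
    and L2: "continuous_map (prod_topology I01 (nsphere n)) A L2"
    and start: "\<And>x. x \<in> topspace (nsphere n) \<Longrightarrow> L1 (0, x) = L2 (0, x)"
    and track: "\<And>t. t \<in> {0..1} \<Longrightarrow> L1 (t, sphere_base) = L2 (t, sphere_base)"
    and L1f: "\<And>x. L1 (1, x) = f x" and L2g: "\<And>x. L2 (1, x) = g x"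
    and a: "L1 (1, sphere_base) = a"
  shows "pointed_homotopic n A a f g"
proof -
  obtain r where r: "continuous_map (nsphere n) (nsphere n) r"
      "pointed_homotopic n (nsphere n) sphere_base id r"
      "\<And>x. x \<in> topspace (nsphere n) \<Longrightarrow> 1/2 \<le> x 0 \<Longrightarrow> r x = sphere_base"
    by (rule sphere_cap_collapse[of n]) blast
  let ?P = "prod_topology I01 (nsphere n)"
  \<comment> \<open>\<open>G\<close> runs \<open>L1\<close> backwards and then \<open>L2\<close>
    forwards: a free homotopy from \<open>f\<close> to \<open>g\<close> whose base point goes back
    along the common track and returns.\<close>
  define G where "G = (\<lambda>p. if fst p \<le> 1/2 then L1 (1 - 2 * fst p, snd p) else L2 (2 * fst p - 1, snd p))"
  have cf: "continuous_map ?P euclideanreal fst"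
    by (rule continuous_map_fst_I01)
  have cfs: "continuous_map (subtopology ?P S) euclideanreal fst" for S
    by (rule continuous_map_from_subtopology[OF cf])
  have css: "continuous_map (subtopology ?P S) (nsphere n) snd" for S
    by (rule continuous_map_from_subtopology[OF continuous_map_snd])
  have cG: "continuous_map ?P A G"
    unfolding G_def
  proof (rule continuous_map_cases_le)
    let ?S = "{x \<in> topspace ?P. fst x \<le> 1/2}"
    have "continuous_map (subtopology ?P ?S) A (L1 \<circ> (\<lambda>p. (1 - 2 * fst p, snd p)))"
    proof (rule continuous_map_compose[OF _ L1], intro continuous_map_pairedI)
      show "continuous_map (subtopology ?P ?S) I01 (\<lambda>p. 1 - 2 * fst p)"
        unfolding continuous_map_in_subtopology
        by (intro conjI continuous_map_diff continuous_map_real_mult_left cfs) auto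
    qed (rule css)
    then show "continuous_map (subtopology ?P ?S) A (\<lambda>p. L1 (1 - 2 * fst p, snd p))"
      by (simp add: o_def)
    let ?S = "{x \<in> topspace ?P. 1/2 \<le> fst x}"
    have "continuous_map (subtopology ?P ?S) A (L2 \<circ> (\<lambda>p. (2 * fst p - 1, snd p)))"
    proof (rule continuous_map_compose[OF _ L2], intro continuous_map_pairedI)
      show "continuous_map (subtopology ?P ?S) I01 (\<lambda>p. 2 * fst p - 1)"
        unfolding continuous_map_in_subtopology
        by (intro conjI continuous_map_diff continuous_map_real_mult_left cfs) auto
    qed (rule css)
    then show "continuous_map (subtopology ?P ?S) A (\<lambda>p. L2 (2 * fst p - 1, snd p))"
      by (simp add: o_def)
    show "L1 (1 - 2 * fst p, snd p) = L2 (2 * fst p - 1, snd p)"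
      if "p \<in> topspace ?P" "fst p = 1/2" for p
    proof -
      have e: "1 - 2 * fst p = 0" "2 * fst p - 1 = 0" using that(2) by simp_all
      show ?thesis unfolding e by (rule start) (use that(1) in auto)
    qed
  qed (simp_all add: cf)
  \<comment> \<open>\<open>N\<close> contracts this loop by never going back beyond time
    \<open>s\<close>. It equals \<open>a\<close> on the sides \<open>t = 0\<close>,
    \<open>t = 1\<close> and \<open>s = 1\<close> of the square.\<close>
  define N where "N = (\<lambda>p::real \<times> real. L1 (max \<bar>2 * fst p - 1\<bar> (snd p), sphere_base))"
  have cN: "continuous_map (prod_topology I01 I01) A N"
  proof -
    have c1: "continuous_map (prod_topology I01 I01) euclideanreal fst"
      by (rule continuous_map_fst_I01)
    have c2: "continuous_map (prod_topology I01 I01) euclideanreal snd"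
      using continuous_map_snd[of I01 I01] by (simp only: continuous_map_in_subtopology)
    have "continuous_map (prod_topology I01 I01) A
        (L1 \<circ> (\<lambda>p. (max \<bar>2 * fst p - 1\<bar> (snd p), sphere_base)))"
    proof (rule continuous_map_compose[OF _ L1], intro continuous_map_pairedI)
      show "continuous_map (prod_topology I01 I01) I01 (\<lambda>p. max \<bar>2 * fst p - 1\<bar> (snd p))"
        unfolding continuous_map_in_subtopology
        by (intro conjI continuous_map_real_max continuous_map_real_abs continuous_map_diff
            continuous_map_real_mult_left c1 c2) auto
    qed simp
    then show ?thesis by (simp add: N_def o_def)
  qed
  have NG: "N (t, 0) = G (t, sphere_base)" if "t \<in> topspace I01" for t
    using that track[of "2 * t - 1"] by (auto simp: N_def G_def abs_if max_def)
  let ?E = "\<lambda>p. if snd p 0 \<le> 1/2 then G (fst (fst p), r (snd p))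
       else N (fst (fst p), snd (fst p) * max 0 (2 * snd p 0 - 1))"
  have cE: "continuous_map (prod_topology (prod_topology I01 I01) (nsphere n)) A ?E"
    by (rule continuous_map_sphere_extension[OF cG cN NG r(1) r(3)])
  have Ec: "continuous_map ?P A (?E \<circ> (\<lambda>p. (u p, snd p)))"
    if "continuous_map ?P (prod_topology I01 I01) u" for u
    by (intro continuous_map_compose[OF _ cE] continuous_map_pairedI that continuous_map_snd)
  have N0: "N (0, s) = a" "N (1, s) = a" if "s \<in> {0..1}" for s
    using that a by (auto simp: N_def)
  have N1: "N (t, 1) = a" if "t \<in> {0..1}" for t
    using that a by (auto simp: N_def max_def)
  have G0: "G (0, x) = f x" "G (1, x) = g x" for x
    by (auto simp: G_def L1f L2g)
  have rb: "G (t, r x) = N (t, 0)" if "t \<in> {0..1}" "x \<in> topspace (nsphere n)" "1/2 \<le> x 0" for t x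
    using that r(3) NG by simp
  have b: "f sphere_base = a" "g sphere_base = a"
    using G0[of sphere_base] NG[of 0] NG[of 1] N0[of 0] by auto
  have ef: "continuous_map (nsphere n) A f" "continuous_map (nsphere n) A g"
    using continuous_map_o_Pair[OF cG, of 0] continuous_map_o_Pair[OF cG, of 1]
    by (simp_all add: o_def G0)
  have cI: "continuous_map ?P I01 fst" by (rule continuous_map_fst)
  \<comment> \<open>The pointed homotopy from \<open>f\<close> to \<open>g\<close> goes round those
    three sides, where the base point stays at \<open>a\<close>.\<close>
  have side: "pointed_homotopic n A a (h \<circ> r) (\<lambda>x. ?E ((t, 1), x))"
    if t: "t = 0 \<and> h = f \<or> t = 1 \<and> h = g" for t h
  proof (rule pointed_homotopic_if_homotopy)
    show "continuous_map ?P A (?E \<circ> (\<lambda>p. ((t, fst p), snd p)))"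
      using t by (intro Ec continuous_map_pairedI cI) auto
    show "(?E \<circ> (\<lambda>p. ((t, fst p), snd p))) (0, x) = (h \<circ> r) x" if "x \<in> topspace (nsphere n)" for x
      using that t rb[of t x] by (auto simp: G0)
    show "(?E \<circ> (\<lambda>p. ((t, fst p), snd p))) (s, sphere_base) = a" if "s \<in> {0..1}" for s
      using that t N0 by auto
  qed auto
  have middle: "pointed_homotopic n A a (\<lambda>x. ?E ((0, 1), x)) (\<lambda>x. ?E ((1, 1), x))"
  proof (rule pointed_homotopic_if_homotopy)
    show "continuous_map ?P A (?E \<circ> (\<lambda>p. ((fst p, 1), snd p)))"
      by (intro Ec continuous_map_pairedI cI) auto
    show "(?E \<circ> (\<lambda>p. ((fst p, 1), snd p))) (t, sphere_base) = a" if "t \<in> {0..1}" for t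
      using that N1 by auto
  qed auto
  have "pointed_homotopic n A a f (f \<circ> r)" "pointed_homotopic n A a g (g \<circ> r)"
    by (intro pointed_homotopic_compose_cap_collapse ef b r(2))+
  then show ?thesis
    using side[of 0 f] side[of 1 g] middle by (meson homotopic_with_trans homotopic_with_symD)
qed


text \<open>Homotopy extension from the base point of the sphere, in a weak form: the extension
  starts at \<open>G\<close> composed with \<open>r\<close>, not at \<open>G\<close>. As
  \<open>r\<close> is homotopic to the identity relative to the base point, this suffices for
  comparing pointed classes.\<close>

lemma sphere_extension:
  assumes G: "continuous_map (prod_topology T (nsphere n)) A G"
    and N: "continuous_map (prod_topology T I01) A N"
    and NG: "\<And>t. t \<in> topspace T \<Longrightarrow> N (t, 0) = G (t, sphere_base)"
  obtains E r where "continuous_map (prod_topology (prod_topology T I01) (nsphere n)) A E"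
    and "\<And>t x. t \<in> topspace T \<Longrightarrow> x \<in> topspace (nsphere n) \<Longrightarrow> E ((t, 0), x) = G (t, r x)"
    and "\<And>t s. t \<in> topspace T \<Longrightarrow> E ((t, s), sphere_base) = N (t, s)"
    and "continuous_map (nsphere n) (nsphere n) r" "r sphere_base = sphere_base"
    and "pointed_homotopic n (nsphere n) sphere_base id r"
proof -
  obtain r where r: "continuous_map (nsphere n) (nsphere n) r"
      "pointed_homotopic n (nsphere n) sphere_base id r"
      "\<And>x. x \<in> topspace (nsphere n) \<Longrightarrow> 1/2 \<le> x 0 \<Longrightarrow> r x = sphere_base"
    by (rule sphere_cap_collapse[of n]) blast
  let ?E = "\<lambda>p. if snd p 0 \<le> 1/2 then G (fst (fst p), r (snd p))
       else N (fst (fst p), snd (fst p) * max 0 (2 * snd p 0 - 1))"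
  show thesis
  proof (rule that[of ?E r])
    show "continuous_map (prod_topology (prod_topology T I01) (nsphere n)) A ?E"
      by (rule continuous_map_sphere_extension[OF G N NG r(1) r(3)])
    show "?E ((t, 0), x) = G (t, r x)" if "t \<in> topspace T" "x \<in> topspace (nsphere n)" for t x
      using that r(3)[of x] NG[of t] by simp
    show "r sphere_base = sphere_base" by (rule r(3)) simp_all
  qed (use r in auto)
qed

text \<open>The base point of the given homotopy sits at \<open>e x\<close>; extending along the
  reversed track of \<open>x\<close> moves it to \<open>x\<close>. The ends become \<open>g1\<close>
  and \<open>g2\<close> up to pointed homotopy, by comparison with the reversed homotopy applied to
  these maps, which moves the base point along the same track.\<close>

lemma homotopic_id_reflects_pointed_homotopic:
  assumes H: "homotopic_with (\<lambda>_. True) A A id e"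
    and g1: "continuous_map (nsphere n) A g1" "g1 sphere_base = x"
    and g2: "continuous_map (nsphere n) A g2" "g2 sphere_base = x"
    and P: "pointed_homotopic n A (e x) (e \<circ> g1) (e \<circ> g2)"
  shows "pointed_homotopic n A x g1 g2"
proof -
  obtain h where h: "continuous_map (prod_topology I01 A) A h" "\<And>a. h (0, a) = a" "\<And>a. h (1, a) = e a"
    using H by (auto simp: homotopic_with_def)
  obtain p where p: "continuous_map (prod_topology I01 (nsphere n)) A p"
      "\<And>y. p (0, y) = e (g1 y)" "\<And>y. p (1, y) = e (g2 y)"
      "\<And>t. t \<in> {0..1} \<Longrightarrow> p (t, sphere_base) = e x"
    using P by (auto simp: homotopic_with_def)
  have "g1 sphere_base \<in> topspace A" using g1(1) by (simp add: continuous_map_def Pi_iff)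
  then have x: "x \<in> topspace A" by (simp only: g1(2))
  define N where "N = (\<lambda>q::real \<times> real. h (1 - snd q, x))"
  have neg: "continuous_map I01 I01 (\<lambda>s. 1 - s)"
    unfolding continuous_map_in_subtopology by (auto intro!: continuous_intros)
  have "continuous_map (prod_topology I01 I01) A (h \<circ> (\<lambda>q. (1 - snd q, x)))"
    by (intro continuous_map_compose[OF _ h(1)] continuous_map_pairedI
        continuous_map_compose[OF continuous_map_snd neg, unfolded o_def]) (simp add: x)
  then have N: "continuous_map (prod_topology I01 I01) A N" by (simp add: N_def o_def)
  obtain E r where E: "continuous_map (prod_topology (prod_topology I01 I01) (nsphere n)) A E"
    "\<And>t x. t \<in> topspace I01 \<Longrightarrow> x \<in> topspace (nsphere n) \<Longrightarrow> E ((t, 0), x) = p (t, r x)"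
    "\<And>t s. t \<in> topspace I01 \<Longrightarrow> E ((t, s), sphere_base) = N (t, s)"
    and r: "continuous_map (nsphere n) (nsphere n) r" "r sphere_base = sphere_base"
      "pointed_homotopic n (nsphere n) sphere_base id r"
    by (rule sphere_extension[OF p(1) N]) (auto simp: N_def h p(4))
  let ?P = "prod_topology I01 (nsphere n)"
  have Ec: "continuous_map ?P A (\<lambda>q. E (u q, snd q))"
    if "continuous_map ?P (prod_topology I01 I01) u" for u
    by (intro continuous_map_compose[OF _ E(1), unfolded o_def] continuous_map_pairedI that continuous_map_snd)
  have side: "pointed_homotopic n A x g (\<lambda>y. E ((t, 1), y))"
    if g: "continuous_map (nsphere n) A g" "g sphere_base = x" "t \<in> {0..1}" "\<And>y. p (t, y) = e (g y)" for t g
  proof -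
    have "pointed_homotopic n A x (g \<circ> r) (\<lambda>y. E ((t, 1), y))"
    proof (rule pointed_homotopic_of_same_track)
      show "continuous_map ?P A (\<lambda>q. h (1 - fst q, g (r (snd q))))"
        by (intro continuous_map_compose[OF _ h(1), unfolded o_def] continuous_map_pairedI
            continuous_map_compose[OF continuous_map_fst neg, unfolded o_def]
            continuous_map_compose[OF _ g(1), unfolded o_def]
            continuous_map_compose[OF continuous_map_snd r(1), unfolded o_def])
      show "continuous_map ?P A (\<lambda>q. E ((t, fst q), snd q))"
        by (intro Ec continuous_map_pairedI continuous_map_fst) (use g in simp)
    qed (use g E(2,3) h r in \<open>auto simp: N_def\<close>)
    then show ?thesis
      using pointed_homotopic_compose_cap_collapse[OF g(1,2) r(3)] by (meson homotopic_with_trans)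
  qed
  have "pointed_homotopic n A x (\<lambda>y. E ((0, 1), y)) (\<lambda>y. E ((1, 1), y))"
  proof (rule pointed_homotopic_if_homotopy)
    show "continuous_map ?P A (\<lambda>q. E ((fst q, 1), snd q))"
      by (intro Ec continuous_map_pairedI continuous_map_fst) simp
  qed (auto simp: E(3) N_def h)
  moreover have "pointed_homotopic n A x g1 (\<lambda>y. E ((0, 1), y))"
    "pointed_homotopic n A x g2 (\<lambda>y. E ((1, 1), y))"
    using side[of g1 0] side[of g2 1] g1 g2 p by auto
  ultimately show ?thesis by (meson homotopic_with_trans homotopic_with_symD)
qed

text \<open>Moving the base point of \<open>k\<close> back along the track of \<open>x\<close>
  produces \<open>g\<close>. Then \<open>e \<circ> g\<close> and \<open>k \<circ> r\<close> both
  arise from \<open>g\<close> by free homotopies with the same track of the base point.\<close>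

lemma homotopic_id_lifts_pointed_map:
  assumes H: "homotopic_with (\<lambda>_. True) A A id e" and x: "x \<in> topspace A"
    and k: "continuous_map (nsphere n) A k" "k sphere_base = e x"
  obtains g where "continuous_map (nsphere n) A g" "g sphere_base = x"
    and "pointed_homotopic n A (e x) (e \<circ> g) k"
proof -
  obtain h where h: "continuous_map (prod_topology I01 A) A h" "\<And>a. h (0, a) = a" "\<And>a. h (1, a) = e a"
    using H by (auto simp: homotopic_with_def)
  define N where "N = (\<lambda>q::real \<times> real. h (1 - snd q, x))"
  have neg: "continuous_map I01 I01 (\<lambda>s. 1 - s)"
    unfolding continuous_map_in_subtopology by (auto intro!: continuous_intros)
  have "continuous_map (prod_topology I01 I01) A (h \<circ> (\<lambda>q. (1 - snd q, x)))"
    by (intro continuous_map_compose[OF _ h(1)] continuous_map_pairedI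
        continuous_map_compose[OF continuous_map_snd neg, unfolded o_def]) (simp add: x)
  then have N: "continuous_map (prod_topology I01 I01) A N" by (simp add: N_def o_def)
  have G: "continuous_map (prod_topology I01 (nsphere n)) A (\<lambda>q. k (snd q))"
    by (rule continuous_map_compose[OF continuous_map_snd k(1), unfolded o_def])
  obtain E r where E: "continuous_map (prod_topology (prod_topology I01 I01) (nsphere n)) A E"
    "\<And>t x. t \<in> topspace I01 \<Longrightarrow> x \<in> topspace (nsphere n) \<Longrightarrow> E ((t, 0), x) = k (r x)"
    "\<And>t s. t \<in> topspace I01 \<Longrightarrow> E ((t, s), sphere_base) = N (t, s)"
    and r: "continuous_map (nsphere n) (nsphere n) r" "r sphere_base = sphere_base"
      "pointed_homotopic n (nsphere n) sphere_base id r"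
    by (rule sphere_extension[OF G N]) (auto simp: N_def h k)
  let ?P = "prod_topology I01 (nsphere n)"
  define g where "g = (\<lambda>y. E ((0, 1), y))"
  have "continuous_map (nsphere n) A (E \<circ> Pair (0, 1))"
    by (rule continuous_map_o_Pair[OF E(1)]) simp
  then have g: "continuous_map (nsphere n) A g" by (simp add: g_def o_def)
  have gb: "g sphere_base = x" by (simp add: g_def E(3) N_def h)
  have "pointed_homotopic n A (e x) (e \<circ> g) (k \<circ> r)"
  proof (rule pointed_homotopic_of_same_track)
    show "continuous_map ?P A (\<lambda>q. h (fst q, g (snd q)))"
      by (intro continuous_map_compose[OF _ h(1), unfolded o_def] continuous_map_pairedI
          continuous_map_fst continuous_map_compose[OF continuous_map_snd g, unfolded o_def])
    have "continuous_map ?P A (\<lambda>q. E ((0, 1 - fst q), snd q))"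
      by (intro continuous_map_compose[OF _ E(1), unfolded o_def] continuous_map_pairedI continuous_map_snd
          continuous_map_compose[OF continuous_map_fst neg, unfolded o_def]) simp
    \<comment> \<open>The case split is there because the end map has to match at all arguments,
      while \<open>E\<close> is known only at points of the sphere.\<close>
    then show "continuous_map ?P A (\<lambda>q. if fst q = 1 then k (r (snd q)) else E ((0, 1 - fst q), snd q))"
      by (rule continuous_map_eq) (auto simp: E(2))
    show "h (fst (t, sphere_base), g (snd (t, sphere_base))) =
       (if fst (t, sphere_base) = 1 then k (r (snd (t, sphere_base)))
        else E ((0, 1 - fst (t, sphere_base)), snd (t, sphere_base)))" if "t \<in> {0..1}" for t
      using that by (auto simp: E(3) N_def h r gb k)
  qed (use gb in \<open>auto simp: h g_def\<close>)
  then show thesis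
    using that[OF g gb] pointed_homotopic_compose_cap_collapse[OF k r(3)]
    by (meson homotopic_with_trans homotopic_with_symD)
qed

section \<open>From maps of spheres to homotopy groups and path components\<close>

lemma pointed_class_eq_iff:
  assumes "continuous_map (nsphere n) X g" "g sphere_base = x"
  shows "pointed_class n X x g = pointed_class n X x h \<longleftrightarrow> pointed_homotopic n X x g h"
proof
  assume eq: "pointed_class n X x g = pointed_class n X x h"
  have "g \<in> pointed_class n X x g" using assms by (simp add: pointed_class_def)
  then show "pointed_homotopic n X x g h" unfolding eq
    by (simp add: pointed_class_def homotopic_with_sym)
next
  assume "pointed_homotopic n X x g h"
  then show "pointed_class n X x g = pointed_class n X x h"
    unfolding pointed_class_def
    by (intro Collect_cong) (meson homotopic_with_trans homotopic_with_symD)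
qed

text \<open>All representatives of a class have the same image class, so the union in
  \<open>homotopy_group_map\<close> is a union of equal sets.\<close>

lemma homotopy_group_map_pointed_class:
  assumes f: "continuous_map X Y f" and g: "continuous_map (nsphere n) X g" "g sphere_base = x"
  shows "homotopy_group_map n Y f x (pointed_class n X x g) = pointed_class n Y (f x) (f \<circ> g)"
proof -
  have fg: "continuous_map (nsphere n) Y (f \<circ> g)" "(f \<circ> g) sphere_base = f x"
    using f g by (auto intro: continuous_map_compose)
  have "pointed_class n Y (f x) (f \<circ> h) = pointed_class n Y (f x) (f \<circ> g)"
    if "h \<in> pointed_class n X x g" for h
  proof -
    have "pointed_homotopic n Y (f x) (f \<circ> g) (f \<circ> h)"
      by (rule homotopic_with_compose_continuous_map_left[OF that[unfolded pointed_class_def mem_Collect_eq] f])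
        simp
    then show ?thesis by (rule pointed_class_eq_iff[OF fg, THEN iffD2, symmetric])
  qed
  moreover have "g \<in> pointed_class n X x g" using g by (simp add: pointed_class_def)
  ultimately show ?thesis unfolding homotopy_group_map_def by blast
qed

lemma bij_betw_homotopy_group_mapI:
  assumes f: "continuous_map X Y f"
    and inj: "\<And>g h. \<lbrakk>continuous_map (nsphere n) X g; g sphere_base = x;
        continuous_map (nsphere n) X h; h sphere_base = x;
        pointed_homotopic n Y (f x) (f \<circ> g) (f \<circ> h)\<rbrakk> \<Longrightarrow> pointed_homotopic n X x g h"
    and surj: "\<And>k. \<lbrakk>continuous_map (nsphere n) Y k; k sphere_base = f x\<rbrakk> \<Longrightarrow>
        \<exists>g. continuous_map (nsphere n) X g \<and> g sphere_base = x \<and>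
          pointed_homotopic n Y (f x) (f \<circ> g) k"
  shows "bij_betw (homotopy_group_map n Y f x) (homotopy_group n X x) (homotopy_group n Y (f x))"
  unfolding bij_betw_def
proof
  let ?M = "{g. continuous_map (nsphere n) X g \<and> g sphere_base = x}"
  have fM: "continuous_map (nsphere n) Y (f \<circ> g) \<and> (f \<circ> g) sphere_base = f x" if "g \<in> ?M" for g
    using that f by (auto intro: continuous_map_compose)
  have map: "homotopy_group_map n Y f x (pointed_class n X x g) = pointed_class n Y (f x) (f \<circ> g)"
    if "g \<in> ?M" for g
    using that by (intro homotopy_group_map_pointed_class[OF f]) auto
  have eqX: "pointed_class n X x g = pointed_class n X x h \<longleftrightarrow> pointed_homotopic n X x g h"
    if "g \<in> ?M" for g h
    using that by (intro pointed_class_eq_iff) auto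
  have eqY: "pointed_class n Y (f x) (f \<circ> g) = pointed_class n Y (f x) k \<longleftrightarrow>
      pointed_homotopic n Y (f x) (f \<circ> g) k" if "g \<in> ?M" for g k
    using fM[OF that] by (intro pointed_class_eq_iff) auto
  show "inj_on (homotopy_group_map n Y f x) (homotopy_group n X x)"
    unfolding homotopy_group_def
  proof (rule inj_onI, elim imageE)
    fix c d g h
    assume eq: "homotopy_group_map n Y f x c = homotopy_group_map n Y f x d"
      and g: "c = pointed_class n X x g" "g \<in> ?M" and h: "d = pointed_class n X x h" "h \<in> ?M"
    have "pointed_homotopic n Y (f x) (f \<circ> g) (f \<circ> h)"
      using eq unfolding g h map[OF g(2)] map[OF h(2)] eqY[OF g(2)] .
    then have "pointed_homotopic n X x g h" using inj g h by blast
    then show "c = d" unfolding g h eqX[OF g(2)] .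
  qed
  have "homotopy_group_map n Y f x ` homotopy_group n X x =
      (\<lambda>g. pointed_class n Y (f x) (f \<circ> g)) ` ?M"
    unfolding homotopy_group_def image_image by (rule image_cong[OF refl map])
  also have "\<dots> = homotopy_group n Y (f x)"
    unfolding homotopy_group_def
  proof (intro equalityI subsetI; elim imageE)
    fix c g assume "c = pointed_class n Y (f x) (f \<circ> g)" "g \<in> ?M"
    then show "c \<in> pointed_class n Y (f x) `
        {g. continuous_map (nsphere n) Y g \<and> g sphere_base = f x}"
      using fM by blast
  next
    fix c k assume c: "c = pointed_class n Y (f x) k"
      and k: "k \<in> {g. continuous_map (nsphere n) Y g \<and> g sphere_base = f x}"
    then obtain g where g: "g \<in> ?M" "pointed_homotopic n Y (f x) (f \<circ> g) k" using surj by blast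
    show "c \<in> (\<lambda>g. pointed_class n Y (f x) (f \<circ> g)) ` ?M"
      using g(2) unfolding c eqY[OF g(1), symmetric] using g(1) by blast
  qed
  finally show "homotopy_group_map n Y f x ` homotopy_group n X x = homotopy_group n Y (f x)" .
qed

text \<open>The track of a point under a homotopy from the identity is a path to its image; this
  gives both injectivity and surjectivity.\<close>

lemma bij_betw_path_components_map:
  assumes f: "continuous_map X Y f" and g: "continuous_map Y X g"
    and gf: "homotopic_with (\<lambda>_. True) X X id (g \<circ> f)" and fg: "homotopic_with (\<lambda>_. True) Y Y id (f \<circ> g)"
  shows "bij_betw (path_components_map Y f) (path_components_of X) (path_components_of Y)"
proof -
  have id_path: "path_component_of Z z (e z)"
    if e: "homotopic_with (\<lambda>_. True) Z Z id e" and z: "z \<in> topspace Z" for Z :: "'c topology" and e z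
  proof -
    obtain h where h: "continuous_map (prod_topology I01 Z) Z h" "\<And>a. h (0, a) = a" "\<And>a. h (1, a) = e a"
      using e by (auto simp: homotopic_with_def)
    have "continuous_map I01 Z (\<lambda>t. h (t, z))"
      by (intro continuous_map_compose[OF _ h(1), unfolded o_def] continuous_map_pairedI) (use z in auto)
    then show ?thesis
      unfolding path_component_of_def pathin_def using h by (intro exI[of _ "\<lambda>t. h (t, z)"]) auto
  qed
  have map: "path_components_map Y f (path_component_of_set X x) = path_component_of_set Y (f x)"
    if "x \<in> topspace X" for x
  proof -
    have "path_component_of_set Y (f y) = path_component_of_set Y (f x)"
      if "path_component_of X x y" for y
      using path_component_of_continuous_image[OF f that] path_component_of_equiv by (metis (full_types))
    then show ?thesis
      unfolding path_components_map_def using path_component_of_refl[of X x] \<open>x \<in> topspace X\<close> by blast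
  qed
  show ?thesis
    unfolding bij_betw_def
  proof
    show "inj_on (path_components_map Y f) (path_components_of X)"
    proof (rule inj_onI)
      fix c d assume "c \<in> path_components_of X" "d \<in> path_components_of X"
        and eq: "path_components_map Y f c = path_components_map Y f d"
      then obtain x y where x: "x \<in> topspace X" "c = path_component_of_set X x"
        and y: "y \<in> topspace X" "d = path_component_of_set X y"
        by (auto simp: path_components_of_def)
      have fy: "f y \<in> topspace Y" using f y by (auto simp: continuous_map_def)
      have "path_component_of_set Y (f x) = path_component_of_set Y (f y)"
        using eq map x y by simp
      then have "path_component_of Y (f x) (f y)"
        using path_component_of_refl[of Y "f y"] fy by blast
      then have "path_component_of X (g (f x)) (g (f y))"
        by (rule path_component_of_continuous_image[OF g])
      moreover have "path_component_of X x (g (f x))" "path_component_of X y (g (f y))"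
        using id_path[OF gf x(1)] id_path[OF gf y(1)] by auto
      ultimately have "path_component_of X x y"
        by (meson path_component_of_trans path_component_of_sym)
      then show "c = d" using x y path_component_of_equiv by (metis (full_types))
    qed
    show "path_components_map Y f ` path_components_of X = path_components_of Y"
    proof (intro equalityI subsetI)
      fix c assume "c \<in> path_components_map Y f ` path_components_of X"
      then show "c \<in> path_components_of Y"
        using map f by (auto simp: path_components_of_def continuous_map_def)
    next
      fix c assume "c \<in> path_components_of Y"
      then obtain y where y: "y \<in> topspace Y" "c = path_component_of_set Y y"
        by (auto simp: path_components_of_def)
      have gy: "g y \<in> topspace X" using g y by (auto simp: continuous_map_def)
      have "path_component_of Y y (f (g y))" using id_path[OF fg y(1)] by simp
      then have "c = path_components_map Y f (path_component_of_set X (g y))"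
        using map[OF gy] y path_component_of_equiv by (metis (full_types))
      then show "c \<in> path_components_map Y f ` path_components_of X"
        using gy by (auto simp: path_components_of_def)
    qed
  qed
qed

text \<open>Injectivity: apply \<open>g\<close> and cancel \<open>g \<circ> f\<close>. Surjectivity:
  lift \<open>g \<circ> k\<close> through \<open>g \<circ> f\<close> to a map \<open>u\<close>.
  Applying \<open>f\<close> shows that \<open>f \<circ> u\<close> and \<open>k\<close> agree after
  composition with \<open>f \<circ> g\<close>, which reflects pointed homotopies.\<close>

lemma weak_equivalence_homotopy_equivalence:
  assumes f: "continuous_map X Y f" and g: "continuous_map Y X g"
    and gf: "homotopic_with (\<lambda>_. True) X X id (g \<circ> f)" and fg: "homotopic_with (\<lambda>_. True) Y Y id (f \<circ> g)"
  shows "weak_equivalence X Y f"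
  unfolding weak_equivalence_def
proof (intro conjI allI impI ballI f bij_betw_path_components_map[OF assms])
  fix n :: nat and x assume x: "x \<in> topspace X"
  show "bij_betw (homotopy_group_map n Y f x) (homotopy_group n X x) (homotopy_group n Y (f x))"
  proof (rule bij_betw_homotopy_group_mapI[OF f])
    fix u v assume u: "continuous_map (nsphere n) X u" "u sphere_base = x"
      and v: "continuous_map (nsphere n) X v" "v sphere_base = x"
      and P: "pointed_homotopic n Y (f x) (f \<circ> u) (f \<circ> v)"
    have "pointed_homotopic n X ((g \<circ> f) x) (g \<circ> (f \<circ> u)) (g \<circ> (f \<circ> v))"
      by (rule homotopic_with_compose_continuous_map_left[OF P g]) simp
    then show "pointed_homotopic n X x u v"
      by (intro homotopic_id_reflects_pointed_homotopic[OF gf u v]) (simp only: o_assoc)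
  next
    fix k assume k: "continuous_map (nsphere n) Y k" "k sphere_base = f x"
    have gk: "continuous_map (nsphere n) X (g \<circ> k)" "(g \<circ> k) sphere_base = (g \<circ> f) x"
      using k g by (auto intro: continuous_map_compose)
    obtain u where u: "continuous_map (nsphere n) X u" "u sphere_base = x"
      and P: "pointed_homotopic n X ((g \<circ> f) x) ((g \<circ> f) \<circ> u) (g \<circ> k)"
      by (rule homotopic_id_lifts_pointed_map[OF gf x gk])
    have fu: "continuous_map (nsphere n) Y (f \<circ> u)" "(f \<circ> u) sphere_base = f x"
      using u f by (auto intro: continuous_map_compose)
    have "pointed_homotopic n Y ((f \<circ> g) (f x)) (f \<circ> ((g \<circ> f) \<circ> u)) (f \<circ> (g \<circ> k))"
      by (rule homotopic_with_compose_continuous_map_left[OF P f]) simp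
    then have "pointed_homotopic n Y (f x) (f \<circ> u) k"
      by (intro homotopic_id_reflects_pointed_homotopic[OF fg fu k]) (simp only: o_assoc)
    with u show "\<exists>u. continuous_map (nsphere n) X u \<and> u sphere_base = x \<and>
        pointed_homotopic n Y (f x) (f \<circ> u) k"
      by blast
  qed
qed

section \<open>Mapping spaces\<close>

lemma topspace_compact_open_topology [simp]:
  "topspace (compact_open_topology X Y) = mapping_points X Y"
  using topspace_mapping_space[of X Y] by (simp only: mapping_space_def topspace_kification)

lemma openin_compact_open_topology:
  assumes "compactin X C" "openin Y U"
  shows "openin (compact_open_topology X Y) {f \<in> mapping_points X Y. f ` C \<subseteq> U}"
  unfolding compact_open_topology_def using assms by (intro topology_generated_by_Basis) blast

text \<open>Regularity of \<open>X\<close> puts a closed, hence compact, neighbourhood of the point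
  inside the preimage of \<open>U\<close>, and this compact set gives the required subbasic
  neighbourhood of the map.\<close>

lemma continuous_map_eval_compact_open:
  assumes X: "compact_space X" "Hausdorff_space X"
  shows "continuous_map (prod_topology (compact_open_topology X Y) X) Y (\<lambda>p. fst p (snd p))"
  unfolding continuous_map_def
proof (intro conjI allI impI)
  let ?P = "prod_topology (compact_open_topology X Y) X"
  show "(\<lambda>p. fst p (snd p)) \<in> topspace ?P \<rightarrow> topspace Y"
    by (auto simp: mapping_points_def continuous_map_def)
  fix U assume U: "openin Y U"
  show "openin ?P {p \<in> topspace ?P. fst p (snd p) \<in> U}"
    unfolding openin_prod_topology_alt
  proof (intro allI impI)
    fix f x assume "(f, x) \<in> {p \<in> topspace ?P. fst p (snd p) \<in> U}"
    then have f: "f \<in> mapping_points X Y" and x: "x \<in> topspace X" "f x \<in> U" by auto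
    have "openin X {z \<in> topspace X. f z \<in> U}"
      using f U by (auto simp: mapping_points_def continuous_map_def)
    moreover have "neighbourhood_base_of (closedin X) X"
      using X compact_Hausdorff_imp_regular_space neighbourhood_base_of_closedin by blast
    ultimately obtain W C where WC: "openin X W" "closedin X C" "x \<in> W" "W \<subseteq> C"
        "C \<subseteq> {z \<in> topspace X. f z \<in> U}"
      using x unfolding neighbourhood_base_of by (smt (verit) mem_Collect_eq)
    have "compactin X C" using X(1) WC(2) by (rule closedin_compact_space)
    then have "openin (compact_open_topology X Y) {g \<in> mapping_points X Y. g ` C \<subseteq> U}"
      using U by (rule openin_compact_open_topology)
    moreover have "f \<in> {g \<in> mapping_points X Y. g ` C \<subseteq> U}" using f WC by auto
    moreover have "{g \<in> mapping_points X Y. g ` C \<subseteq> U} \<times> W \<subseteq> {p \<in> topspace ?P. fst p (snd p) \<in> U}"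
      using WC(4,5) by (auto simp: image_subset_iff subset_iff)
    ultimately show "\<exists>V W. openin (compact_open_topology X Y) V \<and> openin X W \<and> f \<in> V \<and> x \<in> W \<and>
        V \<times> W \<subseteq> {p \<in> topspace ?P. fst p (snd p) \<in> U}"
      using WC by blast
  qed
qed

text \<open>The compact set \<open>C\<close> of a subbasic neighbourhood is what the tube lemma asks
  for: the preimage of \<open>U\<close> is an open set around \<open>{a} \<times> C\<close>.\<close>

lemma continuous_map_into_compact_open_topology:
  assumes h: "continuous_map (prod_topology A X) Y (\<lambda>p. h (fst p) (snd p))"
    and ext: "\<And>a. a \<in> topspace A \<Longrightarrow> h a \<in> extensional (topspace X)"
  shows "continuous_map A (compact_open_topology X Y) h"
  unfolding compact_open_topology_def
proof (rule continuous_on_generated_topo)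
  let ?B = "{{f \<in> mapping_points X Y. f ` C \<subseteq> U} | C U. compactin X C \<and> openin Y U}"
  have into: "h a \<in> mapping_points X Y" if "a \<in> topspace A" for a
  proof -
    have "continuous_map X Y (\<lambda>x. h a x)"
      using continuous_map_o_Pair[OF h that] by (simp add: o_def)
    then show ?thesis using ext[OF that] by (simp add: mapping_points_def)
  qed
  \<comment> \<open>The empty compact set makes the whole space subbasic, so the subbasis covers
    it.\<close>
  have "mapping_points X Y = {f \<in> mapping_points X Y. f ` {} \<subseteq> {}}" by simp
  then have "mapping_points X Y \<in> ?B" using compactin_empty openin_empty by blast
  then show "h ` topspace A \<subseteq> \<Union> ?B" using into by blast
  fix S assume "S \<in> ?B"
  then obtain C U where S: "S = {f \<in> mapping_points X Y. f ` C \<subseteq> U}" "compactin X C" "openin Y U"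
    by blast
  let ?W = "{p \<in> topspace (prod_topology A X). h (fst p) (snd p) \<in> U}"
  have W: "openin (prod_topology A X) ?W"
    using h S(3) by (auto simp: continuous_map_def)
  show "openin A (h -` S \<inter> topspace A)"
    unfolding openin_subopen[of _ "h -` S \<inter> topspace A"]
  proof
    fix a assume a: "a \<in> h -` S \<inter> topspace A"
    have CX: "C \<subseteq> topspace X" by (rule compactin_subset_topspace[OF S(2)])
    have "{a} \<times> C \<subseteq> ?W" using a CX by (auto simp: S(1))
    then obtain V W' where V: "openin A V" "a \<in> V" "C \<subseteq> W'" "V \<times> W' \<subseteq> ?W"
      using tube_lemma_right[OF W S(2), of a] a by blast
    have "V \<subseteq> h -` S \<inter> topspace A"
    proof
      fix b assume b: "b \<in> V"
      then have bA: "b \<in> topspace A" using openin_subset[OF V(1)] by blast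
      have "h b x \<in> U" if "x \<in> C" for x using V b that by force
      then show "b \<in> h -` S \<inter> topspace A" using into[OF bA] bA by (auto simp: S(1))
    qed
    then show "\<exists>T. openin A T \<and> a \<in> T \<and> T \<subseteq> h -` S \<inter> topspace A" using V by blast
  qed
qed

text \<open>Maps out of a k-space are tested on compact subsets, and kification of the target does
  not affect their continuity. The parameters thus range over a compact space, which later bounds
  the supports of points of realizations.\<close>

lemma continuous_map_into_mapping_space:
  assumes A: "k_space A"
    and h: "\<And>C. compactin A C \<Longrightarrow>
      continuous_map (prod_topology (subtopology A C) X) Y (\<lambda>p. h (fst p) (snd p))"
    and ext: "\<And>a. a \<in> topspace A \<Longrightarrow> h a \<in> extensional (topspace X)"
  shows "continuous_map A (mapping_space X Y) h"
  unfolding mapping_space_def continuous_map_into_kification[OF A]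
  by (intro continuous_map_from_k_space[OF A] continuous_map_into_compact_open_topology h ext) auto

lemma continuous_map_mapping_space_eval:
  assumes X: "compact_space X" "Hausdorff_space X"
    and f: "continuous_map A (mapping_space X Y) f" and x: "continuous_map A X x"
  shows "continuous_map A Y (\<lambda>a. f a (x a))"
proof -
  have "continuous_map A (compact_open_topology X Y) f"
    using continuous_map_compose[OF f, unfolded mapping_space_def, OF continuous_map_from_kification[OF continuous_map_id]]
    by simp
  then have "continuous_map A Y ((\<lambda>p. fst p (snd p)) \<circ> (\<lambda>a. (f a, x a)))"
    by (intro continuous_map_compose[OF _ continuous_map_eval_compact_open[OF X]] continuous_map_pairedI x)
  then show ?thesis by (simp add: o_def)
qed

lemma Hausdorff_space_finer:
  assumes "Hausdorff_space X" "topspace X = topspace X'" "\<And>U. openin X U \<Longrightarrow> openin X' U"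
  shows "Hausdorff_space X'"
  using assms unfolding Hausdorff_space_def by metis

text \<open>The middle space of a zigzag must be Hausdorff, and it will be a copy of the mapping
  space. Two maps differ at some \<open>x\<close>, and the compact set \<open>{x}\<close> turns
  disjoint neighbourhoods of the two values into disjoint subbasic sets.\<close>

lemma Hausdorff_space_mapping_space:
  assumes Y: "Hausdorff_space Y"
  shows "Hausdorff_space (mapping_space X Y)"
proof -
  have "Hausdorff_space (compact_open_topology X Y)"
    unfolding Hausdorff_space_def topspace_compact_open_topology
  proof (intro allI impI, elim conjE)
    fix f g assume f: "f \<in> mapping_points X Y" and g: "g \<in> mapping_points X Y" and "f \<noteq> g"
    then obtain x where x: "x \<in> topspace X" "f x \<noteq> g x"
      unfolding mapping_points_def by (metis (mono_tags, lifting) extensionalityI mem_Collect_eq)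
    have "f x \<in> topspace Y" "g x \<in> topspace Y"
      using f g x by (auto simp: mapping_points_def continuous_map_def)
    then obtain U V where UV: "openin Y U" "openin Y V" "f x \<in> U" "g x \<in> V" "disjnt U V"
      using Y x unfolding Hausdorff_space_def by metis
    have cx: "compactin X {x}" using x by simp
    let ?U = "\<lambda>U. {f \<in> mapping_points X Y. f ` {x} \<subseteq> U}"
    have "openin (compact_open_topology X Y) (?U U)" "openin (compact_open_topology X Y) (?U V)"
      using openin_compact_open_topology[OF cx] UV by blast+
    moreover have "f \<in> ?U U" "g \<in> ?U V" "disjnt (?U U) (?U V)"
      using f g UV by (auto simp: disjnt_def)
    ultimately show "\<exists>U V. openin (compact_open_topology X Y) U \<and> openin (compact_open_topology X Y) V \<and>
        f \<in> U \<and> g \<in> V \<and> disjnt U V" by blast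
  qed
  then show ?thesis
    unfolding mapping_space_def by (rule Hausdorff_space_finer) (simp_all add: openin_kification_finer)
qed


section \<open>Homotopy limits\<close>

lemma topspace_holim_op:
  "topspace (holim_op J F r) =
     {\<phi> \<in> \<Pi>\<^sub>E i\<in>J. mapping_points (up_nerve J i) (F i).
        \<forall>i\<in>J. \<forall>j\<in>J. i \<le> j \<longrightarrow> (\<forall>p\<in>topspace (up_nerve J j). \<phi> i p = r i j (\<phi> j p))}"
  by (auto simp: holim_op_def)

lemma continuous_map_into_holim_op:
  assumes A: "k_space A"
    and h: "\<And>i C. i \<in> J \<Longrightarrow> compactin A C \<Longrightarrow>
      continuous_map (prod_topology (subtopology A C) (up_nerve J i)) (F i) (\<lambda>q. h (fst q) i (snd q))"
    and extJ: "\<And>a. a \<in> topspace A \<Longrightarrow> h a \<in> extensional J"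
    and ext: "\<And>a i. a \<in> topspace A \<Longrightarrow> i \<in> J \<Longrightarrow> h a i \<in> extensional (topspace (up_nerve J i))"
    and compat: "\<And>a i j p. a \<in> topspace A \<Longrightarrow> i \<in> J \<Longrightarrow> j \<in> J \<Longrightarrow> i \<le> j \<Longrightarrow>
      p \<in> topspace (up_nerve J j) \<Longrightarrow> h a i p = r i j (h a j p)"
  shows "continuous_map A (holim_op J F r) h"
  unfolding holim_op_def continuous_map_into_kification[OF A] continuous_map_in_subtopology
    continuous_map_componentwise
proof (intro conjI ballI)
  show "continuous_map A (mapping_space (up_nerve J i) (F i)) (\<lambda>a. h a i)" if "i \<in> J" for i
    by (rule continuous_map_into_mapping_space[OF A]) (use that h ext in auto)
qed (auto intro!: extJ compat)

lemma continuous_map_holim_op_eval: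
  assumes i: "i \<in> J" and X: "compact_space (up_nerve J i)" "Hausdorff_space (up_nerve J i)"
    and f: "continuous_map A (holim_op J F r) f" and x: "continuous_map A (up_nerve J i) x"
  shows "continuous_map A (F i) (\<lambda>a. f a i (x a))"
proof (rule continuous_map_mapping_space_eval[OF X _ x])
  have "continuous_map (holim_op J F r) (mapping_space (up_nerve J i) (F i)) (\<lambda>\<phi>. \<phi> i)"
    unfolding holim_op_def
    by (intro continuous_map_from_kification continuous_map_from_subtopology
        continuous_map_product_projection i)
  then show "continuous_map A (mapping_space (up_nerve J i) (F i)) (\<lambda>a. f a i)"
    using continuous_map_compose[OF f] by (simp add: o_def)
qed


section \<open>Maps into realizations\<close>

abbreviation supp :: "('a \<Rightarrow> real) \<Rightarrow> 'a set" where
  "supp t \<equiv> {v. t v \<noteq> 0}"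

lemma realization_points_supp:
  assumes "t \<in> realization_points K"
  shows "supp t \<in> K" "finite (supp t)" "0 \<le> t v" "(\<Sum>v\<in>supp t. t v) = 1"
  using assms by (auto simp: realization_points_def)

lemma sum_realization_points:
  assumes "t \<in> realization_points K" "finite S" "supp t \<subseteq> S"
  shows "(\<Sum>v\<in>S. t v) = 1"
proof -
  have "(\<Sum>v\<in>supp t. t v) = (\<Sum>v\<in>S. t v)"
    by (rule sum.mono_neutral_left) (use assms in auto)
  then show ?thesis using realization_points_supp(4)[OF assms(1)] by simp
qed

lemma realization_pointsI:
  assumes "\<And>v. 0 \<le> t v" "finite S" "supp t \<subseteq> S" "(\<Sum>v\<in>S. t v) = 1" "supp t \<in> K"
  shows "t \<in> realization_points K"
proof -
  have "(\<Sum>v\<in>supp t. t v) = (\<Sum>v\<in>S. t v)"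
    by (rule sum.mono_neutral_left) (use assms in auto)
  then show ?thesis
    using assms finite_subset[OF assms(3,2)] by (simp add: realization_points_def)
qed

lemma realization_points_mono: "K \<subseteq> L \<Longrightarrow> realization_points K \<subseteq> realization_points L"
  by (auto simp: realization_points_def)

lemma realization_points_in_closed_cell:
  assumes "t \<in> realization_points K" "finite \<sigma>" "supp t \<subseteq> \<sigma>"
  shows "t \<in> closed_cell \<sigma>"
  using sum_realization_points[OF assms] assms by (auto simp: closed_cell_def realization_points_def)

lemma continuous_map_realization_coordinate:
  assumes "scomplex K"
  shows "continuous_map (realization K) euclideanreal (\<lambda>t. t v)"
  unfolding continuous_map_def topspace_realization[OF assms] openin_realization
proof (intro conjI allI impI ballI)
  fix U :: "real set" and \<sigma> assume U: "openin euclideanreal U" and \<sigma>: "\<sigma> \<in> K"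
  have "continuous_on (closed_cell \<sigma>) (\<lambda>t::'a \<Rightarrow> real. t v)"
    by (rule continuous_on_product_then_coordinatewise) (rule continuous_on_id)
  then have "openin (top_of_set (closed_cell \<sigma>)) (closed_cell \<sigma> \<inter> (\<lambda>t. t v) -` U)"
    using U by (intro continuous_openin_preimage_gen) auto
  moreover have "closed_cell \<sigma> \<inter> (\<lambda>t. t v) -` U =
      {t \<in> realization_points K. t v \<in> U} \<inter> closed_cell \<sigma>"
    using closed_cell_subset_realization[OF assms \<sigma>] by auto
  ultimately show "openin (top_of_set (closed_cell \<sigma>)) ({t \<in> realization_points K. t v \<in> U} \<inter> closed_cell \<sigma>)"
    by simp
qed auto

text \<open>The coordinates are continuous in the coherent topology and separate points.\<close>

lemma Hausdorff_space_realization: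
  assumes "scomplex K"
  shows "Hausdorff_space (realization K)"
  unfolding Hausdorff_space_def
proof (intro allI impI, elim conjE)
  fix s t assume s: "s \<in> topspace (realization K)" and t: "t \<in> topspace (realization K)" and "s \<noteq> t"
  then obtain v where "s v \<noteq> t v" by auto
  then obtain U V where UV: "open U" "open V" "s v \<in> U" "t v \<in> V" "U \<inter> V = {}"
    using hausdorff by metis
  let ?p = "\<lambda>U. {t \<in> topspace (realization K). t v \<in> U}"
  have "openin (realization K) (?p U)" "openin (realization K) (?p V)"
    using continuous_map_realization_coordinate[OF assms, of v] UV by (auto simp: continuous_map_def)
  moreover have "s \<in> ?p U" "t \<in> ?p V" "disjnt (?p U) (?p V)"
    using s t UV by (auto simp: disjnt_def)
  ultimately show "\<exists>U V. openin (realization K) U \<and> openin (realization K) V \<and> s \<in> U \<and> t \<in> V \<and> disjnt U V"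
    by blast
qed

text \<open>The cell is closed in a product of compact sets, the unit interval for vertices of
  \<open>\<sigma>\<close> and \<open>{0}\<close> for all others.\<close>

lemma compact_closed_cell:
  assumes "finite \<sigma>"
  shows "compact (closed_cell \<sigma> :: ('a \<Rightarrow> real) set)"
proof -
  let ?B = "\<Pi>\<^sub>E v\<in>UNIV. (if v \<in> \<sigma> then {0..1::real} else {0})"
  have "compactin (powertop_real UNIV) ?B"
    by (rule compactin_PiE[THEN iffD2]) auto
  then have B: "compact ?B" by (simp add: euclidean_product_topology)
  have coord: "continuous_on UNIV (\<lambda>t::'a \<Rightarrow> real. t v)" for v
    by (rule continuous_on_product_then_coordinatewise) (rule continuous_on_id)
  have "closed {t::'a \<Rightarrow> real. (\<Sum>v\<in>\<sigma>. t v) = 1}"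
    by (intro closed_Collect_eq continuous_on_sum coord continuous_on_const)
  then have "compact (?B \<inter> {t. (\<Sum>v\<in>\<sigma>. t v) = 1})" by (rule compact_Int_closed[OF B])
  moreover have "?B \<inter> {t. (\<Sum>v\<in>\<sigma>. t v) = 1} = closed_cell \<sigma>"
  proof (intro equalityI subsetI)
    fix t :: "'a \<Rightarrow> real" assume "t \<in> closed_cell \<sigma>"
    then have t: "\<forall>v. 0 \<le> t v" "\<forall>v. v \<notin> \<sigma> \<longrightarrow> t v = 0" "(\<Sum>v\<in>\<sigma>. t v) = 1"
      by (auto simp: closed_cell_def)
    have "t v \<le> 1" if "v \<in> \<sigma>" for v
      using member_le_sum[of v \<sigma> t] that assms t by auto
    then show "t \<in> ?B \<inter> {t. (\<Sum>v\<in>\<sigma>. t v) = 1}" using t by (auto simp: PiE_iff)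
  next
    fix t :: "'a \<Rightarrow> real" assume "t \<in> ?B \<inter> {t. (\<Sum>v\<in>\<sigma>. t v) = 1}"
    then have t: "\<And>v. t v \<in> (if v \<in> \<sigma> then {0..1} else {0})" "(\<Sum>v\<in>\<sigma>. t v) = 1"
      by (auto simp: PiE_iff)
    have "0 \<le> t v" "v \<notin> \<sigma> \<longrightarrow> t v = 0" for v using t(1)[of v] by (auto split: if_splits)
    then show "t \<in> closed_cell \<sigma>" using t(2) by (simp add: closed_cell_def)
  qed
  ultimately show ?thesis by simp
qed

lemma continuous_map_closed_cell_inclusion:
  assumes "scomplex K" "\<sigma> \<in> K"
  shows "continuous_map (top_of_set (closed_cell \<sigma>)) (realization K) (\<lambda>t. t)"
  unfolding continuous_map_def topspace_realization[OF assms(1)]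
proof (intro conjI allI impI)
  show "(\<lambda>t. t) \<in> topspace (top_of_set (closed_cell \<sigma>)) \<rightarrow> realization_points K"
    using closed_cell_subset_realization[OF assms] by auto
  fix U assume "openin (realization K) U"
  then have "openin (top_of_set (closed_cell \<sigma>)) (U \<inter> closed_cell \<sigma>)"
    using assms by (simp add: openin_realization)
  moreover have "U \<inter> closed_cell \<sigma> = {t \<in> topspace (top_of_set (closed_cell \<sigma>)). t \<in> U}" by auto
  ultimately show "openin (top_of_set (closed_cell \<sigma>)) {t \<in> topspace (top_of_set (closed_cell \<sigma>)). t \<in> U}"
    by simp
qed

lemma compact_space_realization:
  assumes K: "scomplex K" "finite K"
  shows "compact_space (realization K)"
proof -
  have "compactin (realization K) ((\<lambda>t. t) ` closed_cell \<sigma>)" if "\<sigma> \<in> K" for \<sigma>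
  proof (rule image_compactin[OF _ continuous_map_closed_cell_inclusion[OF K(1) that]])
    show "compactin (top_of_set (closed_cell \<sigma>)) (closed_cell \<sigma>)"
      using that K by (simp add: compactin_subtopology compact_closed_cell scomplex_def)
  qed
  then have "compactin (realization K) (\<Union>\<sigma>\<in>K. closed_cell \<sigma>)"
    using K(2) by (intro compactin_Union) auto
  moreover have "(\<Union>\<sigma>\<in>K. closed_cell \<sigma>) = topspace (realization K)"
    unfolding topspace_realization[OF K(1)]
  proof (intro equalityI subsetI)
    fix t assume t: "t \<in> realization_points K"
    show "t \<in> (\<Union>\<sigma>\<in>K. closed_cell \<sigma>)"
      using realization_points_in_closed_cell[OF t realization_points_supp(2)[OF t] order_refl]
        realization_points_supp(1)[OF t] by blast
  qed (use closed_cell_subset_realization[OF K(1)] in blast)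
  ultimately show ?thesis by (simp add: compact_space_def)
qed

text \<open>If infinitely many vertices \<open>v\<close> occurred in a compact set, choose a point \<open>x v\<close> of the set
  for each of them.  Every closed cell contains only finitely many of these points, so each subset of
  them is closed and they have no accumulation point.\<close>

lemma finite_supp_compactin_realization:
  assumes K: "scomplex K" and C: "compactin (realization K) C"
  shows "finite (\<Union>t\<in>C. supp t)"
proof (rule ccontr)
  let ?S = "\<Union>t\<in>C. supp t"
  assume inf: "infinite ?S"
  have CK: "C \<subseteq> realization_points K"
    using compactin_subset_topspace[OF C] topspace_realization[OF K] by simp
  obtain x where x: "\<And>v. v \<in> ?S \<Longrightarrow> x v \<in> C \<and> x v v \<noteq> 0"
    by (metis (mono_tags, lifting) UN_E mem_Collect_eq)
  let ?D = "x ` ?S"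
  \<comment> \<open>The choice \<open>x\<close> may fail to be injective. Still, finitely many
    points have only finitely many vertices in their supports.\<close>
  have infD: "infinite ?D"
  proof
    assume fin: "finite ?D"
    have "?S \<subseteq> (\<Union>t\<in>?D. supp t)" using x by blast
    moreover have "finite (\<Union>t\<in>?D. supp t)"
      using fin x CK realization_points_supp(2) by blast
    ultimately show False using inf finite_subset by blast
  qed
  have closed: "closedin (realization K) E" if "E \<subseteq> ?D" for E
    unfolding closedin_def topspace_realization[OF K] openin_realization
  proof (intro conjI ballI)
    have "?D \<subseteq> C" using x by blast
    then show "E \<subseteq> realization_points K" using that CK by (meson order_trans)
    fix \<sigma> assume \<sigma>: "\<sigma> \<in> K"
    have "E \<inter> closed_cell \<sigma> \<subseteq> x ` \<sigma>"
    proof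
      fix y assume y: "y \<in> E \<inter> closed_cell \<sigma>"
      then have "y \<in> ?D" using that by (meson IntD1 subsetD)
      then obtain v where v: "v \<in> ?S" "y = x v" by (rule imageE)
      have "\<forall>w. w \<notin> \<sigma> \<longrightarrow> y w = 0" using y unfolding closed_cell_def by blast
      then have "v \<in> \<sigma>" using x[OF v(1)] v(2) by metis
      then show "y \<in> x ` \<sigma>" using v(2) by blast
    qed
    then have "finite (E \<inter> closed_cell \<sigma>)"
      using \<sigma> K by (meson finite_imageI finite_subset scomplex_def)
    moreover have "Hausdorff_space (top_of_set (closed_cell \<sigma>))"
      unfolding euclidean_product_topology[symmetric]
      by (intro Hausdorff_space_subtopology) (simp add: Hausdorff_space_product_topology)
    ultimately have "closedin (top_of_set (closed_cell \<sigma>)) (E \<inter> closed_cell \<sigma>)"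
      by (intro closedin_Hausdorff_finite) auto
    then have "openin (top_of_set (closed_cell \<sigma>)) (closed_cell \<sigma> - E \<inter> closed_cell \<sigma>)"
      by (simp add: openin_diff)
    moreover have "closed_cell \<sigma> - E \<inter> closed_cell \<sigma> = (realization_points K - E) \<inter> closed_cell \<sigma>"
      using closed_cell_subset_realization[OF K \<sigma>] by auto
    ultimately show "openin (top_of_set (closed_cell \<sigma>)) ((realization_points K - E) \<inter> closed_cell \<sigma>)"
      by simp
  qed simp
  have "?D \<subseteq> C" using x by blast
  then have "C \<inter> realization K derived_set_of ?D \<noteq> {}"
    using compactin_imp_Bolzano_Weierstrass[OF C] infD by blast
  then obtain t where t: "t \<in> C" "t \<in> realization K derived_set_of ?D" by blast
  let ?U = "topspace (realization K) - (?D - {t})"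
  have "openin (realization K) ?U"
    using closed[of "?D - {t}"] by (simp add: closedin_def)
  moreover have "t \<in> ?U" using t(2) by (simp add: in_derived_set_of)
  ultimately obtain y where "y \<noteq> t" "y \<in> ?D" "y \<in> ?U"
    using t(2) unfolding in_derived_set_of by metis
  then show False by simp
qed

lemma finite_supp_compact_map:
  assumes "scomplex K" "compact_space A" "continuous_map A (realization K) f"
  shows "finite (\<Union>a\<in>topspace A. supp (f a))"
proof -
  have "compactin (realization K) (f ` topspace A)"
    using assms(2,3) by (intro image_compactin) (auto simp: compact_space_def)
  then have "finite (\<Union>t\<in>f ` topspace A. supp t)"
    by (rule finite_supp_compactin_realization[OF assms(1)])
  moreover have "(\<Union>t\<in>f ` topspace A. supp t) = (\<Union>a\<in>topspace A. supp (f a))" by blast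
  ultimately show ?thesis by simp
qed

lemma closedin_common_zeros:
  assumes "finite I" "\<And>i. i \<in> I \<Longrightarrow> continuous_map A euclideanreal (f i)"
  shows "closedin A {a \<in> topspace A. \<forall>i\<in>I. f i a = 0}"
  using assms
proof (induction I)
  case (insert i I)
  have "closedin A {a \<in> topspace A. f i a \<in> {0}}"
    by (rule closedin_continuous_map_preimage) (use insert.prems in auto)
  then have "closedin A ({a \<in> topspace A. f i a \<in> {0}} \<inter> {a \<in> topspace A. \<forall>i\<in>I. f i a = 0})"
    using insert by (intro closedin_Int) auto
  moreover have "{a \<in> topspace A. f i a \<in> {0}} \<inter> {a \<in> topspace A. \<forall>i\<in>I. f i a = 0} =
      {a \<in> topspace A. \<forall>i\<in>insert i I. f i a = 0}" by auto
  ultimately show ?case by simp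
qed simp

text \<open>The sets where the coordinates outside a simplex \<open>\<sigma> \<subseteq> S\<close>
  vanish form a finite closed cover of \<open>A\<close>. On each of them the map enters one closed
  cell, whose topology is that of coordinates. Once supports are uniformly finite, continuity is
  thereby a question about real functions.\<close>

lemma continuous_map_into_realization:
  assumes K: "scomplex K" and S: "finite S"
    and f: "\<And>a. a \<in> topspace A \<Longrightarrow> f a \<in> realization_points K" "\<And>a. a \<in> topspace A \<Longrightarrow> supp (f a) \<subseteq> S"
    and cont: "\<And>v. v \<in> S \<Longrightarrow> continuous_map A euclideanreal (\<lambda>a. f a v)"
  shows "continuous_map A (realization K) f"
proof -
  let ?I = "{\<sigma> \<in> K. \<sigma> \<subseteq> S}"
  let ?T = "\<lambda>\<sigma>. {a \<in> topspace A. \<forall>v\<in>S-\<sigma>. f a v = 0}"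
  have cont': "continuous_map A euclideanreal (\<lambda>a. f a v)" for v
  proof (cases "v \<in> S")
    case False
    have "continuous_map A euclideanreal (\<lambda>a. 0)" by simp
    then show ?thesis by (rule continuous_map_eq) (use f(2) False in auto)
  qed (rule cont)
  have cell: "f a \<in> closed_cell \<sigma>" if "\<sigma> \<in> ?I" "a \<in> ?T \<sigma>" for a \<sigma>
    using that f[of a] finite_subset[of \<sigma> S] S by (intro realization_points_in_closed_cell[OF f(1)]) auto
  show ?thesis
  proof (rule pasting_lemma_closed[where I = ?I and T = ?T and f = "\<lambda>_. f"])
    show "finite ?I" using S by (intro finite_subset[of ?I "Pow S"]) auto
    show "closedin A (?T \<sigma>)" for \<sigma>
      using S by (intro closedin_common_zeros cont') simp
    show "continuous_map (subtopology A (?T \<sigma>)) (realization K) f" if "\<sigma> \<in> ?I" for \<sigma>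
    proof -
      have "continuous_map (subtopology A (?T \<sigma>)) (top_of_set (closed_cell \<sigma>)) f"
        unfolding continuous_map_in_subtopology euclidean_product_topology[symmetric]
          continuous_map_componentwise_UNIV
        using cell[OF that] continuous_map_from_subtopology[OF cont'] by auto
      then show ?thesis
        using continuous_map_compose[OF _ continuous_map_closed_cell_inclusion[OF K, of \<sigma>]] that
        by (auto simp: o_def)
    qed
    show "\<exists>\<sigma>. \<sigma> \<in> ?I \<and> a \<in> ?T \<sigma> \<and> f a = f a" if "a \<in> topspace A" for a
      using f(2)[OF that] realization_points_supp(1)[OF f(1)[OF that]] that
      by (intro exI[of _ "supp (f a)"]) auto
  qed auto
qed

lemma continuous_map_coordinate:
  assumes "scomplex K" "continuous_map A (realization K) f"
  shows "continuous_map A euclideanreal (\<lambda>a. f a v)"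
  using continuous_map_compose[OF assms(2) continuous_map_realization_coordinate[OF assms(1)]]
  by (simp add: o_def)

lemma continuous_map_realization_points:
  assumes "scomplex K" "continuous_map A (realization K) f" "a \<in> topspace A"
  shows "f a \<in> realization_points K"
  using assms by (auto simp: continuous_map_def topspace_realization)

lemma scomplex_subset: "scomplex K \<Longrightarrow> \<sigma> \<in> K \<Longrightarrow> \<tau> \<subseteq> \<sigma> \<Longrightarrow> \<tau> \<in> K"
  by (auto simp: scomplex_def)

lemma realization_points_linear:
  assumes K: "scomplex K" and s: "s \<in> realization_points K" and t: "t \<in> realization_points K"
    and st: "supp s \<union> supp t \<in> K" and l: "0 \<le> l" "l \<le> 1"
  shows "(\<lambda>v. (1 - l) * s v + l * t v) \<in> realization_points K"
proof (rule realization_pointsI)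
  show "0 \<le> (1 - l) * s v + l * t v" for v
    using realization_points_supp(3)[OF s] realization_points_supp(3)[OF t] l by simp
  show fin: "finite (supp s \<union> supp t)" using s t by (simp add: realization_points_supp)
  show sub: "supp (\<lambda>v. (1 - l) * s v + l * t v) \<subseteq> supp s \<union> supp t" by auto
  show "supp (\<lambda>v. (1 - l) * s v + l * t v) \<in> K" by (rule scomplex_subset[OF K st sub])
  show "(\<Sum>v\<in>supp s \<union> supp t. (1 - l) * s v + l * t v) = 1"
    using sum_realization_points[OF s fin] sum_realization_points[OF t fin]
    by (simp add: sum.distrib flip: sum_distrib_left)
qed

text \<open>Compactness of \<open>A\<close> yields one finite set that carries all values of
  \<open>f\<close> and \<open>g\<close>; at each point the common simplex contains the
  segment.\<close>

lemma continuous_map_realization_linear: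
  assumes K: "scomplex K" and A: "compact_space A"
    and f: "continuous_map A (realization K) f" and g: "continuous_map A (realization K) g"
    and l: "continuous_map A euclideanreal l" "\<And>a. a \<in> topspace A \<Longrightarrow> 0 \<le> l a \<and> l a \<le> 1"
    and fg: "\<And>a. a \<in> topspace A \<Longrightarrow> supp (f a) \<union> supp (g a) \<in> K"
  shows "continuous_map A (realization K) (\<lambda>a v. (1 - l a) * f a v + l a * g a v)"
proof (rule continuous_map_into_realization[OF K])
  let ?S = "(\<Union>a\<in>topspace A. supp (f a)) \<union> (\<Union>a\<in>topspace A. supp (g a))"
  show "finite ?S" using finite_supp_compact_map[OF K A f] finite_supp_compact_map[OF K A g] by simp
  show "supp (\<lambda>v. (1 - l a) * f a v + l a * g a v) \<subseteq> ?S" if "a \<in> topspace A" for a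
    using that by force
  show "(\<lambda>v. (1 - l a) * f a v + l a * g a v) \<in> realization_points K" if "a \<in> topspace A" for a
    using that l(2) fg by (intro realization_points_linear continuous_map_realization_points[OF K f]
        continuous_map_realization_points[OF K g] K) auto
  show "continuous_map A euclideanreal (\<lambda>a. (1 - l a) * f a v + l a * g a v)" for v
    by (intro continuous_intros l(1) continuous_map_coordinate[OF K f] continuous_map_coordinate[OF K g])
qed

section \<open>Affine extension of maps of vertices\<close>

lemma realization_map_eq_sum:
  assumes "finite S" "supp t \<subseteq> S"
  shows "realization_map g t w = (\<Sum>v\<in>{v \<in> S. g v = w}. t v)"
  unfolding realization_map_def by (rule sum.mono_neutral_left) (use assms in auto)

lemma supp_realization_map: "supp (realization_map g t) \<subseteq> g ` supp t"
proof
  fix w assume w: "w \<in> supp (realization_map g t)"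
  show "w \<in> g ` supp t"
  proof (rule ccontr)
    assume "w \<notin> g ` supp t"
    then have "{v. t v \<noteq> 0 \<and> g v = w} = {}" by auto
    then have "realization_map g t w = 0" unfolding realization_map_def by (simp only: sum.empty)
    then show False using w by simp
  qed
qed

lemma realization_map_cong:
  assumes "\<And>v. t v \<noteq> 0 \<Longrightarrow> g v = h v"
  shows "realization_map g t = realization_map h t"
proof -
  have "{v. t v \<noteq> 0 \<and> g v = w} = {v. t v \<noteq> 0 \<and> h v = w}" for w using assms by auto
  then show ?thesis unfolding realization_map_def by simp
qed

lemma realization_map_comp:
  assumes "finite (supp t)"
  shows "realization_map g (realization_map f t) = realization_map (g \<circ> f) t"
proof
  fix w
  have "realization_map g (realization_map f t) w =
      (\<Sum>u\<in>{u \<in> f ` supp t. g u = w}. realization_map f t u)"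
    by (rule realization_map_eq_sum[OF finite_imageI[OF assms] supp_realization_map])
  also have "\<dots> = (\<Sum>u\<in>{u \<in> f ` supp t. g u = w}. \<Sum>v\<in>{v \<in> supp t. f v = u}. t v)"
    by (simp only: realization_map_eq_sum[OF assms order_refl])
  also have "\<dots> = (\<Sum>u\<in>{u \<in> f ` supp t. g u = w}. \<Sum>v\<in>{v \<in> {v \<in> supp t. g (f v) = w}. f v = u}. t v)"
    by (intro sum.cong refl) auto
  also have "\<dots> = (\<Sum>v\<in>{v \<in> supp t. g (f v) = w}. t v)"
    using assms by (intro sum.group) auto
  also have "\<dots> = realization_map (g \<circ> f) t w"
    by (simp add: realization_map_eq_sum[OF assms order_refl])
  finally show "realization_map g (realization_map f t) w = realization_map (g \<circ> f) t w" .
qed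

lemma realization_map_in_realization_points:
  assumes "scomplex L" "t \<in> realization_points K" "g ` supp t \<in> L"
  shows "realization_map g t \<in> realization_points L"
  using realization_map_in_closed_cell(2)[OF realization_points_supp(2)[OF assms(2)]
      realization_points_in_closed_cell[OF assms(2) realization_points_supp(2)[OF assms(2)] order_refl], of g]
    closed_cell_subset_realization[OF assms(1,3)] by blast


section \<open>Evaluation on internal homs\<close>

text \<open>With barycentric coordinates read as probability weights this is the product measure.
  Pushing it forward along \<open>(f, v) \<mapsto> f v\<close> gives the biaffine evaluation
  \<open>hom_eval\<close>, so that the facts about \<open>realization_map\<close> apply to
  it.\<close>

definition tensor :: "('a \<Rightarrow> real) \<Rightarrow> ('b \<Rightarrow> real) \<Rightarrow> 'a \<times> 'b \<Rightarrow> real" where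
  "tensor t s = (\<lambda>(f, v). t f * s v)"

definition hom_eval :: "(('v \<Rightarrow> 'w) \<Rightarrow> real) \<Rightarrow> ('v \<Rightarrow> real) \<Rightarrow> 'w \<Rightarrow> real" where
  "hom_eval t s = realization_map (\<lambda>(f, v). f v) (tensor t s)"

lemma supp_tensor: "supp (tensor t s) = supp t \<times> supp s"
  by (auto simp: tensor_def)

text \<open>The singleton is not a complex; it merely records the support, which is all that pushing
  points forward asks of the source.\<close>

lemma tensor_in_realization_points:
  assumes t: "t \<in> realization_points K" and s: "s \<in> realization_points L"
  shows "tensor t s \<in> realization_points {supp t \<times> supp s}"
proof (rule realization_pointsI)
  show "0 \<le> tensor t s v" for v
    using realization_points_supp(3)[OF t] realization_points_supp(3)[OF s]
    by (simp add: tensor_def split: prod.split)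
  show "finite (supp t \<times> supp s)" using s t by (simp add: realization_points_supp)
  have "(\<Sum>v\<in>supp t \<times> supp s. tensor t s v) = (\<Sum>f\<in>supp t. t f) * (\<Sum>v\<in>supp s. s v)"
    unfolding sum_product sum.cartesian_product tensor_def ..
  then show "(\<Sum>v\<in>supp t \<times> supp s. tensor t s v) = 1"
    using s t by (simp add: realization_points_supp)
qed (simp_all add: supp_tensor)

lemma supp_hom_eval: "supp (hom_eval t s) \<subseteq> (\<Union>f\<in>supp t. f ` supp s)"
  unfolding hom_eval_def
  by (rule order_trans[OF supp_realization_map]) (auto simp: supp_tensor)

text \<open>The union of images of the top simplex \<open>\<sigma>\<close> contains that of any
  face, so closure of \<open>Y\<close> under subsets leaves a single condition.\<close>

lemma hom_complex_Pow_iff: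
  assumes "scomplex Y"
  shows "S \<in> hom_complex (Pow \<sigma>) Y \<longleftrightarrow> finite S \<and> S \<subseteq> extensional \<sigma> \<and> (\<Union>f\<in>S. f ` \<sigma>) \<in> Y"
proof (intro iffI)
  assume "S \<in> hom_complex (Pow \<sigma>) Y"
  then show "finite S \<and> S \<subseteq> extensional \<sigma> \<and> (\<Union>f\<in>S. f ` \<sigma>) \<in> Y"
    by (auto simp: hom_complex_def simplicial_maps_def verts_def PiE_def)
next
  assume S: "finite S \<and> S \<subseteq> extensional \<sigma> \<and> (\<Union>f\<in>S. f ` \<sigma>) \<in> Y"
  have Y: "\<tau> \<in> Y" if "\<tau> \<subseteq> (\<Union>f\<in>S. f ` \<sigma>)" for \<tau>
    using S that scomplex_subset[OF assms] by blast
  have "f \<in> simplicial_maps (Pow \<sigma>) Y" if "f \<in> S" for f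
    unfolding simplicial_maps_def
  proof (intro CollectI conjI ballI PiE_I)
    show "f v \<in> verts Y" if "v \<in> verts (Pow \<sigma>)" for v
      using that \<open>f \<in> S\<close> by (auto simp: verts_def intro!: Y)
    show "f v = undefined" if "v \<notin> verts (Pow \<sigma>)" for v
      using that S \<open>f \<in> S\<close> by (auto simp: verts_def extensional_def)
    show "f ` \<tau> \<in> Y" if "\<tau> \<in> Pow \<sigma>" for \<tau>
      using that \<open>f \<in> S\<close> by (intro Y) auto
  qed
  moreover have "(\<Union>f\<in>S. f ` \<tau>) \<in> Y" if "\<tau> \<in> Pow \<sigma>" for \<tau>
    using that by (intro Y) auto
  ultimately show "S \<in> hom_complex (Pow \<sigma>) Y" using S by (auto simp: hom_complex_def)
qed

lemma hom_complex_Pow_image: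
  assumes "scomplex Y" "t \<in> realization_points (hom_complex (Pow \<sigma>) Y)"
  shows "(\<Union>f\<in>supp t. f ` \<sigma>) \<in> Y"
  by (rule realization_points_supp(1)[OF assms(2), unfolded hom_complex_Pow_iff[OF assms(1)],
        THEN conjunct2, THEN conjunct2])

lemma hom_eval_in_realization_points:
  assumes Y: "scomplex Y" and t: "t \<in> realization_points (hom_complex (Pow \<sigma>) Y)"
    and s: "s \<in> realization_points L" "supp s \<subseteq> \<sigma>"
  shows "hom_eval t s \<in> realization_points Y"
  unfolding hom_eval_def
proof (rule realization_map_in_realization_points[OF Y tensor_in_realization_points[OF t s(1)]])
  have "(\<Union>f\<in>supp t. f ` \<sigma>) \<in> Y" by (rule hom_complex_Pow_image[OF Y t])
  then show "(\<lambda>(f, v). f v) ` supp (tensor t s) \<in> Y"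
    by (rule scomplex_subset[OF Y]) (use s(2) in \<open>auto simp: supp_tensor\<close>)
qed

text \<open>Over a compact parameter space only finitely many functions and vertices occur, so each
  coordinate of the value is a fixed finite sum of products of coordinates.\<close>

lemma continuous_map_hom_eval:
  assumes Y: "scomplex Y" and L: "scomplex L" and A: "compact_space A"
    and t: "continuous_map A (realization (hom_complex (Pow \<sigma>) Y)) t"
    and s: "continuous_map A (realization L) s" "\<And>a. a \<in> topspace A \<Longrightarrow> supp (s a) \<subseteq> \<sigma>"
  shows "continuous_map A (realization Y) (\<lambda>a. hom_eval (t a) (s a))"
proof (rule continuous_map_into_realization[OF Y])
  note H = scomplex_hom_complex[OF Y, of "Pow \<sigma>"]
  let ?T = "\<Union>a\<in>topspace A. supp (t a)"
  let ?S = "\<Union>a\<in>topspace A. supp (s a)"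
  have fin: "finite ?T" "finite ?S"
    using finite_supp_compact_map[OF H A t] finite_supp_compact_map[OF L A s(1)] .
  then show "finite (\<Union>f\<in>?T. f ` ?S)" by blast
  show "supp (hom_eval (t a) (s a)) \<subseteq> (\<Union>f\<in>?T. f ` ?S)" if "a \<in> topspace A" for a
    by (rule order_trans[OF supp_hom_eval]) (use that in blast)
  show "hom_eval (t a) (s a) \<in> realization_points Y" if "a \<in> topspace A" for a
    by (rule hom_eval_in_realization_points[OF Y continuous_map_realization_points[OF H t that]
          continuous_map_realization_points[OF L s(1) that] s(2)[OF that]])
  show "continuous_map A euclideanreal (\<lambda>a. hom_eval (t a) (s a) w)" for w
  proof (rule continuous_map_eq)
    show "continuous_map A euclideanreal
        (\<lambda>a. \<Sum>p\<in>{p \<in> ?T \<times> ?S. (\<lambda>(f, v). f v) p = w}. t a (fst p) * s a (snd p))"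
      using fin by (intro continuous_map_sum continuous_map_real_mult continuous_map_coordinate[OF H t]
          continuous_map_coordinate[OF L s(1)]) auto
    show "(\<Sum>p\<in>{p \<in> ?T \<times> ?S. (\<lambda>(f, v). f v) p = w}. t a (fst p) * s a (snd p)) = hom_eval (t a) (s a) w"
      if "a \<in> topspace A" for a
    proof -
      have "supp (tensor (t a) (s a)) \<subseteq> ?T \<times> ?S" using that unfolding supp_tensor by blast
      then show ?thesis
        unfolding hom_eval_def using fin
        by (subst realization_map_eq_sum[of "?T \<times> ?S"]) (auto simp: tensor_def intro!: sum.cong)
    qed
  qed
qed

lemma sum_supp_singleton:
  fixes t :: "'a \<Rightarrow> real"
  shows "(\<Sum>u\<in>{u \<in> supp t. u = v}. t u) = t v"
proof -
  have "{u \<in> supp t. u = v} = (if t v = 0 then {} else {v})" by auto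
  then show ?thesis by simp
qed

lemma tensor_realization_map:
  assumes fin: "finite (supp t)" "finite (supp s)"
  shows "tensor (realization_map g t) s = realization_map (\<lambda>p. (g (fst p), snd p)) (tensor t s)"
proof (rule ext, clarify)
  fix w v
  let ?R = "\<lambda>p. (g (fst p), snd p)"
  have fin2: "finite (supp t \<times> supp s)" using fin by simp
  have "realization_map ?R (tensor t s) (w, v) =
      (\<Sum>p\<in>{p \<in> supp t \<times> supp s. ?R p = (w, v)}. tensor t s p)"
    by (rule realization_map_eq_sum[OF fin2]) (simp add: supp_tensor)
  also have "\<dots> = (\<Sum>p\<in>{f \<in> supp t. g f = w} \<times> {u \<in> supp s. u = v}. tensor t s p)"
    by (intro sum.cong refl) auto
  also have "\<dots> = (\<Sum>f\<in>{f \<in> supp t. g f = w}. t f) * (\<Sum>u\<in>{u \<in> supp s. u = v}. s u)"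
    unfolding sum_product sum.cartesian_product tensor_def ..
  finally show "tensor (realization_map g t) s (w, v) = realization_map ?R (tensor t s) (w, v)"
    unfolding sum_supp_singleton by (simp add: tensor_def realization_map_eq_sum[OF fin(1) order_refl])
qed

lemma hom_eval_realization_map:
  assumes fin: "finite (supp t)" "finite (supp s)"
  shows "hom_eval (realization_map g t) s = realization_map (\<lambda>p. g (fst p) (snd p)) (tensor t s)"
  unfolding hom_eval_def tensor_realization_map[OF fin] using fin
  by (subst realization_map_comp) (simp_all add: supp_tensor o_def)

text \<open>A point carried by \<open>\<sigma>\<close> sees the functions only on
  \<open>\<sigma>\<close>. This makes evaluation independent of the component of a compatible family
  that is used.\<close>

lemma hom_eval_restrict:
  assumes "t \<in> realization_points K" "s \<in> realization_points L" "supp s \<subseteq> \<sigma>"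
  shows "hom_eval (realization_map (\<lambda>f. restrict f \<sigma>) t) s = hom_eval t s"
proof -
  have "restrict (fst p) \<sigma> (snd p) = (\<lambda>(f, v). f v) p" if "tensor t s p \<noteq> 0" for p
    using that assms(3) by (auto simp: tensor_def split: prod.splits)
  then show ?thesis
    unfolding hom_eval_realization_map[OF realization_points_supp(2)[OF assms(1)] realization_points_supp(2)[OF assms(2)]]
    unfolding hom_eval_def by (rule realization_map_cong)
qed

definition hom_const :: "'v set \<Rightarrow> ('w \<Rightarrow> real) \<Rightarrow> ('v \<Rightarrow> 'w) \<Rightarrow> real" where
  "hom_const \<sigma> = realization_map (\<lambda>w. \<lambda>v\<in>\<sigma>. w)"

lemma continuous_map_hom_const:
  assumes Y: "scomplex Y"
  shows "continuous_map (realization Y) (realization (hom_complex (Pow \<sigma>) Y)) (hom_const \<sigma>)"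
  unfolding hom_const_def
proof (rule continuous_map_realization_map[OF Y scomplex_hom_complex[OF Y]])
  fix \<tau> assume \<tau>: "\<tau> \<in> Y"
  then have fin: "finite \<tau>" using Y by (auto simp: scomplex_def)
  have U: "(\<Union>f\<in>(\<lambda>w. \<lambda>v\<in>\<sigma>. w) ` \<tau>. f ` \<sigma>) \<in> Y"
    by (rule scomplex_subset[OF Y \<tau>]) auto
  show "(\<lambda>w. \<lambda>v\<in>\<sigma>. w) ` \<tau> \<in> hom_complex (Pow \<sigma>) Y"
    unfolding hom_complex_Pow_iff[OF Y] by (intro conjI U finite_imageI fin) auto
qed

lemma restrict_hom_const:
  fixes y :: "'w \<Rightarrow> real"
  assumes "y \<in> realization_points Y" "\<sigma> \<subseteq> \<tau>"
  shows "realization_map (\<lambda>f. restrict f \<sigma>) (hom_const \<tau> y) = hom_const \<sigma> y"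
proof -
  have "(\<lambda>f. restrict f \<sigma>) \<circ> (\<lambda>w::'w. \<lambda>v\<in>\<tau>. w) = (\<lambda>w. \<lambda>v\<in>\<sigma>. w)"
    using assms(2) by (auto simp: fun_eq_iff restrict_def)
  then show ?thesis
    unfolding hom_const_def realization_map_comp[OF realization_points_supp(2)[OF assms(1)]]
    by (simp only:)
qed

text \<open>The value is the first marginal of the product weights, and this is \<open>y\<close>
  because the coordinates of \<open>s\<close> sum to 1.\<close>

lemma hom_eval_hom_const:
  assumes y: "y \<in> realization_points Y" and s: "s \<in> realization_points L" "supp s \<subseteq> \<sigma>"
  shows "hom_eval (hom_const \<sigma> y) s = y"
proof
  fix w
  have fin: "finite (supp y)" "finite (supp s)"
    using y s by (auto simp: realization_points_supp)
  have "(\<lambda>v\<in>\<sigma>. fst p) (snd p) = fst p" if "tensor y s p \<noteq> 0" for p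
    using that s(2) by (auto simp: tensor_def split: prod.splits)
  then have e: "hom_eval (hom_const \<sigma> y) s = realization_map fst (tensor y s)"
    unfolding hom_const_def hom_eval_realization_map[OF fin] by (rule realization_map_cong)
  have "realization_map fst (tensor y s) w = (\<Sum>p\<in>{p \<in> supp y \<times> supp s. fst p = w}. tensor y s p)"
    using fin by (intro realization_map_eq_sum) (auto simp: supp_tensor)
  also have "{p \<in> supp y \<times> supp s. fst p = w} = {u \<in> supp y. u = w} \<times> supp s" by auto
  also have "(\<Sum>p\<in>{u \<in> supp y. u = w} \<times> supp s. tensor y s p) =
      (\<Sum>u\<in>{u \<in> supp y. u = w}. y u) * (\<Sum>v\<in>supp s. s v)"
    unfolding sum_product sum.cartesian_product tensor_def ..
  finally show "hom_eval (hom_const \<sigma> y) s w = y w"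
    unfolding sum_supp_singleton e by (simp add: realization_points_supp(4)[OF s(1)])
qed

text \<open>The inclusion of the constant maps is a homotopy inverse of an evaluation map, since the
  composite is contiguous to the identity.\<close>

lemma hom_const_hom_eval_contiguous:
  assumes Y: "scomplex Y" and t: "t \<in> realization_points (hom_complex (Pow \<tau>) Y)"
    and s: "supp s \<subseteq> \<tau>" "finite (supp s)" and \<sigma>: "\<sigma> \<subseteq> \<tau>"
  shows "supp (hom_const \<sigma> (hom_eval t s)) \<union> supp (realization_map (\<lambda>f. restrict f \<sigma>) t)
    \<in> hom_complex (Pow \<sigma>) Y"
proof (rule scomplex_subset[OF scomplex_hom_complex[OF Y]])
  let ?C = "(\<lambda>w. \<lambda>v\<in>\<sigma>. w) ` (\<Union>f\<in>supp t. f ` supp s)"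
  let ?R = "(\<lambda>f. restrict f \<sigma>) ` supp t"
  have "supp (hom_const \<sigma> (hom_eval t s)) \<subseteq> ?C"
    unfolding hom_const_def using supp_realization_map supp_hom_eval by fast
  then show "supp (hom_const \<sigma> (hom_eval t s)) \<union> supp (realization_map (\<lambda>f. restrict f \<sigma>) t) \<subseteq> ?C \<union> ?R"
    by (rule Un_mono[OF _ supp_realization_map])
  have U: "(\<Union>f\<in>supp t. f ` \<tau>) \<in> Y"
    by (rule hom_complex_Pow_image[OF Y t])
  have "(\<Union>f\<in>?C \<union> ?R. f ` \<sigma>) \<subseteq> (\<Union>f\<in>supp t. f ` \<tau>)"
    using s(1) \<sigma> by auto
  then have "(\<Union>f\<in>?C \<union> ?R. f ` \<sigma>) \<in> Y" by (rule scomplex_subset[OF Y U])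
  moreover have "finite (?C \<union> ?R)" using realization_points_supp(2)[OF t] s(2) by blast
  moreover have "?C \<union> ?R \<subseteq> extensional \<sigma>" by auto
  ultimately show "?C \<union> ?R \<in> hom_complex (Pow \<sigma>) Y"
    unfolding hom_complex_Pow_iff[OF Y] by (intro conjI)
qed

text \<open>The only extensional function on no vertices is \<open>undefined\<close> everywhere, so
  all the weight lies on it.\<close>

lemma realization_points_hom_complex_Pow_empty:
  assumes Y: "scomplex Y" and t: "t \<in> realization_points (hom_complex (Pow {}) Y)"
  shows "t = (\<lambda>f. if f = (\<lambda>_. undefined) then 1 else 0)"
proof -
  let ?u = "\<lambda>_. undefined"
  have "supp t \<subseteq> extensional {}"
    using realization_points_supp(1)[OF t] unfolding hom_complex_Pow_iff[OF Y] by blast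
  then have sub: "supp t \<subseteq> {?u}" by (auto simp: extensional_def)
  then have "t ?u = 1" using sum_realization_points[OF t, of "{?u}"] by simp
  then show ?thesis using sub by (intro ext) auto
qed

lemma point_in_realization_points_hom_complex_Pow_empty:
  assumes Y: "scomplex Y"
  shows "(\<lambda>f. if f = (\<lambda>_. undefined) then 1 else 0) \<in> realization_points (hom_complex (Pow {}) Y)"
proof (rule realization_pointsI[of _ "{\<lambda>_. undefined}"])
  have "supp (\<lambda>f::'b \<Rightarrow> 'a. if f = (\<lambda>_. undefined) then 1 else 0 :: real) = {\<lambda>_. undefined}" by auto
  then show "supp (\<lambda>f. if f = (\<lambda>_. undefined) then 1 else 0) \<in> hom_complex (Pow {}) Y"
    unfolding hom_complex_Pow_iff[OF Y] using Y by (simp add: scomplex_def)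
qed auto


section \<open>Zigzags from homotopy equivalences\<close>

text \<open>The middle space is a copy of \<open>Y\<close>, whose points are coded as constant functions.\<close>

lemma weakly_equivalent_of_homotopy_equivalence:
  fixes X :: "'a topology" and Y :: "'b topology"
  assumes Y: "k_space Y" "Hausdorff_space Y"
    and f: "continuous_map Y X f" and g: "continuous_map X Y g"
    and gf: "homotopic_with (\<lambda>_. True) Y Y (g \<circ> f) id" and fg: "homotopic_with (\<lambda>_. True) X X (f \<circ> g) id"
  shows "weakly_equivalent X Y"
proof -
  define e :: "'b \<Rightarrow> real \<Rightarrow> 'a + 'b" where "e = (\<lambda>y _. Inr y)"
  define d :: "(real \<Rightarrow> 'a + 'b) \<Rightarrow> 'b" where "d = (\<lambda>h. projr (h 0))"
  define W where "W = pullback_topology (range e) d Y"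
  have de: "d (e y) = y" for y by (simp add: d_def e_def)
  have d: "continuous_map W Y d"
    using continuous_map_pullback[OF continuous_map_id, of "range e" d Y] by (simp add: W_def)
  have e: "continuous_map Y W e"
    unfolding W_def by (rule continuous_map_pullback') (auto simp: o_def de)
  have ed: "e (d w) = w" if "w \<in> topspace W" for w
    using that by (auto simp: W_def topspace_pullback_topology de)
  have "homeomorphic_maps W Y d e" using d e ed de by (auto simp: homeomorphic_maps_def)
  then have "W homeomorphic_space Y" by (auto simp: homeomorphic_space_def)
  then have W: "k_space W" "Hausdorff_space W"
    using Y homeomorphic_k_space homeomorphic_Hausdorff_space by blast+
  have idW: "homotopic_with (\<lambda>_. True) W W id (e \<circ> d)"
    using ed by (intro homotopic_with_equal) auto
  have "weak_equivalence W Y d"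
  proof (rule weak_equivalence_homotopy_equivalence[OF d e idW])
    show "homotopic_with (\<lambda>_. True) Y Y id (d \<circ> e)"
      by (intro homotopic_with_equal) (auto simp: de)
  qed
  moreover have "weak_equivalence W X (f \<circ> d)"
  proof (rule weak_equivalence_homotopy_equivalence)
    show "continuous_map W X (f \<circ> d)" "continuous_map X W (e \<circ> g)"
      using d e f g by (auto intro: continuous_map_compose)
    have "homotopic_with (\<lambda>_. True) W W (e \<circ> ((g \<circ> f) \<circ> d)) (e \<circ> (id \<circ> d))"
      by (intro homotopic_with_compose_continuous_map_left[OF _ e]
          homotopic_with_compose_continuous_map_right[OF gf d]) auto
    then have "homotopic_with (\<lambda>_. True) W W ((e \<circ> g) \<circ> (f \<circ> d)) (e \<circ> d)" by (simp add: o_assoc)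
    then show "homotopic_with (\<lambda>_. True) W W id ((e \<circ> g) \<circ> (f \<circ> d))"
      using idW homotopic_with_trans homotopic_with_symD by blast
    have "(f \<circ> d) \<circ> (e \<circ> g) = f \<circ> g" by (auto simp: de)
    then show "homotopic_with (\<lambda>_. True) X X id ((f \<circ> d) \<circ> (e \<circ> g))"
      using fg homotopic_with_symD by metis
  qed
  ultimately show ?thesis unfolding weakly_equivalent_def using W by blast
qed


section \<open>Join-irreducible complexes\<close>

lemma Pow_in_SCplx_iff: "Pow \<sigma> \<in> SCplx V \<longleftrightarrow> \<sigma> \<subseteq> V"
  by (auto simp: SCplx_def)

text \<open>For a maximal simplex \<open>\<sigma>\<close> the complex \<open>K\<close> is the join
  of \<open>Pow \<sigma>\<close> and the proper subcomplex \<open>K - {\<sigma>}\<close>, so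
  irreducibility forces \<open>K = Pow \<sigma>\<close>. Conversely, if \<open>Pow \<sigma>\<close>
  is a union of two complexes, one of them contains \<open>\<sigma>\<close> and hence
  everything.\<close>

lemma join_irreducibles_SCplx:
  assumes "finite V"
  shows "join_irreducibles (SCplx V) = Pow ` Pow V"
proof (intro equalityI subsetI)
  fix K assume K: "K \<in> join_irreducibles (SCplx V)"
  then have KV: "K \<in> SCplx V" and irr: "\<not> (\<exists>x\<in>SCplx V. \<exists>y\<in>SCplx V. x < K \<and> y < K \<and> K = sup x y)"
    by (auto simp: join_irreducibles_def)
  have sub: "K \<subseteq> Pow V" "{} \<in> K" "\<And>\<sigma> \<tau>. \<sigma> \<in> K \<Longrightarrow> \<tau> \<subseteq> \<sigma> \<Longrightarrow> \<tau> \<in> K"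
    using KV by (auto simp: SCplx_def)
  have "finite K" using sub(1) assms by (meson finite_Pow_iff finite_subset)
  then obtain \<sigma> where \<sigma>: "\<sigma> \<in> K" "\<And>\<tau>. \<tau> \<in> K \<Longrightarrow> \<sigma> \<subseteq> \<tau> \<Longrightarrow> \<sigma> = \<tau>"
    using finite_has_maximal[of K] sub(2) by blast
  have Pow: "Pow \<sigma> \<subseteq> K" using sub(3) \<sigma>(1) by blast
  have "K = Pow \<sigma>"
  \<comment> \<open>Removing the empty simplex would not leave a complex; but if it is maximal,
    \<open>K\<close> consists of it alone.\<close>
  proof (cases "\<sigma> = {}")
    case True
    then show ?thesis using \<sigma> by auto
  next
    case False
    let ?y = "K - {\<sigma>}"
    have "?y \<in> SCplx V"
      unfolding SCplx_def using sub \<sigma>(2) False by blast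
    moreover have "Pow \<sigma> \<in> SCplx V" using sub(1) \<sigma>(1) by (auto simp: Pow_in_SCplx_iff)
    moreover have "?y < K" using \<sigma>(1) by auto
    moreover have "K = sup (Pow \<sigma>) ?y" using Pow by auto
    ultimately show ?thesis using irr Pow by (metis order_le_less)
  qed
  then show "K \<in> Pow ` Pow V" using sub(1) \<sigma>(1) by blast
next
  fix K assume "K \<in> Pow ` Pow V"
  then obtain \<sigma> where \<sigma>: "K = Pow \<sigma>" "\<sigma> \<subseteq> V" by auto
  have "x = K \<or> y = K" if "x \<in> SCplx V" "y \<in> SCplx V" "K = sup x y" for x y
  proof -
    have "\<sigma> \<in> x \<or> \<sigma> \<in> y" using that(3) \<sigma>(1) by auto
    then have "Pow \<sigma> \<subseteq> x \<or> Pow \<sigma> \<subseteq> y" using that(1,2) by (auto simp: SCplx_def)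
    then show ?thesis using that(3) \<sigma>(1) by auto
  qed
  then have "\<not> (\<exists>x\<in>SCplx V. \<exists>y\<in>SCplx V. x < K \<and> y < K \<and> K = sup x y)"
    by (metis less_irrefl)
  then show "K \<in> join_irreducibles (SCplx V)"
    using \<sigma> by (simp add: join_irreducibles_def Pow_in_SCplx_iff)
qed

lemma join_irreducibles_SCplx_below:
  assumes "finite V" "Z \<in> SCplx V"
  shows "{v \<in> join_irreducibles (SCplx V). v \<le> Z} = Pow ` Z"
proof -
  have down: "\<tau> \<in> Z" if "\<sigma> \<in> Z" "\<tau> \<subseteq> \<sigma>" for \<sigma> \<tau>
    using assms(2) that by (auto simp: SCplx_def)
  show ?thesis
    unfolding join_irreducibles_SCplx[OF assms(1)]
  proof (intro equalityI subsetI)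
    fix K assume "K \<in> {v \<in> Pow ` Pow V. v \<le> Z}"
    then obtain \<sigma> where \<sigma>: "K = Pow \<sigma>" "Pow \<sigma> \<subseteq> Z" by auto
    have "\<sigma> \<in> Z" by (rule subsetD[OF \<sigma>(2) Pow_top])
    then show "K \<in> Pow ` Z" unfolding \<sigma>(1) by (rule imageI)
  next
    fix K assume "K \<in> Pow ` Z"
    then obtain \<sigma> where \<sigma>: "K = Pow \<sigma>" "\<sigma> \<in> Z" by (rule imageE)
    have "Pow \<sigma> \<subseteq> Z" using down[OF \<sigma>(2)] by (meson PowD subsetI)
    moreover have "\<sigma> \<in> Pow V" using assms(2) \<sigma>(2) by (auto simp: SCplx_def)
    ultimately show "K \<in> {v \<in> Pow ` Pow V. v \<le> Z}" unfolding \<sigma>(1) by simp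
  qed
qed

section \<open>Affine combinations and finite chains\<close>

lemma realization_map_linear:
  fixes s t :: "'a \<Rightarrow> real"
  assumes "finite (supp s)" "finite (supp t)"
  shows "realization_map g (\<lambda>v. (1 - l) * s v + l * t v) =
    (\<lambda>w. (1 - l) * realization_map g s w + l * realization_map g t w)"
proof
  fix w
  let ?S = "supp s \<union> supp t"
  have fin: "finite ?S" using assms by simp
  have "supp (\<lambda>v. (1 - l) * s v + l * t v) \<subseteq> ?S" by auto
  then show "realization_map g (\<lambda>v. (1 - l) * s v + l * t v) w =
      (1 - l) * realization_map g s w + l * realization_map g t w"
    using realization_map_eq_sum[OF fin, of s g w] realization_map_eq_sum[OF fin, of t g w]
    by (simp add: realization_map_eq_sum[OF fin] sum.distrib sum_distrib_left)
qed

lemma finite_chain_has_maximum: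
  assumes "finite C" "C \<noteq> {}" "\<And>a b. a \<in> C \<Longrightarrow> b \<in> C \<Longrightarrow> a \<subseteq> b \<or> b \<subseteq> a"
  obtains m where "m \<in> C" "\<And>a. a \<in> C \<Longrightarrow> a \<subseteq> m"
  using finite_has_maximal[OF assms(1,2)] assms(3) by metis

lemma finite_chain_Inter:
  assumes "finite C" "C \<noteq> {}" "\<And>a b. a \<in> C \<Longrightarrow> b \<in> C \<Longrightarrow> a \<subseteq> b \<or> b \<subseteq> a"
  shows "\<Inter>C \<in> C"
proof -
  obtain m where m: "m \<in> C" "\<And>a. a \<in> C \<Longrightarrow> a \<subseteq> m \<Longrightarrow> m = a"
    using finite_has_minimal[OF assms(1,2)] by metis
  then have "\<And>a. a \<in> C \<Longrightarrow> m \<subseteq> a" using assms(3) by blast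
  then have "\<Inter>C = m" using m(1) by blast
  then show ?thesis using m(1) by simp
qed

lemma supp_nonempty: "t \<in> realization_points K \<Longrightarrow> supp t \<noteq> {}"
  using realization_points_supp(4) by force

lemma realization_points_order_complex:
  assumes "p \<in> realization_points (order_complex A)"
  shows "supp p \<subseteq> A" "finite (supp p)" "\<And>a b. a \<in> supp p \<Longrightarrow> b \<in> supp p \<Longrightarrow> a \<le> b \<or> b \<le> a"
  using realization_points_supp(1,2)[OF assms] by (auto simp: order_complex_def)


lemma supp_subset_iff: "supp t \<subseteq> B \<Longrightarrow> supp t \<subseteq> C \<longleftrightarrow> (\<forall>v\<in>B-C. t v = 0)"
  by auto

lemma Collect_restrict_conj:
  "(\<And>a. a \<in> A \<Longrightarrow> G a \<longleftrightarrow> P a \<and> Q a) \<Longrightarrow> {a \<in> A. G a} = {a \<in> A. P a} \<inter> {a \<in> A. Q a}"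
  by auto

lemma continuous_map_in_topspace: "continuous_map A B f \<Longrightarrow> a \<in> topspace A \<Longrightarrow> f a \<in> topspace B"
  by (simp add: continuous_map_def Pi_iff)


section \<open>The comparison of the homotopy limit with the mapping space\<close>

locale finite_complex_maps =
  fixes Z :: "'v set set" and Y :: "'w set set"
  assumes scZ: "scomplex Z" and finZ: "finite Z" and scY: "scomplex Y"
begin

abbreviation V :: "'v set" where "V \<equiv> \<Union>Z"

definition J :: "'v set set set" where "J = Pow ` Z"

text \<open>These simplices have barycentres; the empty one is treated apart, by
  \<open>extend\<close>.\<close>

definition Jp :: "'v set set set" where "Jp = Pow ` (Z - {{}})"

abbreviation N :: "'v set set \<Rightarrow> ('v set set \<Rightarrow> real) topology" where
  "N i \<equiv> up_nerve J i"

lemma fin\<sigma>: "\<sigma> \<in> Z \<Longrightarrow> finite \<sigma>" using scZ by (auto simp: scomplex_def)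

lemma finV: "finite V" using finZ fin\<sigma> by blast

lemma finJ: "finite J" "finite Jp" using finZ by (auto simp: J_def Jp_def)

lemma Jp_subset: "Jp \<subseteq> J" by (auto simp: J_def Jp_def)

lemma JpE:
  assumes "j \<in> Jp"
  obtains \<sigma> where "\<sigma> \<in> Z" "\<sigma> \<noteq> {}" "j = Pow \<sigma>" "\<Union>j = \<sigma>"
  using assms unfolding Jp_def by force

lemma J_cases: "j \<in> J \<Longrightarrow> j = Pow {} \<or> j \<in> Jp" by (auto simp: J_def Jp_def)

lemma Jp_not_bot: "j \<in> Jp \<Longrightarrow> j \<noteq> Pow {}" by (auto simp: Jp_def)

lemma Jp_up: "i \<in> Jp \<Longrightarrow> j \<in> J \<Longrightarrow> i \<le> j \<Longrightarrow> j \<in> Jp" by (auto simp: J_def Jp_def)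

lemma Pow_Union_J: "j \<in> J \<Longrightarrow> Pow (\<Union>j) = j" by (auto simp: J_def)

lemma supp_subset_V: "s \<in> realization_points Z \<Longrightarrow> supp s \<subseteq> V"
  using realization_points_supp(1) by blast

lemma topspace_Z: "topspace (realization Z) = realization_points Z"
  by (rule topspace_realization[OF scZ])

lemma topspace_N: "topspace (N i) = realization_points (order_complex {j \<in> J. i \<le> j})"
  unfolding up_nerve_def by (rule topspace_realization[OF scomplex_order_complex])

lemma finite_order_complex: "finite A \<Longrightarrow> finite (order_complex A)"
  by (rule finite_subset[of _ "Pow A"]) (auto simp: order_complex_def)

lemma compact_Hausdorff_N: "compact_space (N i)" "Hausdorff_space (N i)"
  unfolding up_nerve_def
  by (intro compact_space_realization Hausdorff_space_realization scomplex_order_complex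
      finite_order_complex; use finJ in simp)+

lemma compact_Hausdorff_Z: "compact_space (realization Z)" "Hausdorff_space (realization Z)"
  by (intro compact_space_realization Hausdorff_space_realization scZ finZ)+


subsection \<open>Subdividing the complex\<close>

text \<open>A point \<open>s\<close> has some coordinate above \<open>\<theta>\<close>.  The map \<open>shrink\<close> cuts off the coordinates at \<open>\<theta>\<close>,
  while \<open>subdivide s\<close> is supported on the superlevel sets of \<open>s\<close> for levels at most \<open>\<theta>\<close>, all of which
  contain the support of \<open>shrink s\<close>.\<close>

definition \<theta> :: real where "\<theta> = 1 / (2 * real (card V))"

text \<open>Each product enforces one of the three conditions in \<open>weight_nonzero_iff\<close>:
  \<open>\<sigma>\<close> lies in the support of \<open>s\<close>, coordinates off
  \<open>\<sigma>\<close> are below \<open>\<theta>\<close>, and \<open>\<sigma>\<close> is a strict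
  superlevel set. After normalisation the weights are a partition of unity on the
  realization.\<close>

definition weight :: "'v set \<Rightarrow> ('v \<Rightarrow> real) \<Rightarrow> real" where
  "weight \<sigma> s = (\<Prod>v\<in>\<sigma>. s v) * (\<Prod>u\<in>V-\<sigma>. max 0 (\<theta> - s u)) * (\<Prod>v\<in>\<sigma>. \<Prod>u\<in>V-\<sigma>. max 0 (s v - s u))"

definition subdivide :: "('v \<Rightarrow> real) \<Rightarrow> 'v set set \<Rightarrow> real" where
  "subdivide s = (\<lambda>j. if j \<in> Jp then weight (\<Union>j) s / (\<Sum>\<sigma>\<in>Z. weight \<sigma> s) else 0)"

definition shrink :: "('v \<Rightarrow> real) \<Rightarrow> 'v \<Rightarrow> real" where
  "shrink s = (\<lambda>v. max 0 (s v - \<theta>) / (\<Sum>u\<in>V. max 0 (s u - \<theta>)))"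

text \<open>The usual map from the barycentric subdivision: it is affine and sends the vertex
  \<open>Pow \<sigma>\<close> to the barycentre of \<open>\<sigma>\<close>.\<close>

definition bary :: "('v set set \<Rightarrow> real) \<Rightarrow> 'v \<Rightarrow> real" where
  "bary p = (\<lambda>v. \<Sum>\<sigma>\<in>Z-{{}}. p (Pow \<sigma>) * (if v \<in> \<sigma> then 1 / real (card \<sigma>) else 0))"

lemma \<theta>_nonneg: "0 \<le> \<theta>" by (simp add: \<theta>_def)

text \<open>The coordinates over \<open>V\<close> have average \<open>1 / card V\<close>, and
  \<open>\<theta>\<close> is half of this. For empty \<open>V\<close> division by zero gives
  \<open>\<theta> = 0\<close>, and the realization has no points.\<close>

lemma exists_big_coordinate:
  assumes s: "s \<in> realization_points Z"
  shows "\<exists>v\<in>V. \<theta> < s v"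
proof (rule ccontr)
  assume "\<not> (\<exists>v\<in>V. \<theta> < s v)"
  then have "(\<Sum>v\<in>V. s v) \<le> (\<Sum>v\<in>V. \<theta>)" by (intro sum_mono) (meson not_less)
  moreover have "(\<Sum>v\<in>V. s v) = 1" by (rule sum_realization_points[OF s finV supp_subset_V[OF s]])
  moreover have "(\<Sum>v\<in>V. \<theta>) \<le> 1 / 2" by (simp add: \<theta>_def)
  ultimately show False by simp
qed

lemma weight_nonneg: "s \<in> realization_points Z \<Longrightarrow> 0 \<le> weight \<sigma> s"
  unfolding weight_def by (intro mult_nonneg_nonneg prod_nonneg) (auto simp: realization_points_def)

lemma weight_nonzero_iff:
  assumes s: "s \<in> realization_points Z" and \<sigma>: "\<sigma> \<subseteq> V"
  shows "weight \<sigma> s \<noteq> 0 \<longleftrightarrow>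
    \<sigma> \<subseteq> supp s \<and> (\<forall>u\<in>V-\<sigma>. s u < \<theta>) \<and> (\<forall>v\<in>\<sigma>. \<forall>u\<in>V-\<sigma>. s u < s v)"
proof -
  have max0: "max 0 x = 0 \<longleftrightarrow> \<not> 0 < x" for x :: real by auto
  have fin: "finite \<sigma>" "finite (V - \<sigma>)" using finV \<sigma> finite_subset by blast+
  show ?thesis
    unfolding weight_def mult_eq_0_iff de_Morgan_disj prod_zero_iff[OF fin(1)] prod_zero_iff[OF fin(2)] max0
    by auto
qed

text \<open>A coordinate above \<open>\<theta>\<close> kills the weight of the empty face. Hence no
  mass is lost by indexing \<open>subdivide\<close> with nonempty simplices.\<close>

lemma weight_empty: 
  assumes s: "s \<in> realization_points Z"
  shows "weight {} s = 0"
proof -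
  obtain v where v: "v \<in> V" "\<theta> < s v" using exists_big_coordinate[OF s] by blast
  show ?thesis
  proof (rule ccontr)
    assume "weight {} s \<noteq> 0"
    then have "\<forall>u\<in>V - {}. s u < \<theta>" using weight_nonzero_iff[OF s empty_subsetI] by blast
    then have "s v < \<theta>" using v(1) by blast
    then show False using v(2) by simp
  qed
qed

lemma sum_weight_pos:
  assumes s: "s \<in> realization_points Z"
  shows "0 < (\<Sum>\<sigma>\<in>Z. weight \<sigma> s)"
proof -
  \<comment> \<open>The superlevel set of level \<open>\<theta>\<close>: coordinates on it are at
    least \<open>\<theta>\<close> and those off it strictly smaller, since \<open>\<theta>\<close>
    is positive as soon as there is a vertex. So this face always has positive weight.\<close>
  let ?\<sigma> = "{v \<in> V. s v \<noteq> 0 \<and> \<theta> \<le> s v}"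
  have "?\<sigma> \<in> Z" by (rule scomplex_subset[OF scZ realization_points_supp(1)[OF s]]) auto
  have pos: "0 < s v" if "s v \<noteq> 0" for v using realization_points_supp(3)[OF s, of v] that by simp
  have "0 < \<theta>" if "V \<noteq> {}" using that finV by (simp add: \<theta>_def card_gt_0_iff)
  then have less: "s u < \<theta>" if "u \<in> V - ?\<sigma>" for u using that by force
  have "weight ?\<sigma> s \<noteq> 0"
    unfolding weight_nonzero_iff[OF s Collect_restrict]
    using less by fastforce
  then have "0 < weight ?\<sigma> s" using weight_nonneg[OF s, of ?\<sigma>] by simp
  then show ?thesis
    by (intro sum_pos2[OF finZ \<open>?\<sigma> \<in> Z\<close>]) (auto intro: weight_nonneg s)
qed

lemma supp_subdivide_iff:
  assumes s: "s \<in> realization_points Z"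
  shows "j \<in> supp (subdivide s) \<longleftrightarrow> j \<in> Jp \<and> weight (\<Union>j) s \<noteq> 0"
  using sum_weight_pos[OF s] by (auto simp: subdivide_def)

lemma Union_Jp_subset: "j \<in> Jp \<Longrightarrow> \<Union>j \<subseteq> V" by (auto simp: Jp_def)

text \<open>Strict superlevel sets of one function are nested: incomparable ones would give both
  \<open>s u < s v\<close> and \<open>s v < s u\<close>.\<close>

lemma supp_subdivide_chain:
  assumes s: "s \<in> realization_points Z" and ij: "i \<in> supp (subdivide s)" "j \<in> supp (subdivide s)"
  shows "i \<subseteq> j \<or> j \<subseteq> i"
proof -
  have i: "i \<in> Jp" "weight (\<Union>i) s \<noteq> 0" and j: "j \<in> Jp" "weight (\<Union>j) s \<noteq> 0"
    using ij supp_subdivide_iff[OF s] by auto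
  have less: "\<forall>v\<in>\<Union>i. \<forall>u\<in>V - \<Union>i. s u < s v" "\<forall>v\<in>\<Union>j. \<forall>u\<in>V - \<Union>j. s u < s v"
    using i j weight_nonzero_iff[OF s] Union_Jp_subset by meson+
  have "\<Union>i \<subseteq> \<Union>j \<or> \<Union>j \<subseteq> \<Union>i"
  proof (rule ccontr)
    assume "\<not> (\<Union>i \<subseteq> \<Union>j \<or> \<Union>j \<subseteq> \<Union>i)"
    then obtain u v where "u \<in> \<Union>i" "u \<notin> \<Union>j" "v \<in> \<Union>j" "v \<notin> \<Union>i" by blast
    then have "s u < s v" "s v < s u"
      using less Union_Jp_subset[OF i(1)] Union_Jp_subset[OF j(1)] by (meson DiffI subsetD)+
    then show False by simp
  qed
  moreover have "Pow (\<Union>i) = i" "Pow (\<Union>j) = j"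
    using i(1) j(1) Pow_Union_J Jp_subset by blast+
  ultimately show ?thesis by (metis Pow_mono)
qed

lemma subdivide_in_realization_points:
  assumes s: "s \<in> realization_points Z"
  shows "subdivide s \<in> realization_points (order_complex Jp)"
proof (rule realization_pointsI)
  show "0 \<le> subdivide s j" for j
    using sum_weight_pos[OF s] weight_nonneg[OF s] by (simp add: subdivide_def)
  show "finite Jp" by (rule finJ)
  show sub: "supp (subdivide s) \<subseteq> Jp" by (auto simp: subdivide_def)
  have "(\<Sum>j\<in>Jp. subdivide s j) = (\<Sum>j\<in>Jp. weight (\<Union>j) s) / (\<Sum>\<sigma>\<in>Z. weight \<sigma> s)"
    by (simp add: subdivide_def sum_divide_distrib)
  also have "(\<Sum>j\<in>Jp. weight (\<Union>j) s) = (\<Sum>\<sigma>\<in>Z-{{}}. weight \<sigma> s)"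
    unfolding Jp_def by (subst sum.reindex) (auto simp: inj_on_def)
  also have "\<dots> = (\<Sum>\<sigma>\<in>Z. weight \<sigma> s)"
    by (rule sum.mono_neutral_left) (use finZ weight_empty[OF s] in auto)
  finally show "(\<Sum>j\<in>Jp. subdivide s j) = 1" using sum_weight_pos[OF s] by simp
  show "supp (subdivide s) \<in> order_complex Jp"
    using sub finite_subset[OF sub finJ(2)] supp_subdivide_chain[OF s]
    unfolding order_complex_def by blast
qed

lemma continuous_map_coordinate_Z: "continuous_map (realization Z) euclideanreal (\<lambda>s. s v)"
  by (rule continuous_map_realization_coordinate[OF scZ])

lemma continuous_map_subdivide:
  "continuous_map (realization Z) (realization (order_complex Jp)) subdivide"
proof (rule continuous_map_into_realization[OF scomplex_order_complex finJ(2)])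
  fix j assume j: "j \<in> Jp"
  have fin: "finite \<sigma>" "finite (V - \<sigma>)" if "\<sigma> \<subseteq> V" for \<sigma> using finV that finite_subset by blast+
  have weight: "continuous_map (realization Z) euclideanreal (weight \<sigma>)" if "\<sigma> \<subseteq> V" for \<sigma>
    unfolding weight_def using fin[OF that]
    by (intro continuous_map_real_mult continuous_map_prod continuous_map_real_max continuous_map_diff
        continuous_map_coordinate_Z) auto
  have "continuous_map (realization Z) euclideanreal (\<lambda>s. weight (\<Union>j) s / (\<Sum>\<sigma>\<in>Z. weight \<sigma> s))"
    using sum_weight_pos Union_Jp_subset[OF j] finZ
    by (intro continuous_map_real_divide continuous_map_sum weight) (force simp: topspace_Z)+
  then show "continuous_map (realization Z) euclideanreal (\<lambda>s. subdivide s j)"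
    using j by (simp add: subdivide_def)
next
  show "supp (subdivide s) \<subseteq> Jp" for s by (auto simp: subdivide_def split: if_splits)
qed (simp add: topspace_Z subdivide_in_realization_points)

lemma supp_shrink_subset:
  assumes s: "s \<in> realization_points Z"
  shows "supp (shrink s) \<subseteq> {v. \<theta> < s v}"
  by (auto simp: shrink_def)

lemma sum_shrink_pos:
  assumes s: "s \<in> realization_points Z"
  shows "0 < (\<Sum>u\<in>V. max 0 (s u - \<theta>))"
proof -
  obtain v where "v \<in> V" "\<theta> < s v" using exists_big_coordinate[OF s] by blast
  then show ?thesis by (intro sum_pos2[OF finV, of v]) auto
qed

lemma shrink_in_realization_points:
  assumes s: "s \<in> realization_points Z"
  shows "shrink s \<in> realization_points Z"
proof (rule realization_pointsI[OF _ finV])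
  show "0 \<le> shrink s v" for v using sum_shrink_pos[OF s] by (simp add: shrink_def)
  have sub: "supp (shrink s) \<subseteq> supp s" using supp_shrink_subset[OF s] \<theta>_nonneg by force
  then show "supp (shrink s) \<subseteq> V" using supp_subset_V[OF s] by blast
  show "supp (shrink s) \<in> Z" by (rule scomplex_subset[OF scZ realization_points_supp(1)[OF s] sub])
  show "(\<Sum>v\<in>V. shrink s v) = 1"
    using sum_shrink_pos[OF s] by (simp add: shrink_def flip: sum_divide_distrib)
qed

lemma continuous_map_shrink: "continuous_map (realization Z) (realization Z) shrink"
proof (rule continuous_map_into_realization[OF scZ finV])
  show "continuous_map (realization Z) euclideanreal (\<lambda>s. shrink s v)" for v
    unfolding shrink_def using sum_shrink_pos finV
    by (intro continuous_map_real_divide continuous_map_sum continuous_map_real_max continuous_map_diff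
        continuous_map_coordinate_Z) (force simp: topspace_Z)+
  show "supp (shrink s) \<subseteq> V" if "s \<in> topspace (realization Z)" for s
    using that by (intro supp_subset_V shrink_in_realization_points) (simp add: topspace_Z)
qed (simp add: topspace_Z shrink_in_realization_points)

text \<open>If \<open>j\<close> carries weight, a vertex off \<open>\<Union>j\<close> has coordinate
  below \<open>\<theta>\<close>, so \<open>shrink\<close> removes it. This permits evaluation at
  \<open>shrink s\<close> on every simplex of the chain.\<close>

lemma supp_shrink_subdivide:
  assumes s: "s \<in> realization_points Z" and j: "j \<in> supp (subdivide s)"
  shows "supp (shrink s) \<subseteq> \<Union>j"
proof
  fix v assume v: "v \<in> supp (shrink s)"
  then have "\<theta> < s v" using supp_shrink_subset[OF s] by blast
  moreover have "v \<in> V" using v supp_subset_V[OF shrink_in_realization_points[OF s]] by blast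
  moreover have "j \<in> Jp" "weight (\<Union>j) s \<noteq> 0" using j supp_subdivide_iff[OF s] by auto
  ultimately show "v \<in> \<Union>j"
    using weight_nonzero_iff[OF s Union_Jp_subset] by (metis DiffI less_asym)
qed

lemma supp_bary:
  assumes "v \<in> supp (bary p)"
  obtains \<sigma> where "\<sigma> \<in> Z" "\<sigma> \<noteq> {}" "p (Pow \<sigma>) \<noteq> 0" "v \<in> \<sigma>"
proof -
  have "(\<Sum>\<sigma>\<in>Z-{{}}. p (Pow \<sigma>) * (if v \<in> \<sigma> then 1 / real (card \<sigma>) else 0)) \<noteq> 0"
    using assms by (simp add: bary_def)
  then obtain \<sigma> where "\<sigma> \<in> Z - {{}}" "p (Pow \<sigma>) * (if v \<in> \<sigma> then 1 / real (card \<sigma>) else 0) \<noteq> 0"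
    by (rule sum.not_neutral_contains_not_neutral)
  then show thesis using that[of \<sigma>] by (simp split: if_splits)
qed

text \<open>The support lies in the largest simplex of the chain, and each barycentre has total
  weight 1.\<close>

lemma bary_in_realization_points:
  assumes p: "p \<in> realization_points (order_complex Jp)"
  shows "bary p \<in> realization_points Z"
proof (rule realization_pointsI[OF _ finV])
  note pp = realization_points_order_complex[OF p]
  show "0 \<le> bary p v" for v
    unfolding bary_def using realization_points_supp(3)[OF p] by (intro sum_nonneg) simp
  show "supp (bary p) \<subseteq> V" using supp_bary by blast
  obtain m where m: "m \<in> supp p" "\<And>a. a \<in> supp p \<Longrightarrow> a \<subseteq> m"
    using finite_chain_has_maximum[OF pp(2) supp_nonempty[OF p] pp(3)] by blast
  obtain \<mu> where \<mu>: "\<mu> \<in> Z" "m = Pow \<mu>" using m(1) pp(1) by (auto simp: Jp_def)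
  have "supp (bary p) \<subseteq> \<mu>"
  proof
    fix v assume "v \<in> supp (bary p)"
    then obtain \<sigma> where "p (Pow \<sigma>) \<noteq> 0" "v \<in> \<sigma>" by (rule supp_bary)
    then show "v \<in> \<mu>" using m(2)[of "Pow \<sigma>"] \<mu>(2) by auto
  qed
  then show "supp (bary p) \<in> Z" by (rule scomplex_subset[OF scZ \<mu>(1)])
  have one: "(\<Sum>v\<in>V. if v \<in> \<sigma> then 1 / real (card \<sigma>) else 0) = 1" if "\<sigma> \<in> Z - {{}}" for \<sigma>
  proof -
    have "V \<inter> {v. v \<in> \<sigma>} = \<sigma>" using that by auto
    then show ?thesis
      using that fin\<sigma>[of \<sigma>] finV by (simp add: sum.If_cases)
  qed
  have "(\<Sum>v\<in>V. bary p v) =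
      (\<Sum>\<sigma>\<in>Z-{{}}. p (Pow \<sigma>) * (\<Sum>v\<in>V. if v \<in> \<sigma> then 1 / real (card \<sigma>) else 0))"
    unfolding bary_def sum_distrib_left by (rule sum.swap)
  also have "\<dots> = (\<Sum>\<sigma>\<in>Z-{{}}. p (Pow \<sigma>))" using one by simp
  also have "\<dots> = (\<Sum>j\<in>Jp. p j)" unfolding Jp_def by (subst sum.reindex) (auto simp: inj_on_def)
  also have "\<dots> = 1" by (rule sum_realization_points[OF p finJ(2) pp(1)])
  finally show "(\<Sum>v\<in>V. bary p v) = 1" .
qed

lemma continuous_map_bary: "continuous_map (realization (order_complex Jp)) (realization Z) bary"
proof (rule continuous_map_into_realization[OF scZ finV])
  note top = topspace_realization[OF scomplex_order_complex, of Jp]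
  show "bary p \<in> realization_points Z" if "p \<in> topspace (realization (order_complex Jp))" for p
    using that by (simp add: top bary_in_realization_points)
  then show "supp (bary p) \<subseteq> V" if "p \<in> topspace (realization (order_complex Jp))" for p
    using that supp_subset_V by blast
  show "continuous_map (realization (order_complex Jp)) euclideanreal (\<lambda>p. bary p v)" for v
    unfolding bary_def using finZ
    by (intro continuous_map_sum continuous_map_real_mult
        continuous_map_realization_coordinate[OF scomplex_order_complex]) auto
qed

lemma supp_bary_subdivide:
  assumes s: "s \<in> realization_points Z"
  shows "supp (bary (subdivide s)) \<subseteq> supp s"
proof
  fix v assume "v \<in> supp (bary (subdivide s))"
  then obtain \<sigma> where \<sigma>: "\<sigma> \<in> Z" "subdivide s (Pow \<sigma>) \<noteq> 0" "v \<in> \<sigma>" by (rule supp_bary)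
  then have "weight \<sigma> s \<noteq> 0" using supp_subdivide_iff[OF s, of "Pow \<sigma>"] by simp
  moreover have "\<sigma> \<subseteq> V" using \<sigma>(1) by blast
  ultimately have "\<sigma> \<subseteq> supp s" using weight_nonzero_iff[OF s] by metis
  then show "v \<in> supp s" using \<sigma>(3) by blast
qed

text \<open>The superlevel sets of the barycentric coordinates of a point on a chain are members of the
  chain.\<close>

lemma supp_subdivide_bary:
  assumes p: "p \<in> realization_points (order_complex Jp)"
  shows "supp (subdivide (bary p)) \<subseteq> supp p"
proof
  note pp = realization_points_order_complex[OF p]
  note b = bary_in_realization_points[OF p]
  fix j assume j: "j \<in> supp (subdivide (bary p))"
  then have "j \<in> Jp" "weight (\<Union>j) (bary p) \<noteq> 0" using supp_subdivide_iff[OF b] by auto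
  then obtain \<rho> where \<rho>: "\<rho> \<in> Z" "\<rho> \<noteq> {}" "j = Pow \<rho>" "weight \<rho> (bary p) \<noteq> 0" by (metis JpE)
  have \<rho>V: "\<rho> \<subseteq> V" using \<rho>(1) by blast
  have \<rho>': "\<rho> \<subseteq> supp (bary p)" "\<And>v u. v \<in> \<rho> \<Longrightarrow> u \<in> V - \<rho> \<Longrightarrow> bary p u < bary p v"
    using \<rho>(4) weight_nonzero_iff[OF b \<rho>V] by auto
  let ?C = "{\<tau>. p (Pow \<tau>) \<noteq> 0}"
  have CZ: "\<tau> \<in> Z" if "\<tau> \<in> ?C" for \<tau>
  proof -
    have "Pow \<tau> \<in> Jp" using pp(1) that by blast
    then show ?thesis by (rule JpE) (metis Union_Pow_eq)
  qed
  have chain: "\<sigma> \<subseteq> \<tau> \<or> \<tau> \<subseteq> \<sigma>" if "\<sigma> \<in> ?C" "\<tau> \<in> ?C" for \<sigma> \<tau>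
    using pp(3)[of "Pow \<sigma>" "Pow \<tau>"] that by auto
  have fin: "finite D" if "D \<subseteq> ?C" for D
  proof -
    have "D \<subseteq> Z" using that CZ by blast
    then show ?thesis using finZ by (rule finite_subset)
  qed
  \<comment> \<open>Take the least member \<open>m\<close> of the chain that contains
    \<open>v\<close>. A vertex of \<open>m\<close> lies in every member containing \<open>v\<close>,
    so its coordinate is at least that of \<open>v\<close>; coordinates off \<open>\<rho>\<close>
    are strictly smaller, whence \<open>m \<subseteq> \<rho>\<close>.\<close>
  have least: "\<exists>\<tau>\<in>?C. v \<in> \<tau> \<and> \<tau> \<subseteq> \<rho>" if v: "v \<in> \<rho>" for v
  proof -
    let ?D = "{\<tau> \<in> ?C. v \<in> \<tau>}"
    have "v \<in> supp (bary p)" using \<rho>'(1) v by blast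
    then obtain \<sigma> where "p (Pow \<sigma>) \<noteq> 0" "v \<in> \<sigma>" by (rule supp_bary)
    then have "?D \<noteq> {}" by blast
    define m where "m = \<Inter>?D"
    have "m \<in> ?D" unfolding m_def using \<open>?D \<noteq> {}\<close> chain by (intro finite_chain_Inter fin) auto
    then have m: "m \<in> ?C" "v \<in> m" by simp_all
    have least_m: "u \<in> \<tau>" if "u \<in> m" "p (Pow \<tau>) \<noteq> 0" "v \<in> \<tau>" for u \<tau>
      using that unfolding m_def by blast
    have "m \<subseteq> \<rho>"
    proof
      fix u assume u: "u \<in> m"
      have "bary p v \<le> bary p u"
        unfolding bary_def
      proof (rule sum_mono)
        fix \<tau> assume "\<tau> \<in> Z - {{}}"
        show "p (Pow \<tau>) * (if v \<in> \<tau> then 1 / real (card \<tau>) else 0) \<le>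
            p (Pow \<tau>) * (if u \<in> \<tau> then 1 / real (card \<tau>) else 0)"
        proof (cases "p (Pow \<tau>) = 0")
          case False
          then have "v \<in> \<tau> \<Longrightarrow> u \<in> \<tau>" using least_m[OF u] by blast
          then show ?thesis
            using realization_points_supp(3)[OF p, of "Pow \<tau>"] by (intro mult_left_mono) auto
        qed simp
      qed
      moreover have "u \<in> V" using u CZ[OF m(1)] by (rule UnionI[rotated])
      ultimately have "\<not> bary p u < bary p v" "u \<in> V" by (simp_all only: not_less)
      then show "u \<in> \<rho>" using \<rho>'(2)[OF v DiffI, of u] by blast
    qed
    then show ?thesis using m by blast
  qed
  \<comment> \<open>Thus \<open>\<rho>\<close> is a union of members of a finite chain and equals
    the largest of them.\<close>
  let ?E = "{\<tau> \<in> ?C. \<tau> \<subseteq> \<rho>}"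
  have E: "?E \<noteq> {}" using least \<rho>(2) by blast
  have finE: "finite ?E" by (rule fin) blast
  have chainE: "\<sigma> \<subseteq> \<tau> \<or> \<tau> \<subseteq> \<sigma>" if "\<sigma> \<in> ?E" "\<tau> \<in> ?E" for \<sigma> \<tau> using chain that by simp
  obtain m where m: "m \<in> ?E" "\<And>\<tau>. \<tau> \<in> ?E \<Longrightarrow> \<tau> \<subseteq> m"
    by (rule finite_chain_has_maximum[OF finE E]) (erule (1) chainE, rule that)
  have "m = \<rho>" using m least by blast
  then show "j \<in> supp p" using m(1) \<rho>(3) by blast
qed

subsection \<open>The homotopy limit\<close>

abbreviation H :: "('v set set \<Rightarrow> ('v set set \<Rightarrow> real) \<Rightarrow> ('v \<Rightarrow> 'w) \<Rightarrow> real) topology" where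
  "H \<equiv> holim_op J (hom_functor Y) hom_functor_map"

abbreviation M :: "(('v \<Rightarrow> real) \<Rightarrow> 'w \<Rightarrow> real) topology" where
  "M \<equiv> mapping_space (realization Z) (realization Y)"

text \<open>The internal hom out of the empty simplex is a point, so families of maps need only be given on
  the nonempty simplices.\<close>

definition extend :: "('v set set \<Rightarrow> ('v set set \<Rightarrow> real) \<Rightarrow> ('v \<Rightarrow> 'w) \<Rightarrow> real) \<Rightarrow>
    'v set set \<Rightarrow> ('v set set \<Rightarrow> real) \<Rightarrow> ('v \<Rightarrow> 'w) \<Rightarrow> real" where
  "extend \<xi> = (\<lambda>i\<in>J. \<lambda>p\<in>topspace (N i).
     if i = Pow {} then (\<lambda>f. if f = (\<lambda>_. undefined) then 1 else 0) else \<xi> i p)"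

lemma extend_Jp: "i \<in> Jp \<Longrightarrow> p \<in> topspace (N i) \<Longrightarrow> extend \<xi> i p = \<xi> i p"
  using Jp_subset Jp_not_bot by (auto simp: extend_def)

lemma sc_hom: "scomplex (hom_complex i Y)" by (rule scomplex_hom_complex[OF scY])

lemma topspace_hom_functor: "topspace (hom_functor Y i) = realization_points (hom_complex i Y)"
  unfolding hom_functor_def by (rule topspace_realization[OF sc_hom])

lemma hom_functor_map_J:
  assumes "i \<in> J"
  shows "hom_functor_map i j = realization_map (\<lambda>f. restrict f (\<Union>i))"
proof -
  have "verts i = \<Union>i" using assms by (auto simp: J_def verts_def)
  then show ?thesis by (simp add: hom_functor_map_def)
qed

lemma hom_functor_map_into:
  assumes "i \<in> J" "i \<le> j" "t \<in> topspace (hom_functor Y j)"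
  shows "hom_functor_map i j t \<in> topspace (hom_functor Y i)"
proof -
  have "i \<in> SCplx V" using assms(1) by (auto simp: J_def Pow_in_SCplx_iff)
  then show ?thesis
    using continuous_map_hom_functor_map[OF scY assms(2)] assms(3) by (auto simp: continuous_map_def)
qed

text \<open>At the empty simplex the component is constant, and compatibility with it is automatic
  since its target is a point. So conditions on nonempty simplices suffice.\<close>

lemma continuous_map_into_H:
  assumes A: "k_space A"
    and cont: "\<And>i C. i \<in> Jp \<Longrightarrow> compactin A C \<Longrightarrow>
      continuous_map (prod_topology (subtopology A C) (N i)) (hom_functor Y i) (\<lambda>q. \<xi> (fst q) i (snd q))"
    and compat: "\<And>a i j p. a \<in> topspace A \<Longrightarrow> i \<in> Jp \<Longrightarrow> j \<in> Jp \<Longrightarrow> i \<le> j \<Longrightarrow>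
      p \<in> topspace (N j) \<Longrightarrow> \<xi> a i p = hom_functor_map i j (\<xi> a j p)"
  shows "continuous_map A H (\<lambda>a. extend (\<xi> a))"
proof (rule continuous_map_into_holim_op[OF A])
  let ?\<delta> = "\<lambda>f. if f = (\<lambda>_. undefined) then 1 else 0"
  have \<delta>: "?\<delta> \<in> topspace (hom_functor Y (Pow {}))"
    unfolding topspace_hom_functor by (rule point_in_realization_points_hom_complex_Pow_empty[OF scY])
  have bot: "extend (\<xi> a) (Pow {}) p = ?\<delta>" if "Pow {} \<in> J" "p \<in> topspace (N (Pow {}))" for a p
    using that by (simp add: extend_def)
  show "continuous_map (prod_topology (subtopology A C) (N i)) (hom_functor Y i)
      (\<lambda>q. extend (\<xi> (fst q)) i (snd q))" if i: "i \<in> J" and C: "compactin A C" for i C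
  proof (cases "i = Pow {}")
    case True
    have "continuous_map (prod_topology (subtopology A C) (N i)) (hom_functor Y i) (\<lambda>_. ?\<delta>)"
      unfolding True continuous_map_const using \<delta> by (rule disjI2)
    then show ?thesis
      by (rule continuous_map_eq) (use bot i in \<open>auto simp: True\<close>)
  next
    case False
    then have ip: "i \<in> Jp" using i J_cases by blast
    show ?thesis
      by (rule continuous_map_eq[OF cont[OF ip C]]) (auto simp: extend_Jp[OF ip])
  qed
  show "extend (\<xi> a) \<in> extensional J" for a by (simp add: extend_def)
  show "extend (\<xi> a) i \<in> extensional (topspace (N i))" if "i \<in> J" for a i
    using that by (simp add: extend_def)
  fix a i j p assume a: "a \<in> topspace A" and i: "i \<in> J" and j: "j \<in> J" and ij: "i \<le> j"
    and p: "p \<in> topspace (N j)"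
  have pi: "p \<in> topspace (N i)"
  proof -
    have "order_complex {k \<in> J. j \<le> k} \<subseteq> order_complex {k \<in> J. i \<le> k}"
      using ij by (auto simp: order_complex_def)
    then have "realization_points (order_complex {k \<in> J. j \<le> k}) \<subseteq>
        realization_points (order_complex {k \<in> J. i \<le> k})" by (rule realization_points_mono)
    then show ?thesis using p unfolding topspace_N by (rule subsetD)
  qed
  show "extend (\<xi> a) i p = hom_functor_map i j (extend (\<xi> a) j p)"
  proof (cases "i = Pow {}")
    case True
    have "extend (\<xi> a) j p \<in> topspace (hom_functor Y j)"
    proof (cases "j = Pow {}")
      case True
      then show ?thesis using bot \<delta> j p by simp
    next
      case False
      then have jp: "j \<in> Jp" using j J_cases by blast
      \<comment> \<open>Continuity over the compact set \<open>{a}\<close> is what shows that the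
        value lies in the space of the functor.\<close>
      have "continuous_map (prod_topology (subtopology A {a}) (N j)) (hom_functor Y j)
          (\<lambda>q. \<xi> (fst q) j (snd q))" by (rule cont[OF jp]) (simp add: a)
      then have "\<xi> (fst (a, p)) j (snd (a, p)) \<in> topspace (hom_functor Y j)"
        by (rule continuous_map_in_topspace) (use a p in simp)
      then show ?thesis using extend_Jp[OF jp p] by simp
    qed
    then have "hom_functor_map i j (extend (\<xi> a) j p) \<in> realization_points (hom_complex (Pow {}) Y)"
      using hom_functor_map_into[OF i ij] by (simp add: topspace_hom_functor True)
    then have "hom_functor_map i j (extend (\<xi> a) j p) = ?\<delta>"
      by (rule realization_points_hom_complex_Pow_empty[OF scY])
    then show ?thesis using bot[of p a] i pi True by simp
  next
    case False
    then have "i \<in> Jp" "j \<in> Jp" using i j ij J_cases Jp_up by blast+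
    then show ?thesis using compat[OF a _ _ ij p] by (simp add: extend_Jp p pi)
  qed
qed

lemma H_PiE: "\<phi> \<in> topspace H \<Longrightarrow> \<phi> \<in> (\<Pi>\<^sub>E i\<in>J. mapping_points (N i) (hom_functor Y i))"
  unfolding topspace_holim_op mem_Collect_eq by (rule conjunct1)

lemma H_component: "\<phi> \<in> topspace H \<Longrightarrow> i \<in> J \<Longrightarrow> \<phi> i \<in> mapping_points (N i) (hom_functor Y i)"
  by (rule PiE_mem[OF H_PiE])

lemma H_point:
  assumes "\<phi> \<in> topspace H" "i \<in> J" "p \<in> topspace (N i)"
  shows "\<phi> i p \<in> realization_points (hom_complex i Y)"
  using H_component[OF assms(1,2)] assms(3)
  by (auto simp: mapping_points_def continuous_map_def topspace_hom_functor)

lemma H_compat: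
  assumes "\<phi> \<in> topspace H" "i \<in> J" "j \<in> J" "i \<le> j" "p \<in> topspace (N j)"
  shows "\<phi> i p = realization_map (\<lambda>f. restrict f (\<Union>i)) (\<phi> j p)"
proof -
  have "\<forall>i\<in>J. \<forall>j\<in>J. i \<le> j \<longrightarrow> (\<forall>p\<in>topspace (N j). \<phi> i p = hom_functor_map i j (\<phi> j p))"
    using assms(1) unfolding topspace_holim_op mem_Collect_eq by (rule conjunct2)
  from this[rule_format, OF assms(2-5)] show ?thesis
    by (simp only: hom_functor_map_J[OF assms(2)])
qed

text \<open>A point of the limit is extensional in both arguments and has only one possible value at
  the empty simplex.\<close>

lemma extend_H:
  assumes \<phi>: "\<phi> \<in> topspace H"
  shows "extend \<phi> = \<phi>"
proof
  fix i
  show "extend \<phi> i = \<phi> i"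
  proof (cases "i \<in> J")
    case False
    then show ?thesis using PiE_arb[OF H_PiE[OF \<phi>]] by (simp add: extend_def)
  next
    case True
    show ?thesis
    proof
      fix p
      show "extend \<phi> i p = \<phi> i p"
      proof (cases "p \<in> topspace (N i)")
        case False
        then show ?thesis
          using H_component[OF \<phi> True] True by (simp add: extend_def mapping_points_def extensional_def)
      next
        case p: True
        show ?thesis
          using H_point[OF \<phi> True p] realization_points_hom_complex_Pow_empty[OF scY, of "\<phi> i p"] True p
          by (auto simp: extend_def)
      qed
    qed
  qed
qed


subsection \<open>The maps in both directions\<close>

lemma N_subset_Jp:
  assumes "i \<in> Jp"
  shows "topspace (N i) \<subseteq> realization_points (order_complex Jp)"
proof -
  have "order_complex {j \<in> J. i \<le> j} \<subseteq> order_complex Jp"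
    using Jp_up[OF assms] by (auto simp: order_complex_def)
  then show ?thesis unfolding topspace_N by (rule realization_points_mono)
qed

lemma in_topspace_N_iff:
  assumes "p \<in> realization_points (order_complex Jp)"
  shows "p \<in> topspace (N i) \<longleftrightarrow> (\<forall>j\<in>supp p. i \<le> j)"
proof -
  have "supp p \<in> order_complex Jp" by (rule realization_points_supp(1)[OF assms])
  then have "supp p \<in> order_complex {j \<in> J. i \<le> j} \<longleftrightarrow> (\<forall>j\<in>supp p. i \<le> j)"
    using Jp_subset by (auto simp: order_complex_def)
  moreover have "p \<in> realization_points K \<longleftrightarrow> supp p \<in> K" for K
    using assms by (simp add: realization_points_def)
  ultimately show ?thesis by (simp add: topspace_N)
qed

lemma continuous_map_into_N:
  assumes "\<And>a. a \<in> topspace A \<Longrightarrow> f a \<in> topspace (N i)"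
    and "\<And>j. j \<in> J \<Longrightarrow> continuous_map A euclideanreal (\<lambda>a. f a j)"
  shows "continuous_map A (N i) f"
  unfolding up_nerve_def
proof (rule continuous_map_into_realization[OF scomplex_order_complex finJ(1)])
  show "f a \<in> realization_points (order_complex {j \<in> J. i \<le> j})" if "a \<in> topspace A" for a
    using assms(1)[OF that] by (simp add: topspace_N)
  then show "supp (f a) \<subseteq> J" if "a \<in> topspace A" for a
    using realization_points_order_complex(1) that by blast
qed (rule assms(2))

lemma continuous_map_N_inclusion:
  assumes i: "i \<in> Jp"
  shows "continuous_map (N i) (realization (order_complex Jp)) (\<lambda>p. p)"
proof (rule continuous_map_into_realization[OF scomplex_order_complex finJ(2)])
  show "p \<in> realization_points (order_complex Jp)" if "p \<in> topspace (N i)" for p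
    using that N_subset_Jp[OF i] by blast
  then show "supp p \<subseteq> Jp" if "p \<in> topspace (N i)" for p
    using realization_points_order_complex(1) that by blast
  show "continuous_map (N i) euclideanreal (\<lambda>p. p j)" for j
    unfolding up_nerve_def by (rule continuous_map_realization_coordinate[OF scomplex_order_complex])
qed

lemma continuous_map_bary_N:
  assumes "i \<in> Jp"
  shows "continuous_map (N i) (realization Z) bary"
  using continuous_map_compose[OF continuous_map_N_inclusion[OF assms] continuous_map_bary]
  by (simp add: o_def)

lemma bary_N: "i \<in> Jp \<Longrightarrow> p \<in> topspace (N i) \<Longrightarrow> bary p \<in> realization_points Z"
  using bary_in_realization_points N_subset_Jp by blast

lemma supp_subdivide_bary_N:
  "i \<in> Jp \<Longrightarrow> p \<in> topspace (N i) \<Longrightarrow> supp (subdivide (bary p)) \<subseteq> supp p"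
  using supp_subdivide_bary N_subset_Jp by blast

lemma supp_N: "p \<in> topspace (N i) \<Longrightarrow> j \<in> supp p \<Longrightarrow> i \<le> j"
  using realization_points_order_complex(1)[of p "{j \<in> J. i \<le> j}"] by (auto simp: topspace_N)

text \<open>Passing to \<open>subdivide (bary p)\<close> adds no simplex to the chain, and lying in
  \<open>N i\<close> is a condition on the chain alone.\<close>

lemma subdivide_bary_N:
  assumes "i \<in> Jp" "p \<in> topspace (N i)"
  shows "subdivide (bary p) \<in> topspace (N i)"
  using in_topspace_N_iff[OF subdivide_in_realization_points[OF bary_N[OF assms]]]
    supp_subdivide_bary_N[OF assms] supp_N[OF assms(2)] by blast

lemma continuous_map_subdivide_bary_N:
  assumes i: "i \<in> Jp"
  shows "continuous_map (N i) (N i) (\<lambda>p. subdivide (bary p))"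
proof (rule continuous_map_into_N[OF subdivide_bary_N[OF i]])
  show "continuous_map (N i) euclideanreal (\<lambda>p. subdivide (bary p) j)" for j
    using continuous_map_coordinate[OF scomplex_order_complex
        continuous_map_compose[OF continuous_map_bary_N[OF i] continuous_map_subdivide]]
    by (simp add: o_def)
qed

text \<open>The support is a finite chain of complexes, so this is its least member: the largest
  index whose component can be evaluated at \<open>subdivide s\<close>.\<close>

definition bottom :: "('v \<Rightarrow> real) \<Rightarrow> 'v set set" where
  "bottom s = \<Inter>(supp (subdivide s))"

text \<open>Exactly what is needed to evaluate component \<open>j\<close> at \<open>s\<close>.
  Unlike equality with \<open>bottom s\<close> in general, this is a closed condition on
  \<open>s\<close>.\<close>

definition good :: "'v set set \<Rightarrow> ('v \<Rightarrow> real) \<Rightarrow> bool" where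
  "good j s \<longleftrightarrow> j \<in> Jp \<and> subdivide s \<in> topspace (N j) \<and> supp (shrink s) \<subseteq> \<Union>j"

lemma bottom_in_supp:
  assumes s: "s \<in> realization_points Z"
  shows "bottom s \<in> supp (subdivide s)"
  unfolding bottom_def
  by (rule finite_chain_Inter[OF realization_points_supp(2)[OF subdivide_in_realization_points[OF s]]
        supp_nonempty[OF subdivide_in_realization_points[OF s]] supp_subdivide_chain[OF s]])

lemma le_bottom: "(\<And>j. j \<in> supp (subdivide s) \<Longrightarrow> i \<le> j) \<Longrightarrow> i \<le> bottom s"
  unfolding bottom_def by (rule Inter_greatest)

lemma good_bottom:
  assumes s: "s \<in> realization_points Z"
  shows "good (bottom s) s"
  unfolding good_def
proof (intro conjI)
  note b = bottom_in_supp[OF s]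
  show "bottom s \<in> Jp" using b supp_subdivide_iff[OF s] by blast
  show "subdivide s \<in> topspace (N (bottom s))"
    unfolding in_topspace_N_iff[OF subdivide_in_realization_points[OF s]]
    by (auto simp: bottom_def)
  show "supp (shrink s) \<subseteq> \<Union>(bottom s)" by (rule supp_shrink_subdivide[OF s b])
qed

definition to_maps :: "('v set set \<Rightarrow> ('v set set \<Rightarrow> real) \<Rightarrow> ('v \<Rightarrow> 'w) \<Rightarrow> real) \<Rightarrow> ('v \<Rightarrow> real) \<Rightarrow> 'w \<Rightarrow> real" where
  "to_maps \<phi> = (\<lambda>s\<in>realization_points Z. hom_eval (\<phi> (bottom s) (subdivide s)) (shrink s))"

definition from_maps :: "(('v \<Rightarrow> real) \<Rightarrow> 'w \<Rightarrow> real) \<Rightarrow> 'v set set \<Rightarrow> ('v set set \<Rightarrow> real) \<Rightarrow> ('v \<Rightarrow> 'w) \<Rightarrow> real" where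
  "from_maps g = extend (\<lambda>i p. hom_const (\<Union>i) (g (bary p)))"

text \<open>A good \<open>j\<close> lies below \<open>bottom s\<close>, so its component is the
  restriction of the one at \<open>bottom s\<close>, and evaluation at \<open>shrink s\<close> does
  not notice the restriction. The jumps of \<open>bottom s\<close> thereby become harmless for
  continuity.\<close>

lemma to_maps_good:
  assumes \<phi>: "\<phi> \<in> topspace H" and s: "s \<in> realization_points Z" and j: "good j s"
  shows "to_maps \<phi> s = hom_eval (\<phi> j (subdivide s)) (shrink s)"
proof -
  have b: "bottom s \<in> J" "subdivide s \<in> topspace (N (bottom s))"
    using good_bottom[OF s] Jp_subset by (auto simp: good_def)
  have jJ: "j \<in> J" "subdivide s \<in> topspace (N j)" "supp (shrink s) \<subseteq> \<Union>j"
    using j Jp_subset by (auto simp: good_def)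
  have "j \<le> bottom s" by (rule le_bottom) (rule supp_N[OF jJ(2)])
  then have e: "\<phi> j (subdivide s) = realization_map (\<lambda>f. restrict f (\<Union>j)) (\<phi> (bottom s) (subdivide s))"
    by (rule H_compat[OF \<phi> jJ(1) b(1) _ b(2)])
  show ?thesis
    unfolding e to_maps_def using s
    by (simp add: hom_eval_restrict[OF H_point[OF \<phi> b] shrink_in_realization_points[OF s] jJ(3)])
qed

lemma compact_space_prod:
  assumes "compactin A C" "compact_space B"
  shows "compact_space (prod_topology (subtopology A C) B)"
  using assms by (simp add: compact_space_prod_topology compact_space_subtopology)

lemma continuous_map_fst_subtopology:
  "continuous_map (prod_topology (subtopology A C) B) A fst"
  by (rule continuous_map_into_fulltopology[OF continuous_map_fst])

lemma continuous_map_H_eval: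
  assumes "i \<in> J" "continuous_map A H f" "continuous_map A (N i) x"
  shows "continuous_map A (realization (hom_complex i Y)) (\<lambda>a. f a i (x a))"
  using continuous_map_holim_op_eval[OF assms(1) compact_Hausdorff_N assms(2,3)]
  by (simp add: hom_functor_def)

lemma continuous_map_M_eval:
  assumes "continuous_map A M f" "continuous_map A (realization Z) x"
  shows "continuous_map A (realization Y) (\<lambda>a. f a (x a))"
  by (rule continuous_map_mapping_space_eval[OF compact_Hausdorff_Z assms])

text \<open>Both requirements say that finitely many continuous coordinates vanish.\<close>

lemma closedin_good:
  assumes j: "j \<in> Jp" and s: "continuous_map A (realization Z) s"
  shows "closedin A {a \<in> topspace A. good j (s a)}"
proof -
  have sa: "s a \<in> realization_points Z" if "a \<in> topspace A" for a
    by (rule continuous_map_realization_points[OF scZ s that])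
  have c1: "continuous_map A euclideanreal (\<lambda>a. subdivide (s a) k)" for k
    using continuous_map_coordinate[OF scomplex_order_complex
        continuous_map_compose[OF s continuous_map_subdivide]] by (simp add: o_def)
  have c2: "continuous_map A euclideanreal (\<lambda>a. shrink (s a) v)" for v
    using continuous_map_coordinate[OF scZ continuous_map_compose[OF s continuous_map_shrink]]
    by (simp add: o_def)
  let ?K = "{k \<in> Jp. \<not> j \<le> k}"
  have "closedin A ({a \<in> topspace A. \<forall>k\<in>?K. subdivide (s a) k = 0} \<inter>
      {a \<in> topspace A. \<forall>v\<in>V-\<Union>j. shrink (s a) v = 0})"
    using finJ finV by (intro closedin_Int closedin_common_zeros c1 c2) auto
  moreover have "good j (s a) \<longleftrightarrow>
      (\<forall>k\<in>?K. subdivide (s a) k = 0) \<and> (\<forall>v\<in>V-\<Union>j. shrink (s a) v = 0)" if a: "a \<in> topspace A" for a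
  proof -
    note P = subdivide_in_realization_points[OF sa[OF a]]
    have N: "subdivide (s a) \<in> topspace (N j) \<longleftrightarrow> (\<forall>k\<in>?K. subdivide (s a) k = 0)"
      unfolding in_topspace_N_iff[OF P] using realization_points_order_complex(1)[OF P] by blast
    have S: "supp (shrink (s a)) \<subseteq> \<Union>j \<longleftrightarrow> (\<forall>v\<in>V-\<Union>j. shrink (s a) v = 0)"
      by (rule supp_subset_iff[OF supp_subset_V[OF shrink_in_realization_points[OF sa[OF a]]]])
    show ?thesis unfolding good_def N S using j by (simp only: simp_thms)
  qed
  then have "{a \<in> topspace A. good j (s a)} =
      {a \<in> topspace A. \<forall>k\<in>?K. subdivide (s a) k = 0} \<inter>
      {a \<in> topspace A. \<forall>v\<in>V-\<Union>j. shrink (s a) v = 0}" by (rule Collect_restrict_conj)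
  ultimately show ?thesis by (simp only:)
qed

text \<open>For fixed \<open>j\<close> the formula is continuous on the closed set where
  \<open>j\<close> is good. Finitely many such sets cover \<open>A\<close>, because
  \<open>bottom\<close> is always good, and there the formulas all compute
  \<open>to_maps\<close>.\<close>

lemma continuous_map_to_maps_eval:
  assumes A: "compact_space A" and f: "continuous_map A H f" and s: "continuous_map A (realization Z) s"
  shows "continuous_map A (realization Y) (\<lambda>a. to_maps (f a) (s a))"
proof -
  let ?T = "\<lambda>j. {a \<in> topspace A. good j (s a)}"
  let ?g = "\<lambda>j a. hom_eval (f a j (subdivide (s a))) (shrink (s a))"
  have fa: "f a \<in> topspace H" if "a \<in> topspace A" for a
    using f that by (rule continuous_map_in_topspace)
  have sa: "s a \<in> realization_points Z" if "a \<in> topspace A" for a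
    by (rule continuous_map_realization_points[OF scZ s that])
  have eq: "to_maps (f a) (s a) = ?g j a" if "a \<in> ?T j" for a j
    using that fa sa by (intro to_maps_good) auto
  show ?thesis
  proof (rule pasting_lemma_closed[where I = Jp and T = ?T and f = ?g])
    show "closedin A (?T j)" if "j \<in> Jp" for j by (rule closedin_good[OF that s])
    show "continuous_map (subtopology A (?T j)) (realization Y) (?g j)" if j: "j \<in> Jp" for j
    proof -
      obtain \<sigma> where \<sigma>: "j = Pow \<sigma>" "\<Union>j = \<sigma>" using j by (rule JpE)
      let ?A = "subtopology A (?T j)"
      have cA: "compact_space ?A"
        by (rule compact_space_subtopology[OF closedin_compact_space[OF A closedin_good[OF j s]]])
      have sA: "continuous_map ?A (realization Z) s" by (rule continuous_map_from_subtopology[OF s])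
      have "continuous_map ?A (N j) (\<lambda>a. subdivide (s a))"
      proof (rule continuous_map_into_N)
        show "subdivide (s a) \<in> topspace (N j)" if "a \<in> topspace ?A" for a
          using that by (simp add: good_def)
        show "continuous_map ?A euclideanreal (\<lambda>a. subdivide (s a) k)" for k
          using continuous_map_coordinate[OF scomplex_order_complex
              continuous_map_compose[OF sA continuous_map_subdivide]] by (simp add: o_def)
      qed
      then have "continuous_map ?A (realization (hom_complex j Y)) (\<lambda>a. f a j (subdivide (s a)))"
        using j Jp_subset by (intro continuous_map_H_eval continuous_map_from_subtopology[OF f]) auto
      moreover have "continuous_map ?A (realization Z) (\<lambda>a. shrink (s a))"
        using continuous_map_compose[OF sA continuous_map_shrink] by (simp add: o_def)
      moreover have "supp (shrink (s a)) \<subseteq> \<sigma>" if "a \<in> topspace ?A" for a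
        using that by (simp add: good_def \<sigma>(2))
      ultimately show ?thesis
        by (intro continuous_map_hom_eval[OF scY scZ cA, where \<sigma> = \<sigma>]) (simp_all only: \<sigma>(1))
    qed
    show "?g i a = ?g j a" if "a \<in> topspace A \<inter> ?T i \<inter> ?T j" for i j a
      using that eq[of a i] eq[of a j] by simp
    show "\<exists>j. j \<in> Jp \<and> a \<in> ?T j \<and> to_maps (f a) (s a) = ?g j a" if a: "a \<in> topspace A" for a
    proof (intro exI conjI)
      show T: "a \<in> ?T (bottom (s a))" using good_bottom[OF sa[OF a]] a by simp
      then show "bottom (s a) \<in> Jp" by (simp add: good_def)
      show "to_maps (f a) (s a) = ?g (bottom (s a)) a" by (rule eq[OF T])
    qed
  qed (rule finJ)
qed

lemma continuous_map_to_maps: "continuous_map H M to_maps"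
proof (rule continuous_map_into_mapping_space)
  show "k_space H" by (simp add: holim_op_def)
  show "to_maps \<phi> \<in> extensional (topspace (realization Z))" for \<phi>
    by (simp add: to_maps_def topspace_Z)
  show "continuous_map (prod_topology (subtopology H C) (realization Z)) (realization Y)
      (\<lambda>q. to_maps (fst q) (snd q))" if "compactin H C" for C
    by (intro continuous_map_to_maps_eval compact_space_prod[OF that compact_Hausdorff_Z(1)]
        continuous_map_fst_subtopology continuous_map_snd)
qed

lemma M_point: "g \<in> topspace M \<Longrightarrow> s \<in> realization_points Z \<Longrightarrow> g s \<in> realization_points Y"
  by (auto simp: mapping_points_def continuous_map_def topspace_Z topspace_realization[OF scY])

lemma to_maps_into: "\<phi> \<in> topspace H \<Longrightarrow> to_maps \<phi> \<in> topspace M"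
  by (rule continuous_map_in_topspace[OF continuous_map_to_maps])

lemma hom_const_continuous:
  assumes "i \<in> J" "continuous_map A (realization Y) y"
  shows "continuous_map A (realization (hom_complex i Y)) (\<lambda>a. hom_const (\<Union>i) (y a))"
  using continuous_map_compose[OF assms(2) continuous_map_hom_const[OF scY, of "\<Union>i"]]
  by (simp add: o_def Pow_Union_J[OF assms(1)])

lemma continuous_map_from_maps: "continuous_map M H from_maps"
  unfolding from_maps_def
proof (rule continuous_map_into_H)
  show "k_space M" by (simp add: mapping_space_def)
  fix i C assume i: "i \<in> Jp"
  show "continuous_map (prod_topology (subtopology M C) (N i)) (hom_functor Y i)
      (\<lambda>q. hom_const (\<Union>i) ((fst q) (bary (snd q))))"
    unfolding hom_functor_def[of Y i]
    using i Jp_subset by (intro hom_const_continuous continuous_map_M_eval continuous_map_fst_subtopology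
        continuous_map_compose[OF continuous_map_snd continuous_map_bary_N[OF i], unfolded o_def]) auto
next
  fix g i j p assume g: "g \<in> topspace M" and ij: "i \<in> Jp" "j \<in> Jp" "i \<le> j" and p: "p \<in> topspace (N j)"
  have "hom_functor_map i j (hom_const (\<Union>j) (g (bary p))) = hom_const (\<Union>i) (g (bary p))"
    using ij Jp_subset by (subst hom_functor_map_J, blast)
      (rule restrict_hom_const[OF M_point[OF g bary_N[OF ij(2) p]]], blast)
  then show "hom_const (\<Union>i) (g (bary p)) = hom_functor_map i j (hom_const (\<Union>j) (g (bary p)))" ..
qed


subsection \<open>The homotopies\<close>

text \<open>The interval is compact Hausdorff, so the product stays a k-space and homotopies may be
  tested on compact subsets.\<close>

lemma k_space_I01_prod: "k_space A \<Longrightarrow> k_space (prod_topology I01 A)"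
  by (rule k_space_prod_topology_left)
    (simp_all add: compact_imp_locally_compact_space compact_space_subtopology Hausdorff_space_subtopology)

lemma continuous_map_fst_fst:
  "continuous_map (prod_topology (subtopology (prod_topology I01 A) C) B) euclideanreal (\<lambda>q. fst (fst q))"
  using continuous_map_compose[OF continuous_map_fst_subtopology continuous_map_fst_I01] by (simp add: o_def)

lemma continuous_map_snd_fst:
  "continuous_map (prod_topology (subtopology (prod_topology I01 A) C) B) A (\<lambda>q. snd (fst q))"
  using continuous_map_compose[OF continuous_map_fst_subtopology continuous_map_snd] by (simp add: o_def)

text \<open>First half of the homotopy on the limit; it ends at the family evaluated at
  \<open>subdivide (bary p)\<close> instead of \<open>p\<close>. Compatibility persists along the
  segments because restriction acts affinely on coordinates.\<close>

lemma homotopic_from_to_maps_subdivide: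
  "homotopic_with (\<lambda>_. True) H H (from_maps \<circ> to_maps) (\<lambda>\<phi>. extend (\<lambda>i p. \<phi> i (subdivide (bary p))))"
proof -
  let ?\<xi> = "\<lambda>a i p f. (1 - fst a) * hom_const (\<Union>i) (to_maps (snd a) (bary p)) f +
    fst a * snd a i (subdivide (bary p)) f"
  let ?A = "prod_topology I01 H"
  have "continuous_map ?A H (\<lambda>a. extend (?\<xi> a))"
  proof (rule continuous_map_into_H)
    show "k_space ?A" by (intro k_space_I01_prod) (simp add: holim_op_def)
    fix i C assume i: "i \<in> Jp" and C: "compactin ?A C"
    let ?B = "prod_topology (subtopology ?A C) (N i)"
    have iJ: "i \<in> J" using i Jp_subset by blast
    have cB: "compact_space ?B" by (rule compact_space_prod[OF C compact_Hausdorff_N(1)])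
    show "continuous_map ?B (hom_functor Y i) (\<lambda>q. ?\<xi> (fst q) i (snd q))"
      unfolding hom_functor_def[of Y i]
    proof (rule continuous_map_realization_linear[OF sc_hom cB])
      show "continuous_map ?B (realization (hom_complex i Y))
          (\<lambda>q. hom_const (\<Union>i) (to_maps (snd (fst q)) (bary (snd q))))"
        by (intro hom_const_continuous[OF iJ] continuous_map_to_maps_eval[OF cB] continuous_map_snd_fst
            continuous_map_compose[OF continuous_map_snd continuous_map_bary_N[OF i], unfolded o_def])
      show "continuous_map ?B (realization (hom_complex i Y)) (\<lambda>q. snd (fst q) i (subdivide (bary (snd q))))"
        by (intro continuous_map_H_eval[OF iJ] continuous_map_snd_fst
            continuous_map_compose[OF continuous_map_snd continuous_map_subdivide_bary_N[OF i], unfolded o_def])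
      show "continuous_map ?B euclideanreal (\<lambda>q. fst (fst q))" by (rule continuous_map_fst_fst)
      show "0 \<le> fst (fst q) \<and> fst (fst q) \<le> 1" if "q \<in> topspace ?B" for q
        using that by auto
      fix q assume "q \<in> topspace ?B"
      then obtain l \<phi> p where q: "q = ((l, \<phi>), p)" and \<phi>: "\<phi> \<in> topspace H" and p: "p \<in> topspace (N i)"
        by auto
      let ?s = "bary p"
      let ?b = "bottom ?s"
      have s: "?s \<in> realization_points Z" by (rule bary_N[OF i p])
      have b: "?b \<in> J" "subdivide ?s \<in> topspace (N ?b)" "supp (shrink ?s) \<subseteq> \<Union>?b"
        using good_bottom[OF s] Jp_subset by (auto simp: good_def)
      \<comment> \<open>The chain of \<open>subdivide (bary p)\<close> is part of that of
        \<open>p\<close>, which lies above \<open>i\<close>. So component \<open>i\<close> is a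
        restriction of the component at \<open>?b\<close>, where the evaluation takes place, and the
        two ends are contiguous.\<close>
      have ib: "i \<le> ?b"
        by (rule le_bottom, rule supp_N[OF p]) (use supp_subdivide_bary_N[OF i p] in blast)
      have pt: "\<phi> ?b (subdivide ?s) \<in> realization_points (hom_complex (Pow (\<Union>?b)) Y)"
        using H_point[OF \<phi> b(1,2)] by (simp add: Pow_Union_J[OF b(1)])
      have "supp (hom_const (\<Union>i) (hom_eval (\<phi> ?b (subdivide ?s)) (shrink ?s))) \<union>
          supp (realization_map (\<lambda>f. restrict f (\<Union>i)) (\<phi> ?b (subdivide ?s))) \<in> hom_complex (Pow (\<Union>i)) Y"
        by (rule hom_const_hom_eval_contiguous[OF scY pt b(3)
              realization_points_supp(2)[OF shrink_in_realization_points[OF s]] Union_mono[OF ib]])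
      then show "supp (hom_const (\<Union>i) (to_maps (snd (fst q)) (bary (snd q)))) \<union>
          supp (snd (fst q) i (subdivide (bary (snd q)))) \<in> hom_complex i Y"
        unfolding q fst_conv snd_conv H_compat[OF \<phi> iJ b(1) ib b(2)] Pow_Union_J[OF iJ]
          to_maps_good[OF \<phi> s good_bottom[OF s]] .
    qed
  next
    fix a i j p assume a: "a \<in> topspace ?A" and ij: "i \<in> Jp" "j \<in> Jp" "i \<le> j" and p: "p \<in> topspace (N j)"
    have J: "i \<in> J" "j \<in> J" using ij Jp_subset by auto
    have \<phi>: "snd a \<in> topspace H" using a by auto
    have y: "to_maps (snd a) (bary p) \<in> realization_points Y"
      by (rule M_point[OF to_maps_into[OF \<phi>] bary_N[OF ij(2) p]])
    note sub = subdivide_bary_N[OF ij(2) p]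
    have cst: "hom_const (\<Union>j) (to_maps (snd a) (bary p)) \<in> realization_points (hom_complex (Pow (\<Union>j)) Y)"
      using continuous_map_hom_const[OF scY, of "\<Union>j"] y
      by (auto simp: continuous_map_def topspace_realization[OF scY] topspace_realization[OF sc_hom])
    show "?\<xi> a i p = hom_functor_map i j (?\<xi> a j p)"
      unfolding hom_functor_map_J[OF J(1)]
        realization_map_linear[OF realization_points_supp(2)[OF cst] realization_points_supp(2)[OF H_point[OF \<phi> J(2) sub]]]
        restrict_hom_const[OF y Union_mono[OF ij(3)]] H_compat[OF \<phi> J ij(3) sub] ..
  qed
  then show ?thesis
    by (subst homotopic_with; (intro exI[of _ "\<lambda>a. extend (?\<xi> a)"])?)
      (auto simp: from_maps_def)
qed

text \<open>Here the point of the nerve moves: its segment stays on the chain of \<open>p\<close>,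
  hence in each \<open>N i\<close> containing \<open>p\<close>, so compatibility of the family
  passes to the homotopy.\<close>

lemma homotopic_subdivide_id:
  "homotopic_with (\<lambda>_. True) H H (\<lambda>\<phi>. extend (\<lambda>i p. \<phi> i (subdivide (bary p)))) id"
proof -
  let ?q = "\<lambda>l p j. (1 - l) * subdivide (bary p) j + l * p j"
  let ?\<xi> = "\<lambda>a i p. snd a i (?q (fst a) p)"
  let ?A = "prod_topology I01 H"
  have q: "?q l p \<in> topspace (N i)" if "i \<in> Jp" "p \<in> topspace (N i)" "0 \<le> l" "l \<le> 1" for i p l
    unfolding topspace_N
  proof (rule realization_points_linear[OF scomplex_order_complex])
    show p: "p \<in> realization_points (order_complex {j \<in> J. i \<le> j})"
      "subdivide (bary p) \<in> realization_points (order_complex {j \<in> J. i \<le> j})"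
      using that(2) subdivide_bary_N[OF that(1,2)] by (simp_all add: topspace_N)
    have "supp (subdivide (bary p)) \<union> supp p = supp p"
      using supp_subdivide_bary_N[OF that(1,2)] by blast
    then show "supp (subdivide (bary p)) \<union> supp p \<in> order_complex {j \<in> J. i \<le> j}"
      using realization_points_supp(1)[OF p(1)] by simp
  qed (use that in auto)
  have "continuous_map ?A H (\<lambda>a. extend (?\<xi> a))"
  proof (rule continuous_map_into_H)
    show "k_space ?A" by (intro k_space_I01_prod) (simp add: holim_op_def)
    fix i C assume i: "i \<in> Jp" and C: "compactin ?A C"
    let ?B = "prod_topology (subtopology ?A C) (N i)"
    have iJ: "i \<in> J" using i Jp_subset by blast
    have N: "continuous_map (N i) euclideanreal (\<lambda>p. p j)" for j
      unfolding up_nerve_def by (rule continuous_map_realization_coordinate[OF scomplex_order_complex])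
    show "continuous_map ?B (hom_functor Y i) (\<lambda>q. ?\<xi> (fst q) i (snd q))"
      unfolding hom_functor_def[of Y i]
    proof (intro continuous_map_H_eval[OF iJ] continuous_map_snd_fst continuous_map_into_N)
      show "?q (fst (fst b)) (snd b) \<in> topspace (N i)" if "b \<in> topspace ?B" for b
        using that by (intro q i) auto
      show "continuous_map ?B euclideanreal (\<lambda>b. ?q (fst (fst b)) (snd b) j)" for j
        by (intro continuous_map_add continuous_map_real_mult continuous_map_diff continuous_map_fst_fst
            continuous_map_compose[OF continuous_map_snd N, unfolded o_def]
            continuous_map_compose[OF continuous_map_compose[OF continuous_map_snd continuous_map_subdivide_bary_N[OF i]] N, unfolded o_def])
          simp
    qed
  next
    fix a i j p assume a: "a \<in> topspace ?A" and ij: "i \<in> Jp" "j \<in> Jp" "i \<le> j" and p: "p \<in> topspace (N j)"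
    have J: "i \<in> J" "j \<in> J" using ij Jp_subset by auto
    have "snd a \<in> topspace H" "0 \<le> fst a" "fst a \<le> 1" using a by auto
    then show "?\<xi> a i p = hom_functor_map i j (?\<xi> a j p)"
      unfolding hom_functor_map_J[OF J(1)] by (intro H_compat J ij q p)
  qed
  then show ?thesis
    by (subst homotopic_with; (intro exI[of _ "\<lambda>a. extend (?\<xi> a)"])?) (auto simp: extend_H)
qed

text \<open>The components of \<open>from_maps g\<close> are constants, so \<open>shrink s\<close>
  is forgotten and only \<open>bary (subdivide s)\<close> remains.\<close>

lemma to_maps_from_maps:
  assumes g: "g \<in> topspace M" and s: "s \<in> realization_points Z"
  shows "to_maps (from_maps g) s = g (bary (subdivide s))"
proof -
  have b: "bottom s \<in> Jp" "subdivide s \<in> topspace (N (bottom s))" "supp (shrink s) \<subseteq> \<Union>(bottom s)"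
    using good_bottom[OF s] by (auto simp: good_def)
  have y: "g (bary (subdivide s)) \<in> realization_points Y"
    by (intro M_point[OF g] bary_in_realization_points subdivide_in_realization_points s)
  show ?thesis
    using s hom_eval_hom_const[OF y shrink_in_realization_points[OF s] b(3)]
    by (simp add: to_maps_def from_maps_def extend_Jp[OF b(1,2)])
qed

lemma homotopic_to_from_maps:
  "homotopic_with (\<lambda>_. True) M M (to_maps \<circ> from_maps) id"
proof -
  let ?q = "\<lambda>l s v. (1 - l) * bary (subdivide s) v + l * s v"
  let ?h = "\<lambda>a. \<lambda>s\<in>realization_points Z. snd a (?q (fst a) s)"
  let ?A = "prod_topology I01 M"
  have c: "continuous_map ?A M ?h"
  proof (rule continuous_map_into_mapping_space)
    show "k_space ?A" by (intro k_space_I01_prod) (simp add: mapping_space_def)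
    show "?h a \<in> extensional (topspace (realization Z))" for a by (simp add: topspace_Z)
    fix C assume C: "compactin ?A C"
    let ?B = "prod_topology (subtopology ?A C) (realization Z)"
    have cB: "compact_space ?B" by (rule compact_space_prod[OF C compact_Hausdorff_Z(1)])
    have "continuous_map ?B (realization Z) (\<lambda>b. ?q (fst (fst b)) (snd b))"
    proof (rule continuous_map_realization_linear[OF scZ cB])
      show "continuous_map ?B (realization Z) (\<lambda>b. bary (subdivide (snd b)))"
        using continuous_map_compose[OF continuous_map_snd
            continuous_map_compose[OF continuous_map_subdivide continuous_map_bary]] by (simp add: o_def)
      show "continuous_map ?B (realization Z) snd" by (rule continuous_map_snd)
      show "continuous_map ?B euclideanreal (\<lambda>q. fst (fst q))" by (rule continuous_map_fst_fst)
      show "0 \<le> fst (fst q) \<and> fst (fst q) \<le> 1" if "q \<in> topspace ?B" for q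
        using that by auto
      show "supp (bary (subdivide (snd b))) \<union> supp (snd b) \<in> Z" if "b \<in> topspace ?B" for b
      proof -
        have s: "snd b \<in> realization_points Z" using that by (auto simp: topspace_Z)
        have "supp (bary (subdivide (snd b))) \<union> supp (snd b) = supp (snd b)"
          using supp_bary_subdivide[OF s] by blast
        then show ?thesis using realization_points_supp(1)[OF s] by simp
      qed
    qed
    then have "continuous_map ?B (realization Y) (\<lambda>b. snd (fst b) (?q (fst (fst b)) (snd b)))"
      by (intro continuous_map_M_eval continuous_map_snd_fst)
    then show "continuous_map ?B (realization Y) (\<lambda>b. ?h (fst b) (snd b))"
      by (rule continuous_map_eq) (auto simp: topspace_Z)
  qed
  have "?h (0, g) = (to_maps \<circ> from_maps) g" if "g \<in> topspace M" for g
  proof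
    fix s show "?h (0, g) s = (to_maps \<circ> from_maps) g s"
      by (cases "s \<in> realization_points Z") (simp_all add: to_maps_from_maps[OF that], simp add: to_maps_def)
  qed
  moreover have "?h (1, g) = id g" if "g \<in> topspace M" for g
  proof
    fix s show "?h (1, g) s = id g s"
      using that by (cases "s \<in> realization_points Z") (simp_all add: mapping_points_def extensional_def topspace_Z)
  qed
  ultimately show ?thesis
    using c by (subst homotopic_with) blast+
qed

lemma weakly_equivalent_holim_mapping_space: "weakly_equivalent H M"
proof (rule weakly_equivalent_of_homotopy_equivalence)
  show "k_space M" by (simp add: mapping_space_def)
  show "Hausdorff_space M" by (intro Hausdorff_space_mapping_space Hausdorff_space_realization scY)
  show "homotopic_with (\<lambda>_. True) H H (from_maps \<circ> to_maps) id"
    using homotopic_from_to_maps_subdivide homotopic_subdivide_id by (rule homotopic_with_trans)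
qed (rule continuous_map_from_maps continuous_map_to_maps homotopic_to_from_maps)+

end

theorem mainTheorem7:
  fixes X :: "'v set set" and Y :: "'w set set"
  assumes "scomplex X" and "scomplex Y" and "finite (verts X)"
  shows "\<forall>Z \<in> SCplx (verts X).
    weakly_equivalent
      (T1 (SCplx (verts X)) (hom_functor Y) hom_functor_map Z)
      (mapping_space (realization Z) (realization Y))"
proof
  fix Z assume Z: "Z \<in> SCplx (verts X)"
  have "Z \<subseteq> Pow (verts X)" using Z by (simp add: SCplx_def)
  then have "finite Z" using assms(3) by (meson finite_Pow_iff finite_subset)
  \<comment> \<open>Only simplices of \<open>Z\<close> index the limit at \<open>Z\<close>, so the
    locale is used for \<open>Z\<close> itself, with \<open>\<Union>Z\<close> in place of the
    ambient vertex set.\<close>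
  then interpret finite_complex_maps Z Y
    by unfold_locales (use scomplex_SCplx[OF assms(3) Z] assms(2) in auto)
  show "weakly_equivalent (T1 (SCplx (verts X)) (hom_functor Y) hom_functor_map Z)
      (mapping_space (realization Z) (realization Y))"
    using weakly_equivalent_holim_mapping_space
    unfolding T1_def join_irreducibles_SCplx_below[OF assms(3) Z] J_def .
qed

end
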